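(* Let $M$ be a closed isoparametric hypersurface in a unit sphere. Then every focal map from $M$ to its focal submanifolds $M_+$ or $M_-$ is harmonic.
   Context: An isoparametric hypersurface $M^n$ in the unit sphere $S^{n+1}(1)$ is a hypersurface with constant principal curvatures. It is not assumed to be minimal. Let $\xi$ be a smooth unit normal field along $M$, and let $\cot\theta_\alpha$ ($\alpha=1,\dots,g$, $0<\theta_1<\cdots<\theta_g<\pi$) be the distinct principal curvatures with respect to $\xi$, with multiplicities $m_\alpha$; by Münzner $m_\alpha=m_{\alpha+2}$ (indices mod $g$). For $\theta\in\mathbb{R}$ define $\varphi_\theta:M\to S^{n+1}(1)$ by $\varphi_\theta(x)=\cos\theta\,x+\sin\theta\,\xi(x)$. If $\cot\theta=\cot\theta_\alpha$ for some $\alpha$, then $\varphi_\theta$ is not an immersion, and its image is a focal submanifold of codimension $m_\alpha+1$ in $S^{n+1}(1)$; the map $\varphi_\theta$ from $M$ to this focal submanifold is called a focal map. There are exactly two distinct focal submanifolds, $M_+$ and $M_-$, of codimension $m_1+1$ and $m_2+1$ respectively, but there may be more than two focal maps. $M$ and $M_\pm$ carry the metrics induced from $S^{n+1}(1)$. A smooth map $f:M\to N$ of closed Riemannian manifolds is harmonic if it is a critical point of the energy $E(f)=\frac12\int_M|df|^2dV_M$. *)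

theory Defs
  imports "HOL-Analysis.Analysis"
begin

section \<open>Smooth maps and submanifolds of Euclidean space\<close>

text \<open>Maps all of whose iterated directional derivatives up to order \<open>k\<close> exist, are Frechet
  differentiable below order \<open>k\<close>, and are continuous. Intended for open \<open>U\<close>, where it is the usual
  notion of a smooth map once it holds for all \<open>k\<close>.\<close>

primrec ck_on ::
  "nat \<Rightarrow> 'a::euclidean_space set \<Rightarrow> ('a \<Rightarrow> 'b::euclidean_space) \<Rightarrow> bool" where
  "ck_on 0 U f \<longleftrightarrow> continuous_on U f"
| "ck_on (Suc k) U f \<longleftrightarrow>
     (\<forall>x\<in>U. f differentiable (at x)) \<and>
     (\<forall>v. ck_on k U (\<lambda>x. frechet_derivative f (at x) v))"

definition smooth_on_open ::
  "'a::euclidean_space set \<Rightarrow> ('a \<Rightarrow> 'b::euclidean_space) \<Rightarrow> bool" where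
  "smooth_on_open U f \<longleftrightarrow> open U \<and> (\<forall>k. ck_on k U f)"

definition smooth_map_on ::
  "'a::euclidean_space set \<Rightarrow> ('a \<Rightarrow> 'b::euclidean_space) \<Rightarrow> bool" where
  "smooth_map_on M f \<longleftrightarrow>
     (\<forall>p\<in>M. \<exists>U g. p \<in> U \<and> smooth_on_open U g \<and> (\<forall>x\<in>M \<inter> U. g x = f x))"

definition local_parametrization ::
  "'a::euclidean_space set \<Rightarrow> (real^'n) set \<Rightarrow> (real^'n \<Rightarrow> 'a) \<Rightarrow> bool" where
  "local_parametrization M W \<psi> \<longleftrightarrow>
     smooth_on_open W \<psi> \<and>
     (\<forall>u\<in>W. inj (frechet_derivative \<psi> (at u))) \<and>
     openin (top_of_set M) (\<psi> ` W) \<and>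
     (\<exists>\<rho>. homeomorphism W (\<psi> ` W) \<psi> \<rho>)"

text \<open>Embedded submanifolds without boundary, of dimension \<open>CARD('n)\<close>; the type argument
  supplies the coordinate space \<open>real^'n\<close>.\<close>

definition embedded_submanifold :: "'n::finite itself \<Rightarrow> 'a::euclidean_space set \<Rightarrow> bool" where
  "embedded_submanifold n M \<longleftrightarrow>
     (\<forall>p\<in>M. \<exists>W (\<psi> :: real^'n \<Rightarrow> 'a). local_parametrization M W \<psi> \<and> p \<in> \<psi> ` W)"

definition tangent_space :: "'a::euclidean_space set \<Rightarrow> 'a \<Rightarrow> 'a set" where
  "tangent_space M p =
     {v. \<exists>\<epsilon>>0. \<exists>\<gamma>. smooth_on_open {-\<epsilon><..<\<epsilon>} \<gamma> \<and> \<gamma> ` {-\<epsilon><..<\<epsilon>} \<subseteq> M \<and>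
           \<gamma> 0 = p \<and> (\<gamma> has_vector_derivative v) (at (0::real))}"

text \<open>The differential of \<open>f\<close> along \<open>M\<close>. A Frechet derivative within \<open>M\<close> is only determined on
  \<open>tangent_space M p\<close>, so this is to be applied to tangent vectors only; there it is
  \<open>df(\<gamma>'(0)) = (f \<circ> \<gamma>)'(0)\<close>.\<close>

definition differential_on ::
  "'a::euclidean_space set \<Rightarrow> ('a \<Rightarrow> 'b::euclidean_space) \<Rightarrow> 'a \<Rightarrow> 'a \<Rightarrow> 'b" where
  "differential_on M f p = frechet_derivative f (at p within M)"


section \<open>Riemannian volume, energy, harmonic maps\<close>

text \<open>Submanifolds carry the metric induced from the ambient inner product.\<close>

definition gram_matrix :: "(real^'n \<Rightarrow> 'a::euclidean_space) \<Rightarrow> real^'n \<Rightarrow> real^'n^'n" where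
  "gram_matrix \<psi> u =
     (\<chi> i j. frechet_derivative \<psi> (at u) (axis i 1) \<bullet> frechet_derivative \<psi> (at u) (axis j 1))"

definition is_riemannian_volume ::
  "'n::finite itself \<Rightarrow> 'a::euclidean_space set \<Rightarrow> 'a measure \<Rightarrow> bool" where
  "is_riemannian_volume n M \<mu> \<longleftrightarrow>
     space \<mu> = M \<and> sets \<mu> = sets (restrict_space borel M) \<and>
     (\<forall>W (\<psi> :: real^'n \<Rightarrow> 'a). local_parametrization M W \<psi> \<longrightarrow>
        (\<forall>A\<in>sets borel. A \<subseteq> W \<longrightarrow>
           emeasure \<mu> (\<psi> ` A) = (\<integral>\<^sup>+u\<in>A. ennreal (sqrt (det (gram_matrix \<psi> u))) \<partial>lborel)))"

definition riemannian_volume ::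
  "'n::finite itself \<Rightarrow> 'a::euclidean_space set \<Rightarrow> 'a measure" where
  "riemannian_volume n M = (THE \<mu>. is_riemannian_volume n M \<mu>)"

definition orthonormal_basis_of :: "'a::euclidean_space set \<Rightarrow> 'a set \<Rightarrow> bool" where
  "orthonormal_basis_of T B \<longleftrightarrow>
     B \<subseteq> T \<and> pairwise orthogonal B \<and> (\<forall>e\<in>B. norm e = 1) \<and> span B = T"

text \<open>\<open>|df|\<^sup>2\<close> at \<open>x\<close>; the sum does not depend on the chosen orthonormal basis.\<close>

definition differential_norm_sq ::
  "'a::euclidean_space set \<Rightarrow> ('a \<Rightarrow> 'b::euclidean_space) \<Rightarrow> 'a \<Rightarrow> real" where
  "differential_norm_sq M f x =
     (\<Sum>e\<in>(SOME B. orthonormal_basis_of (tangent_space M x) B). (norm (differential_on M f x e))\<^sup>2)"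

definition energy ::
  "'n::finite itself \<Rightarrow> 'a::euclidean_space set \<Rightarrow> ('a \<Rightarrow> 'b::euclidean_space) \<Rightarrow> real" where
  "energy n M f = 1/2 * (\<integral>x. differential_norm_sq M f x \<partial>riemannian_volume n M)"

definition smooth_variation ::
  "'a::euclidean_space set \<Rightarrow> 'b::euclidean_space set \<Rightarrow> ('a \<Rightarrow> 'b) \<Rightarrow> real \<Rightarrow>
   (real \<Rightarrow> 'a \<Rightarrow> 'b) \<Rightarrow> bool" where
  "smooth_variation M N f \<epsilon> F \<longleftrightarrow>
     \<epsilon> > 0 \<and>
     smooth_map_on ({-\<epsilon><..<\<epsilon>} \<times> M) (\<lambda>(t, x). F t x) \<and>
     (\<forall>t\<in>{-\<epsilon><..<\<epsilon>}. F t ` M \<subseteq> N) \<and>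
     (\<forall>x\<in>M. F 0 x = f x)"

text \<open>Critical points of the energy among smooth maps \<open>M \<rightarrow> N\<close>. For an embedded submanifold \<open>N\<close>
  of the ambient space, a map into \<open>N\<close> is smooth iff it is smooth as a map into the ambient space,
  and its energy may be computed with the ambient norm.\<close>

definition harmonic_map ::
  "'n::finite itself \<Rightarrow> 'a::euclidean_space set \<Rightarrow> 'b::euclidean_space set \<Rightarrow> ('a \<Rightarrow> 'b) \<Rightarrow> bool" where
  "harmonic_map n M N f \<longleftrightarrow>
     smooth_map_on M f \<and> f ` M \<subseteq> N \<and>
     (\<forall>\<epsilon> F. smooth_variation M N f \<epsilon> F \<longrightarrow>
        ((\<lambda>t. energy n M (F t)) has_real_derivative 0) (at 0))"


section \<open>Isoparametric hypersurfaces and focal maps\<close>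

definition sphere_hypersurface :: "'n::finite itself \<Rightarrow> 'a::euclidean_space set \<Rightarrow> bool" where
  "sphere_hypersurface n M \<longleftrightarrow>
     DIM('a) = CARD('n) + 2 \<and> M \<subseteq> sphere 0 1 \<and> M \<noteq> {} \<and> connected M \<and> embedded_submanifold n M"

definition unit_normal_field :: "'a::euclidean_space set \<Rightarrow> ('a \<Rightarrow> 'a) \<Rightarrow> bool" where
  "unit_normal_field M \<xi> \<longleftrightarrow>
     smooth_map_on M \<xi> \<and>
     (\<forall>x\<in>M. norm (\<xi> x) = 1 \<and> \<xi> x \<bullet> x = 0 \<and> (\<forall>v\<in>tangent_space M x. \<xi> x \<bullet> v = 0))"

text \<open>The covariant derivative of \<open>\<xi>\<close> in the sphere equals its derivative in the ambient space,
  since \<open>d\<xi>(v) \<bullet> x = - \<xi>(x) \<bullet> v = 0\<close> for tangent \<open>v\<close>. The sign is the one for which the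
  differential of \<open>cos \<theta> x + sin \<theta> \<xi>(x)\<close> kills the eigenvectors of eigenvalue \<open>cot \<theta>\<close>.\<close>

definition shape_operator :: "'a::euclidean_space set \<Rightarrow> ('a \<Rightarrow> 'a) \<Rightarrow> 'a \<Rightarrow> 'a \<Rightarrow> 'a" where
  "shape_operator M \<xi> x v = - differential_on M \<xi> x v"

definition curvature_space ::
  "'a::euclidean_space set \<Rightarrow> ('a \<Rightarrow> 'a) \<Rightarrow> 'a \<Rightarrow> real \<Rightarrow> 'a set" where
  "curvature_space M \<xi> x \<kappa> = {v \<in> tangent_space M x. shape_operator M \<xi> x v = \<kappa> *\<^sub>R v}"

definition principal_curvature_at ::
  "'a::euclidean_space set \<Rightarrow> ('a \<Rightarrow> 'a) \<Rightarrow> 'a \<Rightarrow> real \<Rightarrow> bool" where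
  "principal_curvature_at M \<xi> x \<kappa> \<longleftrightarrow> (\<exists>v\<in>curvature_space M \<xi> x \<kappa>. v \<noteq> 0)"

text \<open>Constancy of the principal curvatures counted with multiplicity.\<close>

definition constant_principal_curvatures ::
  "'a::euclidean_space set \<Rightarrow> ('a \<Rightarrow> 'a) \<Rightarrow> bool" where
  "constant_principal_curvatures M \<xi> \<longleftrightarrow>
     (\<forall>x\<in>M. \<forall>y\<in>M. \<forall>\<kappa>. dim (curvature_space M \<xi> x \<kappa>) = dim (curvature_space M \<xi> y \<kappa>))"

definition isoparametric_hypersurface ::
  "'n::finite itself \<Rightarrow> 'a::euclidean_space set \<Rightarrow> ('a \<Rightarrow> 'a) \<Rightarrow> bool" where
  "isoparametric_hypersurface n M \<xi> \<longleftrightarrow>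
     sphere_hypersurface n M \<and> unit_normal_field M \<xi> \<and> constant_principal_curvatures M \<xi>"

definition parallel_map :: "('a::euclidean_space \<Rightarrow> 'a) \<Rightarrow> real \<Rightarrow> 'a \<Rightarrow> 'a" where
  "parallel_map \<xi> \<theta> x = cos \<theta> *\<^sub>R x + sin \<theta> *\<^sub>R \<xi> x"

text \<open>Here \<open>\<theta>\<close> ranges over all reals with \<open>cot \<theta> = cot \<theta>\<^sub>\<alpha>\<close> for some \<open>\<alpha>\<close>. The condition on \<open>sin \<theta>\<close>
  is needed because \<open>cot 0 = 0\<close> in HOL.\<close>

definition focal_angle :: "'a::euclidean_space set \<Rightarrow> ('a \<Rightarrow> 'a) \<Rightarrow> real \<Rightarrow> bool" where
  "focal_angle M \<xi> \<theta> \<longleftrightarrow> sin \<theta> \<noteq> 0 \<and> (\<exists>x\<in>M. principal_curvature_at M \<xi> x (cot \<theta>))"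

text \<open>The focal submanifold belonging to \<open>\<theta>\<close> is the image of the focal map; by Muenzner it is one
  of \<open>M\<^sub>+\<close>, \<open>M\<^sub>-\<close>.\<close>

definition focal_submanifold :: "'a::euclidean_space set \<Rightarrow> ('a \<Rightarrow> 'a) \<Rightarrow> real \<Rightarrow> 'a set" where
  "focal_submanifold M \<xi> \<theta> = parallel_map \<xi> \<theta> ` M"

end

theory Submission
  imports Defs
begin

text \<open>The differential of the focal map \<open>\<phi>\<close> acts on \<open>T\<^sub>xM\<close> as the symmetric endomorphism
  \<open>S = cos \<theta> - sin \<theta> A\<close>, with \<open>A\<close> the shape operator. Since the principal curvatures are constant,
  so are the rank and the trace of \<open>S\<close>.

  Let \<open>V\<close> be the velocity at time \<open>0\<close> of a variation \<open>F\<^sub>t\<close> of \<open>\<phi>\<close> with values in \<open>N = \<phi>(M)\<close>. By the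
  constant rank theorem \<open>N\<close> is a finite union of compact pieces whose tangent cones have dimension at
  most the rank of \<open>S\<close>. For \<open>x\<close> in a dense set, every piece through \<open>\<phi>(x)\<close> contains \<open>\<phi>\<close> of a
  neighbourhood of \<open>x\<close>, so its tangent cone is \<open>d\<phi>(T\<^sub>xM) \<subseteq> T\<^sub>xM\<close>, which then contains \<open>V(x)\<close>. By
  continuity \<open>V\<close> is tangent to \<open>M\<close> everywhere.

  The first variation is the integral of \<open>\<langle>d\<phi>, dV\<rangle> = tr (S \<nabla>V)\<close>. By the Codazzi equation and the
  constancy of \<open>tr S\<close> the endomorphism \<open>S\<close> is divergence free, so the integrand is \<open>div (S V)\<close> and its
  integral over the closed manifold \<open>M\<close> vanishes.\<close>

section \<open>Calculus of maps of class \<open>C\<^sup>k\<close>\<close>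

text \<open>The target is given only as the set \<phi>(M), and a variation is only known to stay in
  it. The obstacle is that several sheets of this set may pass through one point: a curve in it that
  starts at \<phi>(x) may follow a sheet other than the one traced by \<phi> near x, and then its
  velocity need not lie in the image of d\<phi>. This is why tangent cones of closed pieces are
  used, and why x is first restricted to a dense set.

  Tangency of V to M has to be secured because components of V along x or \<xi> would contribute to
  the first variation: V = h x adds h tr S and V = h \<xi> adds -h tr (S A). Tangency amounts to two
  equations, so it survives limits.

  The volume is a definite description and |df|^2 refers to an arbitrarily chosen orthonormal basis;
  both must be replaced by coordinate expressions before anything can be differentiated. In such
  coordinates the Codazzi equation is the symmetry of the second derivatives of \<phi> composed with
  a chart.\<close>

abbreviation ddiff :: "('a::euclidean_space \<Rightarrow> 'b::euclidean_space) \<Rightarrow> 'a \<Rightarrow> 'a \<Rightarrow> 'b" where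
  "ddiff f v \<equiv> (\<lambda>x. frechet_derivative f (at x) v)"

lemma frechet_derivative_cong_open:
  fixes f :: "'a::euclidean_space \<Rightarrow> 'b::euclidean_space"
  assumes "open U" "x \<in> U" "\<And>y. y \<in> U \<Longrightarrow> f y = g y"
  shows "frechet_derivative f (at x) = frechet_derivative g (at x)"
    and "f differentiable (at x) \<longleftrightarrow> g differentiable (at x)"
proof -
  have "(f has_derivative D) (at x) \<longleftrightarrow> (g has_derivative D) (at x)" for D
    using has_derivative_transform_within_open[of f D x UNIV U g]
      has_derivative_transform_within_open[of g D x UNIV U f] assms by auto
  then show "frechet_derivative f (at x) = frechet_derivative g (at x)"
    and "f differentiable (at x) \<longleftrightarrow> g differentiable (at x)"
    by (simp_all add: frechet_derivative_def differentiable_def)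
qed

lemma ck_on_cong:
  assumes "open U" "\<And>y. y \<in> U \<Longrightarrow> f y = g y"
  shows "ck_on k U f \<longleftrightarrow> ck_on k U g"
  using assms(2)
proof (induction k arbitrary: f g)
  case 0
  then show ?case by (simp cong: continuous_on_cong)
next
  case (Suc k)
  have eq: "frechet_derivative f (at x) = frechet_derivative g (at x)"
      "f differentiable (at x) \<longleftrightarrow> g differentiable (at x)" if "x \<in> U" for x
    by (rule frechet_derivative_cong_open[OF assms(1) that]; rule Suc.prems; assumption)+
  have "ck_on k U (ddiff f v) \<longleftrightarrow> ck_on k U (ddiff g v)" for v
    by (rule Suc.IH) (simp add: eq)
  then show ?case by (simp add: eq)
qed

lemma ck_on_subset: "ck_on k U f \<Longrightarrow> V \<subseteq> U \<Longrightarrow> ck_on k V f"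
proof (induction k arbitrary: f)
  case 0
  then show ?case using continuous_on_subset by auto
next
  case (Suc k)
  then have "ck_on k V (ddiff f v)" for v by simp
  with Suc.prems show ?case by auto
qed

text \<open>Regularity of composites along charts and of functions extended by zero is available
  only near each point; this glues it.\<close>

lemma ck_on_local:
  assumes "\<And>x. x \<in> U \<Longrightarrow> \<exists>V. open V \<and> x \<in> V \<and> ck_on k V f"
  shows "ck_on k U f"
  using assms
proof (induction k arbitrary: f)
  case 0
  have "isCont f x" if "x \<in> U" for x
    using 0[OF that] by (auto simp: continuous_on_eq_continuous_at)
  then show ?case by (simp add: continuous_at_imp_continuous_on)
next
  case (Suc k)
  have "f differentiable (at x)" if "x \<in> U" for x
    using Suc.prems[OF that] by auto
  moreover have "ck_on k U (ddiff f v)" for v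
  proof (rule Suc.IH)
    fix x assume "x \<in> U"
    then show "\<exists>V. open V \<and> x \<in> V \<and> ck_on k V (ddiff f v)"
      using Suc.prems[of x] by auto
  qed
  ultimately show ?case by simp
qed

lemma ck_on_Suc_imp: "ck_on (Suc k) U f \<Longrightarrow> ck_on k U f"
proof (induction k arbitrary: f)
  case 0
  then show ?case
    by (auto intro!: continuous_at_imp_continuous_on differentiable_imp_continuous_within)
next
  case (Suc k)
  have "ck_on k U (ddiff f v)" for v
    by (rule Suc.IH) (use Suc.prems in simp)
  then show ?case using Suc.prems by simp
qed

lemma ck_on_le: "ck_on k U f \<Longrightarrow> j \<le> k \<Longrightarrow> ck_on j U f"
  by (induction k) (use ck_on_Suc_imp in \<open>auto simp del: ck_on.simps simp: le_Suc_eq\<close>)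

lemma ck_on_imp_continuous_on: "ck_on k U f \<Longrightarrow> continuous_on U f"
  using ck_on_le[of k U f 0] by simp

lemma ck_on_ddiff: "ck_on (Suc k) U f \<Longrightarrow> ck_on k U (ddiff f v)"
  by simp

lemma ck_on_has_derivative:
  "ck_on (Suc k) U f \<Longrightarrow> x \<in> U \<Longrightarrow> (f has_derivative frechet_derivative f (at x)) (at x)"
  by (simp add: frechet_derivative_works)

text \<open>\<open>ck_on\<close> refers to the derivative selected by
  \<open>frechet_derivative\<close>; uniqueness of derivatives allows an explicit formula
  \<open>f'\<close> in its place.\<close>

lemma ck_on_SucI:
  fixes f :: "'a::euclidean_space \<Rightarrow> 'b::euclidean_space"
  assumes "open U" and f': "\<And>x. x \<in> U \<Longrightarrow> (f has_derivative f' x) (at x)"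
    and ck: "\<And>v. ck_on k U (\<lambda>x. f' x v)"
  shows "ck_on (Suc k) U f"
proof -
  have "ck_on k U (ddiff f v)" for v
  proof -
    have "ddiff f v x = f' x v" if "x \<in> U" for x
      using frechet_derivative_at[OF f'[OF that]] by metis
    then show ?thesis
      using ck_on_cong[OF \<open>open U\<close>, of "ddiff f v" "\<lambda>x. f' x v" k] ck[of v] by blast
  qed
  then show ?thesis using f' by (auto simp: differentiable_def)
qed

lemma ck_on_const: "ck_on k U (\<lambda>x. c)"
  by (induction k arbitrary: c) auto

lemma ck_on_bounded_linear:
  assumes "open U" "bounded_linear L" "ck_on k U f"
  shows "ck_on k U (\<lambda>x. L (f x))"
  using assms(3)
proof (induction k arbitrary: f)
  case 0
  then show ?case using assms(2) by (simp add: bounded_linear.continuous_on)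
next
  case (Suc k)
  show ?case
    by (rule ck_on_SucI[OF \<open>open U\<close>, where f' = "\<lambda>x v. L (ddiff f v x)"])
      (use Suc assms(2) in \<open>auto intro!: bounded_linear.has_derivative[OF assms(2)]
          ck_on_has_derivative[OF Suc.prems]\<close>)
qed

lemma ck_on_id: "ck_on k U (\<lambda>x. x)"
  by (cases k) (auto simp: ck_on_const frechet_derivative_ident)

lemma ck_on_add:
  assumes "open U" "ck_on k U f" "ck_on k U g"
  shows "ck_on k U (\<lambda>x. f x + g x)"
  using assms(2,3)
proof (induction k arbitrary: f g)
  case 0
  then show ?case by (simp add: continuous_on_add)
next
  case (Suc k)
  show ?case
    by (rule ck_on_SucI[OF \<open>open U\<close>, where f' = "\<lambda>x v. ddiff f v x + ddiff g v x"])
      (use Suc in \<open>auto intro!: has_derivative_add ck_on_has_derivative[OF Suc.prems(1)]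
          ck_on_has_derivative[OF Suc.prems(2)]\<close>)
qed

lemma ck_on_sum:
  assumes "open U" "\<And>i. i \<in> I \<Longrightarrow> ck_on k U (f i)"
  shows "ck_on k U (\<lambda>x. \<Sum>i\<in>I. f i x)"
  using assms(2)
  by (induction I rule: infinite_finite_induct) (auto simp: ck_on_const intro!: ck_on_add[OF assms(1)])

lemma ck_on_bilinear:
  fixes prod :: "'b::euclidean_space \<Rightarrow> 'c::euclidean_space \<Rightarrow> 'd::euclidean_space"
  assumes "bounded_bilinear prod" "open U" "ck_on k U f" "ck_on k U g"
  shows "ck_on k U (\<lambda>x. prod (f x) (g x))"
  using assms(3,4)
proof (induction k arbitrary: f g)
  case 0
  then show ?case by (simp add: bounded_bilinear.continuous_on[OF assms(1)])
next
  case (Suc k)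
  show ?case
  proof (rule ck_on_SucI[OF \<open>open U\<close>])
    show "((\<lambda>x. prod (f x) (g x)) has_derivative
        (\<lambda>v. prod (f x) (ddiff g v x) + prod (ddiff f v x) (g x))) (at x)" if "x \<in> U" for x
      by (rule bounded_bilinear.FDERIV[OF assms(1)])
        (use that Suc.prems in \<open>auto intro: ck_on_has_derivative\<close>)
    show "ck_on k U (\<lambda>x. prod (f x) (ddiff g v x) + prod (ddiff f v x) (g x))" for v
      using Suc.prems Suc.prems[THEN ck_on_Suc_imp]
      by (intro ck_on_add[OF \<open>open U\<close>] Suc.IH) auto
  qed
qed

lemmas ck_on_scaleR = ck_on_bilinear[OF bounded_bilinear_scaleR]
lemmas ck_on_inner = ck_on_bilinear[OF bounded_bilinear_inner]
lemmas ck_on_mult = ck_on_bilinear[OF bounded_bilinear_mult[where 'a = real]]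

lemma ck_on_compose:
  fixes f :: "'a::euclidean_space \<Rightarrow> 'b::euclidean_space" and g :: "'b \<Rightarrow> 'c::euclidean_space"
  assumes "open U" "open V" "ck_on k U f" "ck_on k V g" "f ` U \<subseteq> V"
  shows "ck_on k U (\<lambda>x. g (f x))"
  using assms(3,4)
proof (induction k arbitrary: g)
  case 0
  then show ?case using assms(5) by (auto intro: continuous_on_compose2)
next
  case (Suc k)
  \<comment> \<open>In the chain rule the direction \<open>ddiff f v x\<close> moves with
    \<open>x\<close>, while the induction hypothesis concerns fixed directions. Expanding the
    direction over \<open>Basis\<close> leaves sums of products of functions of class C^k.\<close>
  let ?d = "\<lambda>x v. \<Sum>b\<in>Basis. (ddiff f v x \<bullet> b) *\<^sub>R ddiff g b (f x)"
  have eq: "?d x v = frechet_derivative g (at (f x)) (frechet_derivative f (at x) v)"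
    if "x \<in> U" for x v
  proof -
    have "linear (frechet_derivative g (at (f x)))"
      using ck_on_has_derivative[OF Suc.prems(2)] that assms(5) has_derivative_linear by blast
    then show ?thesis
      by (subst (3) euclidean_representation[symmetric]) (simp only: linear_sum linear_scale)
  qed
  show ?case
  proof (rule ck_on_SucI[OF \<open>open U\<close>])
    show "((\<lambda>x. g (f x)) has_derivative ?d x) (at x)" if "x \<in> U" for x
      unfolding eq[OF that]
      by (rule has_derivative_compose[OF ck_on_has_derivative[OF Suc.prems(1) that]])
        (use that assms(5) in \<open>auto intro!: ck_on_has_derivative[OF Suc.prems(2)]\<close>)
    show "ck_on k U (\<lambda>x. ?d x v)" for v
      using Suc.prems ck_on_Suc_imp[OF Suc.prems(1)]
      by (intro ck_on_sum ck_on_scaleR ck_on_inner ck_on_const Suc.IH \<open>open U\<close>) auto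
  qed
qed

lemma ck_on_minus: "open U \<Longrightarrow> ck_on k U f \<Longrightarrow> ck_on k U (\<lambda>x. - f x)"
  by (rule ck_on_bounded_linear[OF _ bounded_linear_minus[OF bounded_linear_ident]])

lemma ck_on_diff:
  "open U \<Longrightarrow> ck_on k U f \<Longrightarrow> ck_on k U g \<Longrightarrow> ck_on k U (\<lambda>x. f x - g x)"
  using ck_on_add[of U k f "\<lambda>x. - g x"] ck_on_minus[of U k g] by simp

lemma ck_on_Pair:
  assumes "open U" "ck_on k U f" "ck_on k U g"
  shows "ck_on k U (\<lambda>x. (f x, g x))"
proof -
  have "ck_on k U (\<lambda>x. (f x, 0) + (0, g x))"
    by (intro ck_on_add[OF \<open>open U\<close>] ck_on_bounded_linear[OF \<open>open U\<close> _ assms(2)]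
        ck_on_bounded_linear[OF \<open>open U\<close> _ assms(3)] bounded_linear_Pair bounded_linear_ident
        bounded_linear_zero)
  then show ?thesis by simp
qed

lemma ck_on_prod:
  fixes f :: "'i \<Rightarrow> 'a::euclidean_space \<Rightarrow> real"
  assumes "open U" "\<And>i. i \<in> I \<Longrightarrow> ck_on k U (f i)"
  shows "ck_on k U (\<lambda>x. \<Prod>i\<in>I. f i x)"
  using assms(2)
  by (induction I rule: infinite_finite_induct) (auto simp: ck_on_const intro!: ck_on_mult[OF assms(1)])

lemma ck_on_inverse_real: "ck_on k {x::real. x \<noteq> 0} inverse"
proof (induction k)
  case 0
  then show ?case by (auto intro!: continuous_intros)
next
  case (Suc k)
  have op: "open {x::real. x \<noteq> 0}"
    by (simp add: open_Collect_neq)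
  show ?case
    by (rule ck_on_SucI[OF op, where f' = "\<lambda>x v. - (inverse x * inverse x) * v"])
      (auto intro!: ck_on_mult[OF op] ck_on_minus[OF op] Suc ck_on_const derivative_eq_intros
        simp: power2_eq_square)
qed

lemma ck_on_sqrt_real: "ck_on k {0<..} sqrt"
proof (induction k)
  case 0
  then show ?case by (auto intro!: continuous_intros)
next
  case (Suc k)
  have "ck_on k {0<..} (\<lambda>x. inverse (sqrt x))"
    by (rule ck_on_compose[OF _ _ Suc ck_on_inverse_real]) (auto simp: open_Collect_neq)
  then have "ck_on k {0<..} (\<lambda>x. inverse (sqrt x) * (v / 2))" for v
    by (intro ck_on_mult ck_on_const) auto
  moreover have "(sqrt has_derivative (\<lambda>v. inverse (sqrt x) * (v / 2))) (at x)" if "x \<in> {0<..}" for x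
  proof -
    have "(sqrt has_derivative (*) (inverse (sqrt x) / 2)) (at x)"
      using DERIV_real_sqrt[of x] that by (simp add: has_field_derivative_def)
    then show ?thesis
      by (rule has_derivative_eq_rhs) (simp add: fun_eq_iff)
  qed
  ultimately show ?case
    by (intro ck_on_SucI[where f' = "\<lambda>x v. inverse (sqrt x) * (v / 2)"]) auto
qed

lemma ck_on_inverse:
  fixes f :: "'a::euclidean_space \<Rightarrow> real"
  assumes "open U" "ck_on k U f" "\<And>x. x \<in> U \<Longrightarrow> f x \<noteq> 0"
  shows "ck_on k U (\<lambda>x. inverse (f x))"
  by (rule ck_on_compose[OF assms(1) _ assms(2) ck_on_inverse_real])
    (use assms(3) in \<open>auto simp: open_Collect_neq\<close>)

lemma ck_on_sqrt:
  fixes f :: "'a::euclidean_space \<Rightarrow> real"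
  assumes "open U" "ck_on k U f" "\<And>x. x \<in> U \<Longrightarrow> 0 < f x"
  shows "ck_on k U (\<lambda>x. sqrt (f x))"
  by (rule ck_on_compose[OF assms(1) _ assms(2) ck_on_sqrt_real]) (use assms(3) in auto)

section \<open>Symmetry of second derivatives\<close>

lemma has_vector_derivative_line:
  assumes "(f has_derivative f') (at (x + s *\<^sub>R v))"
  shows "((\<lambda>t. f (x + t *\<^sub>R v)) has_vector_derivative f' v) (at s)"
proof -
  have "((\<lambda>t. x + t *\<^sub>R v) has_vector_derivative v) (at s)"
    by (auto intro!: derivative_eq_intros)
  from vector_derivative_diff_chain_within[OF this, of f f']
  show ?thesis using assms by (simp add: o_def has_derivative_at_withinI)
qed

lemma has_real_derivative_line:
  fixes f :: "'a::real_normed_vector \<Rightarrow> real"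
  assumes "(f has_derivative f') (at (x + s *\<^sub>R v))"
  shows "((\<lambda>t. f (x + t *\<^sub>R v)) has_real_derivative f' v) (at s)"
  using has_vector_derivative_line[OF assms] by (simp add: has_real_derivative_iff_has_vector_derivative)

text \<open>The second difference over a parallelogram is symmetric in \<open>v\<close> and
  \<open>w\<close>, so evaluating it by two mean value theorems in either order compares the two
  mixed derivatives at nearby points.\<close>

lemma second_difference_mean_value:
  fixes f :: "'a::euclidean_space \<Rightarrow> real"
  assumes "ck_on (Suc (Suc 0)) U f" "h > 0"
    and "\<And>s t. 0 \<le> s \<Longrightarrow> s \<le> h \<Longrightarrow> 0 \<le> t \<Longrightarrow> t \<le> h \<Longrightarrow> x + s *\<^sub>R v + t *\<^sub>R w \<in> U"
  obtains s t where "0 < s" "s < h" "0 < t" "t < h"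
    "f (x + h *\<^sub>R v + h *\<^sub>R w) - f (x + h *\<^sub>R v) - f (x + h *\<^sub>R w) + f x
      = h * h * ddiff (ddiff f v) w (x + s *\<^sub>R v + t *\<^sub>R w)"
proof -
  define p where "p s = f (x + h *\<^sub>R w + s *\<^sub>R v) - f (x + s *\<^sub>R v)" for s
  have p': "(p has_real_derivative ddiff f v (x + h *\<^sub>R w + s *\<^sub>R v) - ddiff f v (x + s *\<^sub>R v)) (at s)"
    if "0 \<le> s" "s \<le> h" for s
    unfolding p_def
    by (intro DERIV_diff has_real_derivative_line ck_on_has_derivative[OF assms(1)])
      (use that assms(2) assms(3)[of s h] assms(3)[of s 0] in \<open>auto simp: algebra_simps\<close>)
  have "\<exists>s>0. s < h \<and> p h - p 0 = (h - 0) * (ddiff f v (x + h *\<^sub>R w + s *\<^sub>R v) - ddiff f v (x + s *\<^sub>R v))"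
    by (rule MVT2[OF assms(2)]) (rule p')
  then obtain s where s: "0 < s" "s < h"
    "p h - p 0 = (h - 0) * (ddiff f v (x + h *\<^sub>R w + s *\<^sub>R v) - ddiff f v (x + s *\<^sub>R v))"
    by blast
  define q where "q t = ddiff f v (x + s *\<^sub>R v + t *\<^sub>R w)" for t
  have q': "(q has_real_derivative ddiff (ddiff f v) w (x + s *\<^sub>R v + t *\<^sub>R w)) (at t)"
    if "0 \<le> t" "t \<le> h" for t
    unfolding q_def
    by (intro has_real_derivative_line ck_on_has_derivative[OF ck_on_ddiff[OF assms(1)]])
      (use that s assms(3)[of s t] in auto)
  have "\<exists>t>0. t < h \<and> q h - q 0 = (h - 0) * ddiff (ddiff f v) w (x + s *\<^sub>R v + t *\<^sub>R w)"
    by (rule MVT2[OF assms(2)]) (rule q')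
  then obtain t where t: "0 < t" "t < h"
    "q h - q 0 = (h - 0) * ddiff (ddiff f v) w (x + s *\<^sub>R v + t *\<^sub>R w)"
    by blast
  show thesis
    by (rule that[OF s(1,2) t(1,2)]) (use s(3) t(3) in \<open>simp add: p_def q_def algebra_simps\<close>)
qed

lemma ddiff_commute_real:
  fixes f :: "'a::euclidean_space \<Rightarrow> real"
  assumes "open U" "ck_on (Suc (Suc 0)) U f" "x \<in> U"
  shows "ddiff (ddiff f v) w x = ddiff (ddiff f w) v x"
proof (rule ccontr)
  let ?A = "ddiff (ddiff f v) w" and ?B = "ddiff (ddiff f w) v"
  assume ne: "?A x \<noteq> ?B x"
  define e where "e = \<bar>?A x - ?B x\<bar> / 2"
  have e: "e > 0" using ne by (simp add: e_def)
  have "isCont ?A x" "isCont ?B x"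
    using assms by (auto simp: continuous_on_eq_continuous_at)
  then obtain d1 d2 where d: "d1 > 0" "d2 > 0"
    "\<And>y. dist y x < d1 \<Longrightarrow> dist (?A y) (?A x) < e" "\<And>y. dist y x < d2 \<Longrightarrow> dist (?B y) (?B x) < e"
    using e unfolding continuous_at_eps_delta by metis
  obtain d0 where d0: "d0 > 0" "ball x d0 \<subseteq> U"
    using assms openE by blast
  define r where "r = min d0 (min d1 d2)"
  \<comment> \<open>The parallelogram with sides \<open>h *\<^sub>R v\<close> and
    \<open>h *\<^sub>R w\<close> stays within distance r/2 of \<open>x\<close>; the summand 1 keeps
    the denominator positive when both vectors vanish.\<close>
  define h where "h = r / (2 * (norm v + norm w + 1))"
  have "r > 0" using d d0 by (simp add: r_def)
  have h: "h > 0" using \<open>r > 0\<close> by (simp add: h_def add_nonneg_pos)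
  have near: "dist (x + s *\<^sub>R v + t *\<^sub>R w) x < r" if "0 \<le> s" "s \<le> h" "0 \<le> t" "t \<le> h" for s t
  proof -
    have "dist (x + s *\<^sub>R v + t *\<^sub>R w) x \<le> norm (s *\<^sub>R v) + norm (t *\<^sub>R w)"
      using norm_triangle_ineq[of "s *\<^sub>R v" "t *\<^sub>R w"] by (simp add: dist_norm)
    also have "\<dots> \<le> h * norm v + h * norm w"
      using that by (auto intro!: add_mono mult_right_mono)
    also have "\<dots> \<le> h * (norm v + norm w + 1)"
      using h by (simp add: algebra_simps)
    also have "\<dots> = r / 2"
    proof -
      have "norm v + norm w + 1 > 0" by (simp add: add_nonneg_pos)
      then show ?thesis unfolding h_def by (simp add: divide_simps)
    qed
    finally show ?thesis using \<open>r > 0\<close> by simp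
  qed
  have inU: "x + s *\<^sub>R v + t *\<^sub>R w \<in> U" if "0 \<le> s" "s \<le> h" "0 \<le> t" "t \<le> h" for s t
    using near[OF that] d0 by (auto simp: r_def dist_commute)
  have inU': "x + s *\<^sub>R w + t *\<^sub>R v \<in> U" if "0 \<le> s" "s \<le> h" "0 \<le> t" "t \<le> h" for s t
    using inU[of t s] that by (simp add: algebra_simps)
  obtain s t where st: "0 < s" "s < h" "0 < t" "t < h"
    "f (x + h *\<^sub>R v + h *\<^sub>R w) - f (x + h *\<^sub>R v) - f (x + h *\<^sub>R w) + f x = h * h * ?A (x + s *\<^sub>R v + t *\<^sub>R w)"
    by (rule second_difference_mean_value[OF assms(2) h inU])
  obtain s' t' where st': "0 < s'" "s' < h" "0 < t'" "t' < h"
    "f (x + h *\<^sub>R w + h *\<^sub>R v) - f (x + h *\<^sub>R w) - f (x + h *\<^sub>R v) + f x = h * h * ?B (x + s' *\<^sub>R w + t' *\<^sub>R v)"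
    by (rule second_difference_mean_value[OF assms(2) h inU'])
  have "h * h * ?A (x + s *\<^sub>R v + t *\<^sub>R w) = h * h * ?B (x + s' *\<^sub>R w + t' *\<^sub>R v)"
    using st(5) st'(5) by (simp add: algebra_simps)
  then have eq: "?A (x + s *\<^sub>R v + t *\<^sub>R w) = ?B (x + t' *\<^sub>R v + s' *\<^sub>R w)"
    using h by (simp add: algebra_simps)
  have "dist (?A (x + s *\<^sub>R v + t *\<^sub>R w)) (?A x) < e"
    by (rule d(3)) (use near[of s t] st in \<open>simp add: r_def\<close>)
  moreover have "dist (?B (x + t' *\<^sub>R v + s' *\<^sub>R w)) (?B x) < e"
    by (rule d(4)) (use near[of t' s'] st' in \<open>simp add: r_def\<close>)
  ultimately show False
    unfolding eq e_def dist_real_def by argo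
qed

lemma ddiff_bounded_linear:
  fixes f :: "'a::euclidean_space \<Rightarrow> 'b::euclidean_space" and L :: "'b \<Rightarrow> 'c::euclidean_space"
  assumes "bounded_linear L" "f differentiable (at x)"
  shows "ddiff (\<lambda>x. L (f x)) v x = L (ddiff f v x)"
  using bounded_linear.has_derivative[OF assms(1) assms(2)[unfolded frechet_derivative_works]]
  by (metis frechet_derivative_at)

lemma ddiff_commute:
  fixes f :: "'a::euclidean_space \<Rightarrow> 'b::euclidean_space"
  assumes "open U" "ck_on (Suc (Suc 0)) U f" "x \<in> U"
  shows "ddiff (ddiff f v) w x = ddiff (ddiff f w) v x"
proof (rule euclidean_eqI)
  fix b :: 'b
  have bl: "bounded_linear (\<lambda>y. y \<bullet> b)" by (rule bounded_linear_inner_left)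
  have 2: "ddiff (ddiff (\<lambda>x. f x \<bullet> b) v) w x = ddiff (ddiff f v) w x \<bullet> b" for v w
  proof -
    have "ddiff (ddiff (\<lambda>x. f x \<bullet> b) v) w x = ddiff (\<lambda>x. ddiff f v x \<bullet> b) w x"
      using assms(2)
      by (subst frechet_derivative_cong_open(1)[OF assms(1,3), of _ "\<lambda>x. ddiff f v x \<bullet> b"])
        (auto simp: ddiff_bounded_linear[OF bl])
    also have "\<dots> = ddiff (ddiff f v) w x \<bullet> b"
      using assms by (subst ddiff_bounded_linear[OF bl]) auto
    finally show ?thesis .
  qed
  have "ck_on (Suc (Suc 0)) U (\<lambda>x. f x \<bullet> b)"
    by (rule ck_on_bounded_linear[OF assms(1) bl assms(2)])
  from ddiff_commute_real[OF assms(1) this assms(3), of v w]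
  show "ddiff (ddiff f v) w x \<bullet> b = ddiff (ddiff f w) v x \<bullet> b" by (simp only: 2)
qed

section \<open>Frames, Gram determinants and symmetric operators\<close>

text \<open>Independence of the indexed family: unlike independence of the set
  \<open>range b\<close>, it excludes repeated vectors.\<close>

definition frame :: "('n::finite \<Rightarrow> 'a::euclidean_space) \<Rightarrow> bool" where
  "frame b \<longleftrightarrow> (\<forall>x::real^'n. (\<Sum>i\<in>UNIV. x $ i *\<^sub>R b i) = 0 \<longrightarrow> x = 0)"

definition gram :: "('n::finite \<Rightarrow> 'a::euclidean_space) \<Rightarrow> real^'n^'n" where
  "gram b = (\<chi> i j. b i \<bullet> b j)"

text \<open>The dual basis inside the span of \<open>b\<close>, obtained by raising the index:
  \<open>matrix_inv (gram b)\<close> is the inverse metric tensor.\<close>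

definition dual_frame :: "('n::finite \<Rightarrow> 'a::euclidean_space) \<Rightarrow> 'n \<Rightarrow> 'a" where
  "dual_frame b j = (\<Sum>i\<in>UNIV. matrix_inv (gram b) $ j $ i *\<^sub>R b i)"

lemma inner_gram:
  "x \<bullet> (gram b *v y) = (\<Sum>i\<in>UNIV. x $ i *\<^sub>R b i) \<bullet> (\<Sum>j\<in>UNIV. y $ j *\<^sub>R b j)"
proof -
  have "(\<Sum>i\<in>UNIV. x $ i *\<^sub>R b i) \<bullet> (\<Sum>j\<in>UNIV. y $ j *\<^sub>R b j)
      = (\<Sum>i\<in>UNIV. \<Sum>j\<in>UNIV. x $ i * (y $ j * (b i \<bullet> b j)))"
    by (simp only: inner_sum_left) (simp add: inner_sum_right sum_distrib_left mult_ac)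
  then show ?thesis
    by (simp add: inner_vec_def gram_def matrix_vector_mult_def sum_distrib_left mult_ac)
qed

lemma det_continuous_on:
  fixes A :: "'t::topological_space \<Rightarrow> real^'n^'n"
  assumes "\<And>i j. continuous_on S (\<lambda>t. A t $ i $ j)"
  shows "continuous_on S (\<lambda>t. det (A t))"
  unfolding det_def by (intro continuous_intros assms)

lemma det_nonzero_if_trivial_kernel:
  fixes A :: "real^'n^'n"
  assumes "\<And>x. A *v x = 0 \<Longrightarrow> x = 0"
  shows "det A \<noteq> 0"
  using assms by (metis invertible_det_nz invertible_left_inverse matrix_left_invertible_ker)

text \<open>The segment from the identity to the Gram matrix consists of positive definite matrices,
  so the determinant has no zero along it and keeps the sign it has at the identity.\<close>

lemma det_gram_pos:
  fixes b :: "'n::finite \<Rightarrow> 'a::euclidean_space"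
  assumes "frame b"
  shows "det (gram b) > 0"
proof -
  define A where "A s = (1 - s) *\<^sub>R mat 1 + s *\<^sub>R gram b" for s :: real
  have Av: "x \<bullet> (A s *v x) = (1 - s) * (norm x)\<^sup>2 + s * (norm (\<Sum>i\<in>UNIV. x $ i *\<^sub>R b i))\<^sup>2" for s x
  proof -
    have "A s *v x = (1 - s) *\<^sub>R x + s *\<^sub>R (gram b *v x)"
      by (simp add: A_def matrix_vector_mult_add_rdistrib scaleR_matrix_vector_assoc[symmetric])
    then show ?thesis
      by (simp add: inner_add_right inner_gram power2_norm_eq_inner)
  qed
  have nz: "det (A s) \<noteq> 0" if "0 \<le> s" "s \<le> 1" for s
  proof (rule det_nonzero_if_trivial_kernel, rule ccontr)
    fix x assume x: "A s *v x = 0" "x \<noteq> 0"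
    then have "0 < norm x" "0 < norm (\<Sum>i\<in>UNIV. x $ i *\<^sub>R b i)"
      using assms by (auto simp: frame_def)
    then have "0 < (1 - s) * (norm x)\<^sup>2 + s * (norm (\<Sum>i\<in>UNIV. x $ i *\<^sub>R b i))\<^sup>2"
      using that by (cases "s = 0") (auto intro!: add_nonneg_pos)
    with Av[of x s] x show False by simp
  qed
  show ?thesis
  proof (rule ccontr)
    assume "\<not> det (gram b) > 0"
    then have "det (A 1) \<le> 0" "0 \<le> det (A 0)" by (simp_all add: A_def)
    moreover have "continuous_on {0..1} (\<lambda>s. det (A s))"
      by (rule det_continuous_on) (auto simp: A_def intro!: continuous_intros)
    ultimately obtain s where "0 \<le> s" "s \<le> 1" "det (A s) = 0"
      using IVT2'[of "\<lambda>s. det (A s)" 1 0 0] by auto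
    with nz show False by blast
  qed
qed

lemma matrix_inv_mult:
  assumes "invertible A"
  shows "A ** matrix_inv A = mat 1" "matrix_inv A ** A = mat 1"
  using someI_ex[OF assms[unfolded invertible_def]] by (simp_all add: matrix_inv_def)

lemma gram_matrix_inv:
  assumes "frame b"
  shows "gram b ** matrix_inv (gram b) = mat 1" "matrix_inv (gram b) ** gram b = mat 1"
proof -
  have "invertible (gram b)"
    using det_gram_pos[OF assms] by (simp add: invertible_det_nz)
  then show "gram b ** matrix_inv (gram b) = mat 1" "matrix_inv (gram b) ** gram b = mat 1"
    by (simp_all add: matrix_inv_mult)
qed

lemma gram_inv_symmetric:
  assumes "frame b"
  shows "matrix_inv (gram b) $ i $ j = matrix_inv (gram b) $ j $ i"
proof -
  let ?g = "gram b" and ?G = "matrix_inv (gram b)"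
  have t: "transpose ?g = ?g"
    by (simp add: gram_def transpose_def vec_eq_iff inner_commute)
  have "?g ** transpose ?G = mat 1"
    using gram_matrix_inv(2)[OF assms] t by (metis matrix_transpose_mul transpose_mat)
  then have "?G ** (?g ** transpose ?G) = ?G" by (simp add: matrix_mul_rid)
  then have "transpose ?G = ?G"
    by (simp add: matrix_mul_assoc gram_matrix_inv(2)[OF assms])
  then have "transpose ?G $ i $ j = ?G $ i $ j" by simp
  then show ?thesis by (simp add: transpose_def)
qed

lemma dual_frame_inner:
  assumes "frame b"
  shows "dual_frame b i \<bullet> b j = (if i = j then 1 else 0)"
proof -
  have "dual_frame b i \<bullet> b j = (matrix_inv (gram b) ** gram b) $ i $ j"
    by (simp add: dual_frame_def matrix_matrix_mult_def gram_def inner_sum_left)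
  then show ?thesis
    by (simp add: gram_matrix_inv(2)[OF assms] mat_def)
qed

lemma dual_frame_inner_dual:
  assumes "frame b"
  shows "dual_frame b i \<bullet> dual_frame b j = matrix_inv (gram b) $ i $ j"
  by (subst (2) dual_frame_def)
    (simp add: inner_sum_right dual_frame_inner[OF assms] if_distrib gram_inv_symmetric[OF assms]
      cong: if_cong)

lemma dual_frame_in_span: "dual_frame b j \<in> span (range b)"
  unfolding dual_frame_def by (intro span_sum span_scale span_base) auto

lemma span_frame_expand:
  assumes "v \<in> span (range b)"
  obtains x :: "real^'n::finite" where "v = (\<Sum>i\<in>UNIV. x $ i *\<^sub>R b i)"
proof -
  have "\<exists>x::real^'n. v = (\<Sum>i\<in>UNIV. x $ i *\<^sub>R b i)"
    using assms
  proof (induction rule: span_induct_alt)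
    case base
    then show ?case by (intro exI[of _ 0]) simp
  next
    case (step c y z)
    then obtain k x where "y = b k" "z = (\<Sum>i\<in>UNIV. x $ i *\<^sub>R b i)" by auto
    then show ?case
      by (intro exI[of _ "c *\<^sub>R axis k 1 + x"])
        (simp add: scaleR_left_distrib sum.distrib axis_def if_distrib[of "\<lambda>t. t *\<^sub>R _"]
          if_distrib[of "\<lambda>t. c * t"] cong: if_cong)
  qed
  with that show thesis by blast
qed

lemma frame_expand_dual:
  assumes "frame b" "v \<in> span (range b)"
  shows "(\<Sum>j\<in>UNIV. (v \<bullet> dual_frame b j) *\<^sub>R b j) = v"
proof -
  obtain x where x: "v = (\<Sum>i\<in>UNIV. x $ i *\<^sub>R b i)"
    using span_frame_expand[OF assms(2)] .
  have "v \<bullet> dual_frame b j = x $ j" for j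
    by (simp add: x inner_sum_left inner_commute[of "b _"] dual_frame_inner[OF assms(1)]
        if_distrib cong: if_cong)
  then show ?thesis by (simp add: x)
qed

lemma dual_frame_expand_dual:
  assumes "frame b"
  shows "(\<Sum>j\<in>UNIV. (dual_frame b i \<bullet> dual_frame b j) *\<^sub>R b j) = dual_frame b i"
  by (rule frame_expand_dual[OF assms dual_frame_in_span])

lemma dim_span_frame:
  fixes b :: "'n::finite \<Rightarrow> 'a::euclidean_space"
  assumes "frame b"
  shows "dim (span (range b)) = CARD('n)"
proof -
  let ?L = "\<lambda>x::real^'n. \<Sum>i\<in>UNIV. x $ i *\<^sub>R b i"
  have L: "linear ?L"
    by (rule linearI) (simp_all add: scaleR_left_distrib sum.distrib scaleR_sum_right)
  have "inj ?L"
    using assms by (simp add: linear_injective_0[OF L] frame_def)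
  then have "dim (?L ` UNIV) = dim (UNIV :: (real^'n) set)"
    by (intro dim_image_eq L) (auto simp: inj_on_subset)
  moreover have "?L ` UNIV = span (range b)"
    by (auto intro: span_sum span_scale span_base elim!: span_frame_expand)
  ultimately show ?thesis by simp
qed

text \<open>In the Leibniz formula every permutation other than the identity moves at least two
  indices; after one factor is differentiated, an off-diagonal entry of the identity matrix, which
  is 0, remains in the product.\<close>

lemma has_real_derivative_det_mat_1:
  fixes C :: "real \<Rightarrow> real^'n^'n"
  assumes C: "\<And>i j. ((\<lambda>t. C t $ i $ j) has_real_derivative C' i j) (at t0)" and "C t0 = mat 1"
  shows "((\<lambda>t. det (C t)) has_real_derivative (\<Sum>i\<in>UNIV. C' i i)) (at t0)"
proof -
  let ?P = "{p. p permutes (UNIV :: 'n set)}"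
  let ?d = "\<lambda>p. of_int (sign p) * (\<Sum>i\<in>UNIV. C' i (p i) * (\<Prod>j\<in>UNIV - {i}. C t0 $ j $ p j))"
  have "((\<lambda>t. det (C t)) has_real_derivative (\<Sum>p\<in>?P. ?d p)) (at t0)"
    unfolding det_def
    by (intro DERIV_sum DERIV_cmult has_field_derivative_prod C)
  moreover have "(\<Sum>p\<in>?P. ?d p) = (\<Sum>p\<in>{id}. ?d p)"
  proof (rule sum.mono_neutral_right)
    show "\<forall>p\<in>?P - {id}. ?d p = 0"
    proof
      fix p assume p: "p \<in> ?P - {id}"
      have "(\<Prod>j\<in>UNIV - {i}. C t0 $ j $ p j) = 0" for i
      proof -
        obtain k where k: "p k \<noteq> k" using p by (auto simp: fun_eq_iff)
        have "inj p" using p permutes_inj by blast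
        then have "p (p k) \<noteq> p k" using k by (auto dest: injD)
        with k have "\<exists>j. j \<noteq> i \<and> p j \<noteq> j" by (metis)
        then obtain j where "j \<noteq> i" "p j \<noteq> j" by blast
        then show ?thesis by (intro prod_zero bexI[of _ j]) (auto simp: assms(2) mat_def)
      qed
      then show "?d p = 0" by (simp only: mult_zero_right sum.neutral_const)
    qed
  qed (auto simp: permutes_id finite_permutations)
  ultimately show ?thesis
    by (simp add: assms(2) mat_def sign_id)
qed

text \<open>Jacobi's formula. Multiplication by the inverse \<open>B\<close> moves the base point to
  the identity matrix.\<close>

lemma has_real_derivative_det:
  fixes A :: "real \<Rightarrow> real^'n^'n"
  assumes A: "\<And>i j. ((\<lambda>t. A t $ i $ j) has_real_derivative A' i j) (at t0)"
    and B: "B ** A t0 = mat 1"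
  shows "((\<lambda>t. det (A t)) has_real_derivative
    det (A t0) * (\<Sum>i\<in>UNIV. \<Sum>k\<in>UNIV. B $ i $ k * A' k i)) (at t0)"
proof -
  have AB: "A t0 ** B = mat 1" using B by (simp add: matrix_left_right_inverse)
  have eq: "(\<lambda>t. det (A t)) = (\<lambda>t. det (A t0) * det (B ** A t))"
  proof
    fix t
    have "A t0 ** (B ** A t) = A t" by (simp add: matrix_mul_assoc AB)
    then show "det (A t) = det (A t0) * det (B ** A t)" by (metis det_mul)
  qed
  have "((\<lambda>t. det (B ** A t)) has_real_derivative
      (\<Sum>i\<in>UNIV. \<Sum>k\<in>UNIV. B $ i $ k * A' k i)) (at t0)"
    by (rule has_real_derivative_det_mat_1[where C = "\<lambda>t. B ** A t", OF _ B])
      (auto simp: matrix_matrix_mult_def intro!: DERIV_sum DERIV_cmult A)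
  then show ?thesis
    by (subst eq) (rule DERIV_cmult)
qed

lemma ck_on_det:
  fixes A :: "'a::euclidean_space \<Rightarrow> real^'n^'n"
  assumes "open U" "\<And>i j. ck_on k U (\<lambda>x. A x $ i $ j)"
  shows "ck_on k U (\<lambda>x. det (A x))"
  unfolding det_def by (intro ck_on_sum ck_on_mult ck_on_prod ck_on_const assms)

text \<open>Cramer's rule writes the entries of the inverse as quotients of determinants.\<close>

lemma ck_on_matrix_inv:
  fixes A :: "'a::euclidean_space \<Rightarrow> real^'n^'n"
  assumes "open U" and A: "\<And>i j. ck_on k U (\<lambda>x. A x $ i $ j)"
    and nz: "\<And>x. x \<in> U \<Longrightarrow> det (A x) \<noteq> 0"
  shows "ck_on k U (\<lambda>x. matrix_inv (A x) $ i $ j)"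
proof -
  let ?N = "\<lambda>x. det (\<chi> r c. if c = i then (axis j 1 :: real^'n) $ r else A x $ r $ c)"
  have eq: "matrix_inv (A x) $ i $ j = ?N x * inverse (det (A x))" if "x \<in> U" for x
  proof -
    have "A x ** matrix_inv (A x) = mat 1"
      using nz[OF that] by (simp add: invertible_det_nz matrix_inv_mult)
    then have "A x *v (matrix_inv (A x) *v axis j 1) = axis j 1"
      by (simp add: matrix_vector_mul_assoc)
    then have "matrix_inv (A x) *v axis j 1
        = (\<chi> k. det (\<chi> r c. if c = k then (axis j 1 :: real^'n) $ r else A x $ r $ c) / det (A x))"
      by (simp add: cramer[OF nz[OF that]])
    moreover have "matrix_inv (A x) $ i $ j = (matrix_inv (A x) *v axis j 1) $ i"
      by (simp add: matrix_vector_mult_def axis_def if_distrib cong: if_cong)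
    ultimately show ?thesis by (simp add: divide_inverse)
  qed
  have "ck_on k U (\<lambda>x. ?N x * inverse (det (A x)))"
  proof (intro ck_on_mult ck_on_inverse ck_on_det assms)
    fix r c
    show "ck_on k U (\<lambda>x. (\<chi> r c. if c = i then (axis j 1 :: real^'n) $ r else A x $ r $ c) $ r $ c)"
      by (cases "c = i") (simp_all add: ck_on_const A)
  qed
  then show ?thesis by (subst ck_on_cong[OF assms(1) eq])
qed

section \<open>Orthonormal bases, the spectral theorem and traces\<close>

lemma finite_orthonormal_basis:
  fixes T :: "'a::euclidean_space set"
  assumes "orthonormal_basis_of T B"
  shows "finite B" "independent B"
proof -
  have "0 \<notin> B" using assms by (auto simp: orthonormal_basis_of_def)
  then show "independent B"
    using assms pairwise_orthogonal_independent by (auto simp: orthonormal_basis_of_def)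
  then show "finite B" by (rule independent_imp_finite)
qed

lemma orthonormal_basis_of_expand:
  assumes "orthonormal_basis_of T B" "v \<in> T"
  shows "(\<Sum>e\<in>B. (v \<bullet> e) *\<^sub>R e) = v"
  by (rule orthonormal_basis_expand)
    (use assms finite_orthonormal_basis[OF assms(1)] in \<open>auto simp: orthonormal_basis_of_def\<close>)

text \<open>\<open>differential_norm_sq\<close> and traces refer to an arbitrary orthonormal basis,
  which cannot be expected to vary smoothly with the point. Expanding its vectors in the frame
  \<open>b\<close> and applying Parseval to the dual vectors replaces it by the inverse
  metric.\<close>

lemma orthonormal_contraction_eq_frame:
  fixes b :: "'n::finite \<Rightarrow> 'a::euclidean_space"
    and P Q :: "'a \<Rightarrow> 'b::euclidean_space"
  assumes b: "frame b" and B: "orthonormal_basis_of (span (range b)) B"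
    and P: "linear P" and Q: "linear Q"
  shows "(\<Sum>e\<in>B. P e \<bullet> Q e)
    = (\<Sum>i\<in>UNIV. \<Sum>j\<in>UNIV. (dual_frame b i \<bullet> dual_frame b j) * (P (b i) \<bullet> Q (b j)))"
proof -
  let ?d = "dual_frame b"
  have T: "e \<in> span (range b)" if "e \<in> B" for e
    using B that by (auto simp: orthonormal_basis_of_def)
  have Pe: "P e = (\<Sum>i\<in>UNIV. (e \<bullet> ?d i) *\<^sub>R P (b i))" if "e \<in> B" for e
    by (subst frame_expand_dual[OF b T[OF that], symmetric]) (simp add: linear_sum[OF P] linear_scale[OF P])
  have Qe: "Q e = (\<Sum>i\<in>UNIV. (e \<bullet> ?d i) *\<^sub>R Q (b i))" if "e \<in> B" for e
    by (subst frame_expand_dual[OF b T[OF that], symmetric]) (simp add: linear_sum[OF Q] linear_scale[OF Q])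
  have dd: "(\<Sum>e\<in>B. (e \<bullet> ?d i) * (e \<bullet> ?d j)) = ?d i \<bullet> ?d j" for i j
  proof -
    have "?d i \<bullet> ?d j = (\<Sum>e\<in>B. (?d i \<bullet> e) *\<^sub>R e) \<bullet> ?d j"
      by (simp only: orthonormal_basis_of_expand[OF B dual_frame_in_span])
    then show ?thesis by (simp add: inner_sum_left inner_commute[of "?d i"])
  qed
  have "(\<Sum>e\<in>B. P e \<bullet> Q e) = (\<Sum>e\<in>B. \<Sum>i\<in>UNIV. \<Sum>j\<in>UNIV. ((e \<bullet> ?d i) * (e \<bullet> ?d j)) * (P (b i) \<bullet> Q (b j)))"
    by (intro sum.cong refl) (simp only: Pe Qe inner_sum_left, simp add: inner_sum_right sum_distrib_left mult_ac)
  also have "\<dots> = (\<Sum>i\<in>UNIV. \<Sum>j\<in>UNIV. (\<Sum>e\<in>B. (e \<bullet> ?d i) * (e \<bullet> ?d j)) * (P (b i) \<bullet> Q (b j)))"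
    unfolding sum_distrib_right
    by (subst sum.swap) (intro sum.cong refl, rule sum.swap)
  finally show ?thesis by (simp only: dd)
qed

lemma orthonormal_trace_eq_frame:
  fixes b :: "'n::finite \<Rightarrow> 'a::euclidean_space"
  assumes b: "frame b" and B: "orthonormal_basis_of (span (range b)) B" and S: "linear S"
  shows "(\<Sum>e\<in>B. S e \<bullet> e) = (\<Sum>i\<in>UNIV. S (b i) \<bullet> dual_frame b i)"
proof -
  have "(\<Sum>e\<in>B. S e \<bullet> e)
      = (\<Sum>i\<in>UNIV. S (b i) \<bullet> (\<Sum>j\<in>UNIV. (dual_frame b i \<bullet> dual_frame b j) *\<^sub>R b j))"
    using orthonormal_contraction_eq_frame[OF b B S linear_id]
    by (simp add: inner_sum_right)
  then show ?thesis by (simp only: dual_frame_expand_dual[OF b])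
qed

lemma orthonormal_basis_exists:
  fixes T :: "'a::euclidean_space set"
  assumes "subspace T"
  obtains B where "orthonormal_basis_of T B"
proof -
  obtain B where "B \<subseteq> T" "pairwise orthogonal B" "\<And>x. x \<in> B \<Longrightarrow> norm x = 1" "span B = T"
    using orthonormal_basis_subspace[OF assms] by metis
  then show thesis by (intro that[of B]) (auto simp: orthonormal_basis_of_def)
qed

text \<open>The quadratic form of \<open>S\<close> attains its maximum \<open>c\<close> on the unit
  sphere of \<open>T\<close>. The residual \<open>S e - c *\<^sub>R e\<close> must vanish, since
  otherwise a small move in its direction would raise the Rayleigh quotient above
  \<open>c\<close>.\<close>

lemma symmetric_operator_eigenvector:
  fixes T :: "'a::euclidean_space set"
  assumes T: "subspace T" "T \<noteq> {0}" and S: "linear S" "S ` T \<subseteq> T"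
    and sym: "\<And>v w. v \<in> T \<Longrightarrow> w \<in> T \<Longrightarrow> S v \<bullet> w = v \<bullet> S w"
  obtains e c where "e \<in> T" "norm e = 1" "S e = c *\<^sub>R e"
proof -
  have "bounded_linear S" using S(1) by (simp add: linear_conv_bounded_linear)
  then have contS: "continuous_on A S" for A by (simp add: linear_continuous_on)
  let ?K = "T \<inter> sphere 0 1"
  obtain w where "w \<in> T" "w \<noteq> 0" using T by (metis subspace_0 singletonI subsetI subset_antisym empty_subsetI insert_subset)
  then have "w /\<^sub>R norm w \<in> ?K" using T(1) by (simp add: subspace_scale)
  moreover have "compact ?K" using T(1) by (simp add: closed_Int_compact closed_subspace)
  ultimately obtain e where e: "e \<in> ?K" and max: "\<And>y. y \<in> ?K \<Longrightarrow> S y \<bullet> y \<le> S e \<bullet> e"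
    using continuous_attains_sup[of ?K "\<lambda>y. S y \<bullet> y"] contS by (fastforce intro: continuous_intros)
  define c where "c = S e \<bullet> e"
  have quad: "S y \<bullet> y \<le> c * (y \<bullet> y)" if "y \<in> T" for y
  proof (cases "y = 0")
    case False
    then have "y /\<^sub>R norm y \<in> ?K" using T(1) that by (simp add: subspace_scale)
    from max[OF this] have "(S y \<bullet> y) / (norm y)\<^sup>2 \<le> c"
      by (simp add: linear_scale[OF S(1)] c_def power2_eq_square divide_inverse mult_ac)
    then show ?thesis using False by (simp add: field_simps power2_norm_eq_inner)
  qed (simp add: linear_0[OF S(1)])
  have e1: "e \<in> T" "e \<bullet> e = 1" using e by (auto simp: norm_eq_1)
  define r where "r = S e - c *\<^sub>R e"
  have rT: "r \<in> T" using S(2) e1 T(1) by (auto simp: r_def intro!: subspace_diff subspace_scale)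
  have re: "r \<bullet> e = 0" using e1 by (simp add: r_def c_def inner_diff_left)
  have Ser: "S e \<bullet> r = r \<bullet> r" using re by (simp add: r_def inner_diff_left inner_diff_right inner_commute)
  have "r = 0"
  proof (rule ccontr)
    assume "r \<noteq> 0"
    then have rr: "r \<bullet> r > 0" by simp
    \<comment> \<open>\<open>K\<close> bounds the quadratic terms: for t = |r|^2 / K the second
      order loss is at most t |r|^2, only half of the first order gain 2 t |r|^2.\<close>
    define K where "K = \<bar>S r \<bullet> r\<bar> + \<bar>c\<bar> * (r \<bullet> r) + 1"
    have K: "K > 0" using rr by (auto simp: K_def intro!: add_nonneg_pos)
    define t where "t = (r \<bullet> r) / K"
    have t: "t > 0" using rr K by (simp add: t_def)
    have "S (e + t *\<^sub>R r) \<bullet> (e + t *\<^sub>R r) \<le> c * ((e + t *\<^sub>R r) \<bullet> (e + t *\<^sub>R r))"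
      by (rule quad) (use e1 rT T(1) in \<open>auto intro!: subspace_add subspace_scale\<close>)
    moreover have "S r \<bullet> e = r \<bullet> r" using sym[OF rT e1(1)] Ser by (simp add: inner_commute)
    ultimately have "2 * t * (r \<bullet> r) + t * t * (S r \<bullet> r) \<le> t * t * (c * (r \<bullet> r))"
      using re e1 Ser
      by (simp add: linear_add[OF S(1)] linear_scale[OF S(1)] inner_add_left inner_add_right
          c_def[symmetric] inner_commute[of e r] algebra_simps)
    then have "t * (2 * (r \<bullet> r)) \<le> t * (t * (c * (r \<bullet> r) - S r \<bullet> r))"
      by (simp add: algebra_simps)
    then have "2 * (r \<bullet> r) \<le> t * (c * (r \<bullet> r) - S r \<bullet> r)"
      using t by (simp only: mult_le_cancel_left_pos)
    also have "\<dots> \<le> t * K"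
    proof (intro mult_left_mono)
      have "c * (r \<bullet> r) \<le> \<bar>c\<bar> * (r \<bullet> r)" by (intro mult_right_mono) auto
      then show "c * (r \<bullet> r) - S r \<bullet> r \<le> K" by (simp add: K_def)
    qed (use t in simp)
    also have "\<dots> = r \<bullet> r" using K by (simp add: t_def)
    finally show False using rr by simp
  qed
  then show thesis using e1 by (intro that[of e c]) (auto simp: r_def norm_eq_1)
qed

text \<open>Induction on the dimension: by symmetry the orthogonal complement of an eigenvector
  within \<open>T\<close> is again invariant.\<close>

lemma symmetric_operator_eigenbasis:
  fixes T :: "'a::euclidean_space set"
  assumes "subspace T" "linear S" "S ` T \<subseteq> T"
    and "\<And>v w. v \<in> T \<Longrightarrow> w \<in> T \<Longrightarrow> S v \<bullet> w = v \<bullet> S w"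
  shows "\<exists>B. orthonormal_basis_of T B \<and> (\<forall>e\<in>B. \<exists>c. S e = c *\<^sub>R e)"
  using assms
proof (induction "dim T" arbitrary: T rule: less_induct)
  case less
  note S = less.prems(2) and sym = less.prems(4)
  show ?case
  proof (cases "T = {0}")
    case True
    then show ?thesis
      by (intro exI[of _ "{}"]) (auto simp: orthonormal_basis_of_def)
  next
    case False
    obtain e c where e: "e \<in> T" "norm e = 1" "S e = c *\<^sub>R e"
      by (rule symmetric_operator_eigenvector[OF less.prems(1) False less.prems(2-4)])
    let ?T = "{v \<in> T. e \<bullet> v = 0}"
    have ee: "e \<bullet> e = 1" using e by (simp add: norm_eq_1)
    have sub: "subspace ?T"
      using less.prems(1) by (auto simp: subspace_def inner_add_right)
    have "e \<notin> ?T" using ee by simp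
    then have "?T \<subset> T" using e(1) by blast
    then have lt: "dim ?T < dim T"
      using sub less.prems(1) by (metis dim_psubset span_eq_iff)
    have inv: "S ` ?T \<subseteq> ?T"
      using less.prems(3) sym[OF e(1)] e(3) by (auto simp: inner_commute) (metis inner_commute inner_scaleR_left mult_zero_right)
    obtain B where B: "orthonormal_basis_of ?T B" "\<forall>e\<in>B. \<exists>c. S e = c *\<^sub>R e"
      using less.hyps[OF lt sub S inv] sym by auto
    have "span (insert e B) = T"
    proof
      show "span (insert e B) \<subseteq> T"
        using B(1) e(1) less.prems(1) by (intro span_minimal) (auto simp: orthonormal_basis_of_def)
      show "T \<subseteq> span (insert e B)"
      proof
        fix v assume v: "v \<in> T"
        have "v - (e \<bullet> v) *\<^sub>R e \<in> ?T"
          using v e less.prems(1) ee by (auto simp: inner_diff_right intro!: subspace_diff subspace_scale)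
        then have "v - (e \<bullet> v) *\<^sub>R e \<in> span B" using B(1) by (simp add: orthonormal_basis_of_def)
        then show "v \<in> span (insert e B)" by (auto simp: span_insert)
      qed
    qed
    then have "orthonormal_basis_of T (insert e B)"
      using B(1) e by (auto simp: orthonormal_basis_of_def pairwise_insert orthogonal_def inner_commute)
    then show ?thesis using B(2) e(3) by blast
  qed
qed

definition eigenspace_on :: "'a::euclidean_space set \<Rightarrow> ('a \<Rightarrow> 'a) \<Rightarrow> real \<Rightarrow> 'a set" where
  "eigenspace_on T S c = {v \<in> T. S v = c *\<^sub>R v}"

text \<open>The trace depends on the eigenvalues and their multiplicities alone, and these are what
  \<open>constant_principal_curvatures\<close> keeps fixed from point to point.\<close>

lemma symmetric_operator_trace:
  fixes T :: "'a::euclidean_space set"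
  assumes T: "subspace T" and S: "linear S" and "S ` T \<subseteq> T"
    and "\<And>v w. v \<in> T \<Longrightarrow> w \<in> T \<Longrightarrow> S v \<bullet> w = v \<bullet> S w"
  obtains B where "orthonormal_basis_of T B"
    "(\<Sum>e\<in>B. S e \<bullet> e) = (\<Sum>c | dim (eigenspace_on T S c) \<noteq> 0. c * real (dim (eigenspace_on T S c)))"
proof -
  obtain B where B: "orthonormal_basis_of T B" and eig: "\<forall>e\<in>B. \<exists>c. S e = c *\<^sub>R e"
    using symmetric_operator_eigenbasis[OF assms] by blast
  have fin: "finite B" and ind: "independent B" using finite_orthonormal_basis[OF B] .
  have norm: "e \<bullet> e = 1" if "e \<in> B" for e
    using B that by (auto simp: orthonormal_basis_of_def norm_eq_1)
  define c where "c e = S e \<bullet> e" for e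
  have c: "S e = c e *\<^sub>R e" if "e \<in> B" for e
    using eig that norm[OF that] by (auto simp: c_def)
  have E: "eigenspace_on T S a = span {e \<in> B. c e = a}" for a
  proof
    show "span {e \<in> B. c e = a} \<subseteq> eigenspace_on T S a"
    proof (rule span_minimal)
      show "{e \<in> B. c e = a} \<subseteq> eigenspace_on T S a"
        using B c by (auto simp: eigenspace_on_def orthonormal_basis_of_def)
      show "subspace (eigenspace_on T S a)"
        using T by (auto simp: eigenspace_on_def subspace_def linear_0[OF S] linear_add[OF S]
            linear_scale[OF S] scaleR_right_distrib)
    qed
    show "eigenspace_on T S a \<subseteq> span {e \<in> B. c e = a}"
    proof
      fix v assume v: "v \<in> eigenspace_on T S a"
      have vT: "v \<in> T" using v by (simp add: eigenspace_on_def)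
      have z: "v \<bullet> e = 0" if "e \<in> B" "c e \<noteq> a" for e
      proof -
        have eT: "e \<in> T" using B that by (auto simp: orthonormal_basis_of_def)
        have "a * (v \<bullet> e) = S v \<bullet> e" using v by (simp add: eigenspace_on_def)
        also have "\<dots> = c e * (v \<bullet> e)" using assms(4)[OF vT eT] c[OF that(1)] by simp
        finally show ?thesis using that by simp
      qed
      have "v = (\<Sum>e\<in>B. (v \<bullet> e) *\<^sub>R e)" using orthonormal_basis_of_expand[OF B vT] by simp
      also have "\<dots> = (\<Sum>e\<in>{e \<in> B. c e = a}. (v \<bullet> e) *\<^sub>R e)"
        by (rule sum.mono_neutral_right) (use fin z in auto)
      also have "\<dots> \<in> span {e \<in> B. c e = a}" by (intro span_sum span_scale span_base) auto
      finally show "v \<in> span {e \<in> B. c e = a}" .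
    qed
  qed
  have dimE: "dim (eigenspace_on T S a) = card {e \<in> B. c e = a}" for a
    unfolding E dim_span 
    by (intro dim_eq_card_independent independent_mono[OF ind]) auto
  have "(\<Sum>e\<in>B. S e \<bullet> e) = (\<Sum>a\<in>c ` B. \<Sum>e | e \<in> B \<and> c e = a. c e)"
    by (subst sum.image_gen[OF fin, of _ c]) (simp add: c_def)
  also have "\<dots> = (\<Sum>a\<in>c ` B. a * real (dim (eigenspace_on T S a)))"
    by (intro sum.cong refl) (simp add: dimE)
  also have "c ` B = {a. dim (eigenspace_on T S a) \<noteq> 0}"
    using fin by (auto simp: dimE card_eq_0_iff)
  finally show thesis using that[OF B] by blast
qed

section \<open>Charts\<close>

text \<open>Applied to a local parametrization it is a \<open>frame\<close> of the tangent space;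
  applied to a map composed with one it gives the images of the coordinate vectors under the
  differential.\<close>

definition coord_frame :: "(real^'n \<Rightarrow> 'a::euclidean_space) \<Rightarrow> real^'n \<Rightarrow> 'n \<Rightarrow> 'a" where
  "coord_frame \<psi> u i = frechet_derivative \<psi> (at u) (axis i 1)"

lemma gram_matrix_eq: "gram_matrix \<psi> u = gram (coord_frame \<psi> u)"
  by (simp add: gram_matrix_def gram_def coord_frame_def)

lemma linear_eq_sum_axis:
  fixes L :: "real^'n \<Rightarrow> 'a::real_vector"
  assumes "linear L"
  shows "L x = (\<Sum>i\<in>UNIV. x $ i *\<^sub>R L (axis i 1))"
proof -
  have "L x = L (\<Sum>i\<in>UNIV. x $ i *\<^sub>R axis i 1)"
    using basis_expansion[of x] by (simp add: scalar_mult_eq_scaleR)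
  then show ?thesis by (simp add: linear_sum[OF assms] linear_scale[OF assms])
qed

text \<open>Near \<open>h x\<close> the map \<open>k\<close> agrees with a translation to first
  order, so the increments of \<open>h\<close> and of the composite differ by o(|h y - h x|).
  Differentiability of the composite first gives a Lipschitz bound for \<open>h\<close> at
  \<open>x\<close>, and then the error is o(|y - x|).\<close>

lemma has_derivative_cancel_left:
  fixes h :: "'b::real_normed_vector \<Rightarrow> 'c::real_normed_vector" and k :: "'c \<Rightarrow> 'c"
  assumes k: "(k has_derivative (\<lambda>z. z)) (at (h x))"
    and h: "continuous (at x within S) h"
    and F: "((\<lambda>y. k (h y)) has_derivative q) (at x within S)"
  shows "(h has_derivative q) (at x within S)"
  unfolding has_derivative_within_alt
proof (intro conjI allI impI)
  show q: "bounded_linear q" using F by (rule has_derivative_bounded_linear)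
  then obtain B where B: "B > 0" "\<And>v. norm (q v) \<le> norm v * B"
    using bounded_linear.pos_bounded by blast
  fix e :: real assume e: "e > 0"
  \<comment> \<open>The bound 1/2 lets the error term in |h y - h x| be absorbed on the left, with
    resulting Lipschitz constant \<open>2 * (B + 1)\<close>; the other bound makes \<open>e1\<close>
    times this constant at most \<open>e / 2\<close>.\<close>
  define e1 where "e1 = min (1/2) (e / (4 * (B + 1)))"
  define e2 where "e2 = min 1 (e / 2)"
  have e1: "e1 > 0" "e1 \<le> 1/2" "e1 * (2 * (B + 1)) \<le> e / 2"
  proof -
    show "e1 > 0" "e1 \<le> 1/2" unfolding e1_def using e B by (simp_all only: min.cobounded1, simp)
    have "e1 * (2 * (B + 1)) \<le> e / (4 * (B + 1)) * (2 * (B + 1))"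
      using B by (intro mult_right_mono) (auto simp: e1_def)
    also have "\<dots> = e / 2" using B by (simp add: field_simps)
    finally show "e1 * (2 * (B + 1)) \<le> e / 2" .
  qed
  have e2: "e2 > 0" "e2 \<le> 1" "e2 \<le> e / 2" using e by (auto simp: e2_def)
  obtain d1 where d1: "d1 > 0"
    "\<And>z. norm (z - h x) < d1 \<Longrightarrow> norm (k z - k (h x) - (z - h x)) \<le> e1 * norm (z - h x)"
    using k e1(1) unfolding has_derivative_at_alt by blast
  obtain d2 where d2: "d2 > 0" "\<And>y. y \<in> S \<Longrightarrow> dist y x < d2 \<Longrightarrow> dist (h y) (h x) < d1"
    using h d1(1) unfolding continuous_within_eps_delta by blast
  obtain d3 where d3: "d3 > 0"
    "\<And>y. y \<in> S \<Longrightarrow> norm (y - x) < d3 \<Longrightarrow> norm (k (h y) - k (h x) - q (y - x)) \<le> e2 * norm (y - x)"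
    using F e2(1) unfolding has_derivative_within_alt by blast
  show "\<exists>d>0. \<forall>y\<in>S. norm (y - x) < d \<longrightarrow> norm (h y - h x - q (y - x)) \<le> e * norm (y - x)"
  proof (intro exI[of _ "min d2 d3"] conjI ballI impI)
    show "min d2 d3 > 0" using d2 d3 by simp
    fix y assume y: "y \<in> S" "norm (y - x) < min d2 d3"
    let ?A = "norm (h y - h x)" and ?N = "norm (y - x)"
    have 1: "norm (k (h y) - k (h x) - (h y - h x)) \<le> e1 * ?A"
      using d1(2) d2(2)[of y] y by (simp add: dist_norm)
    have 2: "norm (k (h y) - k (h x) - q (y - x)) \<le> e2 * ?N" using d3(2) y by simp
    have "?A \<le> norm (k (h y) - k (h x) - (h y - h x)) + norm (k (h y) - k (h x) - q (y - x)) + norm (q (y - x))"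
      by norm
    also have "\<dots> \<le> e1 * ?A + e2 * ?N + ?N * B" using 1 2 B(2)[of "y - x"] by linarith
    also have "\<dots> \<le> 1/2 * ?A + 1 * ?N + ?N * B"
      using e1 e2 B(1) by (intro add_mono mult_right_mono) auto
    finally have A: "?A \<le> 2 * (B + 1) * ?N" by (simp add: algebra_simps)
    have "norm (h y - h x - q (y - x))
        \<le> norm (k (h y) - k (h x) - (h y - h x)) + norm (k (h y) - k (h x) - q (y - x))"
      by norm
    also have "\<dots> \<le> e1 * ?A + e2 * ?N" using 1 2 by linarith
    also have "\<dots> \<le> e1 * (2 * (B + 1) * ?N) + e / 2 * ?N"
      using A e1 e2 B(1) by (intro add_mono mult_left_mono mult_right_mono) auto
    also have "\<dots> = e1 * (2 * (B + 1)) * ?N + e / 2 * ?N" by simp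
    also have "\<dots> \<le> e / 2 * ?N + e / 2 * ?N"
      using e1 by (intro add_mono mult_right_mono) auto
    finally show "norm (h y - h x - q (y - x)) \<le> e * ?N" by simp
  qed
qed

text \<open>A linear left inverse \<open>P\<close> of \<open>L\<close>, composed with \<psi>, has
  the identity as derivative at \<open>h x\<close>, which is the situation of the preceding lemma.
  Continuity is all that a homeomorphic chart provides for its inverse; in this way curves in M and
  chart transitions become differentiable in coordinates.\<close>

lemma has_derivative_lift:
  fixes \<psi> :: "'c::euclidean_space \<Rightarrow> 'a::euclidean_space"
    and h :: "'b::real_normed_vector \<Rightarrow> 'c"
  assumes \<psi>: "(\<psi> has_derivative L) (at (h x))" and "inj L"
    and f: "((\<lambda>y. \<psi> (h y)) has_derivative f') (at x)"
    and h: "isCont h x"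
  obtains h' where "(h has_derivative h') (at x)" "\<And>v. L (h' v) = f' v"
proof -
  have L: "linear L" using \<psi> has_derivative_linear by blast
  obtain P where P: "linear P" "P \<circ> L = id"
    using linear_injective_left_inverse[OF L \<open>inj L\<close>] by blast
  have "bounded_linear P" using P by (simp add: linear_conv_bounded_linear)
  from bounded_linear.has_derivative[OF this]
  have PD: "((\<lambda>z. P (g z)) has_derivative (\<lambda>v. P (g' v))) F" if "(g has_derivative g') F"
    for g :: "'d::real_normed_vector \<Rightarrow> 'a" and g' F using that by blast
  have "P (L z) = z" for z using P(2) by (simp add: fun_eq_iff)
  then have "((\<lambda>z. P (\<psi> z)) has_derivative (\<lambda>z. z)) (at (h x))"
    using PD[OF \<psi>] by simp
  then have h': "(h has_derivative (\<lambda>v. P (f' v))) (at x)"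
    by (rule has_derivative_cancel_left[OF _ h PD[OF f]])
  have "((\<lambda>y. \<psi> (h y)) has_derivative (\<lambda>v. L (P (f' v)))) (at x)"
    by (rule has_derivative_compose[OF h' \<psi>])
  then have "L (P (f' v)) = f' v" for v using has_derivative_unique[OF f] by metis
  with h' show thesis by (rule that)
qed

lemma smooth_map_onE:
  assumes "smooth_map_on N f" "p \<in> N"
  obtains U g where "p \<in> U" "open U" "\<And>k. ck_on k U g" "\<And>x. x \<in> N \<Longrightarrow> x \<in> U \<Longrightarrow> g x = f x"
proof -
  from bspec[OF assms(1)[unfolded smooth_map_on_def smooth_on_open_def] assms(2)]
  obtain U g where "p \<in> U \<and> (open U \<and> (\<forall>k. ck_on k U g)) \<and> (\<forall>x\<in>N \<inter> U. g x = f x)"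
    by (elim exE)
  then show thesis by (intro that[of U g]) auto
qed

lemma smooth_map_on_compose:
  assumes "smooth_map_on N f" "smooth_on_open W \<psi>" "\<psi> ` W \<subseteq> N"
  shows "smooth_on_open W (\<lambda>u. f (\<psi> u))"
  unfolding smooth_on_open_def
proof (intro conjI allI)
  show W: "open W" using assms(2) by (simp add: smooth_on_open_def)
  have \<psi>: "ck_on k W \<psi>" for k using assms(2) by (simp add: smooth_on_open_def)
  show "ck_on k W (\<lambda>u. f (\<psi> u))" for k
  proof (rule ck_on_local)
    fix u assume u: "u \<in> W"
    then have "\<psi> u \<in> N" using assms(3) by auto
    from smooth_map_onE[OF assms(1) this]
    obtain U g where U: "\<psi> u \<in> U" "open U" "\<And>k. ck_on k U g"
      and g: "\<And>x. x \<in> N \<Longrightarrow> x \<in> U \<Longrightarrow> g x = f x" by metis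
    let ?V = "W \<inter> \<psi> -` U"
    have V: "open ?V"
      using continuous_open_preimage[OF ck_on_imp_continuous_on[OF \<psi>] W U(2)] by simp
    have "ck_on k ?V (\<lambda>u. g (\<psi> u))"
      by (rule ck_on_compose[OF V _ ck_on_subset[OF \<psi>] U(3)]) (use U in auto)
    moreover have "g (\<psi> u) = f (\<psi> u)" if "u \<in> ?V" for u using that g assms(3) by auto
    ultimately have "ck_on k ?V (\<lambda>u. f (\<psi> u))" by (subst ck_on_cong[OF V, symmetric]) auto
    with V u U(1) show "\<exists>V. open V \<and> u \<in> V \<and> ck_on k V (\<lambda>u. f (\<psi> u))" by blast
  qed
qed

lemma local_parametrizationD:
  assumes "local_parametrization M W \<psi>"
  shows "open W" "ck_on k W \<psi>" "smooth_on_open W \<psi>" "\<psi> ` W \<subseteq> M" "openin (top_of_set M) (\<psi> ` W)"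
    "inj_on \<psi> W" "u \<in> W \<Longrightarrow> inj (frechet_derivative \<psi> (at u))"
    "u \<in> W \<Longrightarrow> (\<psi> has_derivative frechet_derivative \<psi> (at u)) (at u)"
    "u \<in> W \<Longrightarrow> linear (frechet_derivative \<psi> (at u))"
proof -
  show "open W" "ck_on k W \<psi>" "smooth_on_open W \<psi>" "openin (top_of_set M) (\<psi> ` W)"
    "u \<in> W \<Longrightarrow> inj (frechet_derivative \<psi> (at u))"
    using assms by (auto simp: local_parametrization_def smooth_on_open_def)
  show "\<psi> ` W \<subseteq> M" using assms by (meson local_parametrization_def openin_imp_subset)
  obtain \<rho> where "homeomorphism W (\<psi> ` W) \<psi> \<rho>" using assms by (auto simp: local_parametrization_def)
  then show "inj_on \<psi> W" by (metis homeomorphism_def inj_on_inverseI)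
  have ck: "ck_on (Suc 0) W \<psi>" using assms by (auto simp: local_parametrization_def smooth_on_open_def)
  show d: "u \<in> W \<Longrightarrow> (\<psi> has_derivative frechet_derivative \<psi> (at u)) (at u)"
    by (rule ck_on_has_derivative[OF ck])
  show "u \<in> W \<Longrightarrow> linear (frechet_derivative \<psi> (at u))"
    using d has_derivative_linear by blast
qed

lemma local_parametrization_inverse:
  assumes "local_parametrization M W \<psi>"
  obtains \<rho> where "continuous_on (\<psi> ` W) \<rho>" "\<And>u. u \<in> W \<Longrightarrow> \<rho> (\<psi> u) = u"
  using assms by (auto simp: local_parametrization_def homeomorphism_def)

lemma frame_coord_frame:
  assumes "local_parametrization M W \<psi>" "u \<in> W"
  shows "frame (coord_frame \<psi> u)"
    and "span (range (coord_frame \<psi> u)) = range (frechet_derivative \<psi> (at u))"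
    and "frechet_derivative \<psi> (at u) x = (\<Sum>i\<in>UNIV. x $ i *\<^sub>R coord_frame \<psi> u i)"
proof -
  let ?L = "frechet_derivative \<psi> (at u)"
  note L = local_parametrizationD(7,9)[OF assms]
  have eq: "?L x = (\<Sum>i\<in>UNIV. x $ i *\<^sub>R coord_frame \<psi> u i)" for x
    unfolding coord_frame_def by (rule linear_eq_sum_axis[OF L(2)])
  show "?L x = (\<Sum>i\<in>UNIV. x $ i *\<^sub>R coord_frame \<psi> u i)" by (rule eq)
  show "frame (coord_frame \<psi> u)"
    using L by (auto simp: frame_def eq[symmetric] linear_injective_0)
  show "span (range (coord_frame \<psi> u)) = range ?L"
  proof
    have "range (coord_frame \<psi> u) \<subseteq> range ?L" by (auto simp: coord_frame_def)
    then show "span (range (coord_frame \<psi> u)) \<subseteq> range ?L"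
      by (intro span_minimal linear_subspace_image[OF L(2)] subspace_UNIV)
    show "range ?L \<subseteq> span (range (coord_frame \<psi> u))"
      by (auto simp: eq intro!: span_sum span_scale intro: span_base)
  qed
qed

lemma ck_on_affine_line:
  fixes f :: "'a::euclidean_space \<Rightarrow> 'b::euclidean_space"
  assumes "smooth_on_open W f" "open I" "\<And>s. s \<in> I \<Longrightarrow> u + s *\<^sub>R v \<in> W"
  shows "smooth_on_open (I :: real set) (\<lambda>s. f (u + s *\<^sub>R v))"
proof -
  have line: "ck_on k I (\<lambda>s. u + s *\<^sub>R v)" for k
    by (intro ck_on_add ck_on_const ck_on_scaleR ck_on_id assms)
  have "ck_on k I (\<lambda>s. f (u + s *\<^sub>R v))" for k
    by (rule ck_on_compose[OF assms(2) _ line, where V = W]) (use assms in \<open>auto simp: smooth_on_open_def\<close>)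
  then show ?thesis using assms(2) by (simp add: smooth_on_open_def)
qed

lemma openin_in_chart:
  fixes \<gamma> :: "'t::t2_space \<Rightarrow> 'a::euclidean_space"
  assumes "local_parametrization M W \<psi>" "isCont \<gamma> x" "open S" "x \<in> S" "\<gamma> ` S \<subseteq> M" "\<gamma> x \<in> \<psi> ` W"
  obtains V where "open V" "x \<in> V" "V \<subseteq> S" "\<gamma> ` V \<subseteq> \<psi> ` W"
proof -
  obtain O' where O': "open O'" "\<psi> ` W = M \<inter> O'"
    using local_parametrizationD(5)[OF assms(1)] by (auto simp: openin_open)
  have "\<gamma> x \<in> O'" using O' assms(6) by blast
  with assms(2) O'(1) have "\<exists>A. open A \<and> x \<in> A \<and> (\<forall>y\<in>A. \<gamma> y \<in> O')"
    by (simp add: continuous_at_open)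
  then obtain A where "open A" "x \<in> A" "\<And>y. y \<in> A \<Longrightarrow> \<gamma> y \<in> O'"
    by (elim exE conjE) simp
  then show thesis using assms O' by (intro that[of "A \<inter> S"]) auto
qed

text \<open>Straight lines in the parameter domain realize every vector of the span. Conversely a
  curve in M stays in the relatively open chart image for short times, and
  \<open>has_derivative_lift\<close> differentiates its coordinates. In particular the tangent
  vectors form a subspace, which the definition by curves does not show.\<close>

lemma tangent_space_chart:
  assumes lp: "local_parametrization M W \<psi>" and u: "u \<in> W"
  shows "tangent_space M (\<psi> u) = span (range (coord_frame \<psi> u))"
proof -
  let ?L = "frechet_derivative \<psi> (at u)"
  note W = local_parametrizationD[OF lp]
  have "tangent_space M (\<psi> u) = range ?L"
  proof (intro set_eqI iffI)
    fix v assume "v \<in> range ?L"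
    then obtain w where w: "v = ?L w" by blast
    obtain r where r: "r > 0" "ball u r \<subseteq> W" using W(1) u openE by blast
    define e where "e = r / (norm w + 1)"
    have n1: "norm w + 1 > 0" by (simp add: add_nonneg_pos)
    then have e: "e > 0" using r by (simp add: e_def)
    have in_W: "u + s *\<^sub>R w \<in> W" if "s \<in> {-e<..<e}" for s
    proof -
      have "norm (s *\<^sub>R w) \<le> \<bar>s\<bar> * (norm w + 1)" by (simp add: mult_left_mono)
      also have "\<dots> < e * (norm w + 1)" using that n1 by (intro mult_strict_right_mono) auto
      also have "\<dots> = r" using n1 by (simp add: e_def)
      finally show ?thesis using r by (auto simp: dist_norm)
    qed
    have "((\<lambda>s. \<psi> (u + s *\<^sub>R w)) has_vector_derivative ?L w) (at 0)"
      by (rule has_vector_derivative_line) (use W(8)[OF u] in simp)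
    moreover have "smooth_on_open {-e<..<e} (\<lambda>s. \<psi> (u + s *\<^sub>R w))"
      by (rule ck_on_affine_line[OF W(3) _ in_W]) auto
    moreover have "(\<lambda>s. \<psi> (u + s *\<^sub>R w)) ` {-e<..<e} \<subseteq> M"
      using in_W W(4) by (simp add: image_subset_iff)
    ultimately show "v \<in> tangent_space M (\<psi> u)"
      unfolding tangent_space_def w mem_Collect_eq
      by (intro exI[of _ e] exI[of _ "\<lambda>s. \<psi> (u + s *\<^sub>R w)"] conjI e) simp_all
  next
    fix v assume "v \<in> tangent_space M (\<psi> u)"
    then obtain e \<gamma> where e: "e > 0" "smooth_on_open {-e<..<e} \<gamma>" "\<gamma> ` {-e<..<e} \<subseteq> M"
      "\<gamma> 0 = \<psi> u" "(\<gamma> has_vector_derivative v) (at (0::real))"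
      by (auto simp: tangent_space_def)
    obtain \<rho> where \<rho>: "continuous_on (\<psi> ` W) \<rho>" "\<And>u. u \<in> W \<Longrightarrow> \<rho> (\<psi> u) = u"
      using local_parametrization_inverse[OF lp] by blast
    have cont: "continuous_on {-e<..<e} \<gamma>"
      by (rule ck_on_imp_continuous_on[of 0]) (use e(2) in \<open>simp add: smooth_on_open_def\<close>)
    then have "isCont \<gamma> 0" using e(1) by (simp add: continuous_on_eq_continuous_at)
    from openin_in_chart[OF lp this, of "{-e<..<e}"]
    obtain V where V: "open V" "0 \<in> V" "V \<subseteq> {-e<..<e}" "\<gamma> ` V \<subseteq> \<psi> ` W"
      using e u by auto
    define h where "h s = \<rho> (\<gamma> s)" for s
    have \<psi>h: "\<psi> (h s) = \<gamma> s" if "s \<in> V" for s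
    proof -
      obtain w where "w \<in> W" "\<gamma> s = \<psi> w" using V(4) \<open>s \<in> V\<close> by auto
      then show ?thesis by (simp add: h_def \<rho>(2))
    qed
    have h0: "h 0 = u" using e(4) \<rho>(2) u by (simp add: h_def)
    have "continuous_on V h"
      unfolding h_def using V by (intro continuous_on_compose2[OF \<rho>(1)] continuous_on_subset[OF cont]) auto
    then have hc: "isCont h 0" using V by (simp add: continuous_on_eq_continuous_at)
    have D: "((\<lambda>s. \<psi> (h s)) has_derivative (\<lambda>s. s *\<^sub>R v)) (at 0)"
      by (rule has_derivative_transform_within_open[where f = \<gamma> and s = V])
        (use e(5) V \<psi>h in \<open>auto simp: has_vector_derivative_def\<close>)
    have "(\<psi> has_derivative ?L) (at (h 0))" using W(8)[OF u] h0 by simp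
    from has_derivative_lift[OF this W(7)[OF u] D hc]
    obtain h' where "\<And>s. ?L (h' s) = s *\<^sub>R v" by blast
    from this[of 1] show "v \<in> range ?L" by (metis rangeI scaleR_one)
  qed
  then show ?thesis using frame_coord_frame(2)[OF lp u] by simp
qed

text \<open>A local smooth extension provides one derivative within M, so the one selected in
  \<open>differential_on\<close> is a genuine derivative, although it need not be the same
  one.\<close>

lemma smooth_map_on_has_derivative_within:
  assumes "smooth_map_on M f" "p \<in> M"
  shows "(f has_derivative differential_on M f p) (at p within M)"
proof -
  from smooth_map_onE[OF assms]
  obtain U g where U: "p \<in> U" "open U" "\<And>k. ck_on k U g"
    and g: "\<And>x. x \<in> M \<Longrightarrow> x \<in> U \<Longrightarrow> g x = f x" by metis
  have "(g has_derivative frechet_derivative g (at p)) (at p within M)"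
    by (rule has_derivative_at_withinI[OF ck_on_has_derivative[OF U(3) U(1)]])
  then have "(g has_derivative frechet_derivative g (at p)) (at p within M \<inter> U)"
    by (rule has_derivative_subset) auto
  then have "(f has_derivative frechet_derivative g (at p)) (at p within M \<inter> U)"
    by (rule has_derivative_transform[rotated 2]) (use U(1) assms(2) g in auto)
  moreover have "at p within M \<inter> U = at p within M"
    by (rule at_within_nhd[OF U(1,2)]) auto
  ultimately have "(f has_derivative frechet_derivative g (at p)) (at p within M)" by simp
  then have "f differentiable (at p within M)" by (rule differentiableI)
  then show ?thesis
    unfolding differential_on_def by (simp only: frechet_derivative_works)
qed

text \<open>The chain rule within M holds for whichever derivative is selected, so its values on
  tangent vectors are determined by derivatives in the chart.\<close>

lemma differential_on_chart:
  assumes lp: "local_parametrization M W \<psi>" and u: "u \<in> W" and f: "smooth_map_on M f"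
  shows "frechet_derivative (\<lambda>u. f (\<psi> u)) (at u) v = differential_on M f (\<psi> u) (frechet_derivative \<psi> (at u) v)"
    and "linear (differential_on M f (\<psi> u))"
proof -
  note W = local_parametrizationD[OF lp]
  have fd: "(f has_derivative differential_on M f (\<psi> u)) (at (\<psi> u) within M)"
    using u W(4) by (intro smooth_map_on_has_derivative_within[OF f]) auto
  then show "linear (differential_on M f (\<psi> u))" by (rule has_derivative_linear)
  have "((\<lambda>u. f (\<psi> u)) has_derivative (\<lambda>v. differential_on M f (\<psi> u) (frechet_derivative \<psi> (at u) v))) (at u within W)"
    by (rule has_derivative_in_compose[OF has_derivative_at_withinI[OF W(8)[OF u]]
          has_derivative_subset[OF fd W(4)]])
  then have "((\<lambda>u. f (\<psi> u)) has_derivative (\<lambda>v. differential_on M f (\<psi> u) (frechet_derivative \<psi> (at u) v))) (at u)"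
    by (simp only: at_within_open[OF u W(1)])
  from frechet_derivative_at[OF this]
  show "frechet_derivative (\<lambda>u. f (\<psi> u)) (at u) v = differential_on M f (\<psi> u) (frechet_derivative \<psi> (at u) v)"
    by metis
qed

lemma differential_on_coord_frame:
  assumes "local_parametrization M W \<psi>" "u \<in> W" "smooth_map_on M f"
  shows "differential_on M f (\<psi> u) (coord_frame \<psi> u i) = coord_frame (\<lambda>u. f (\<psi> u)) u i"
  using differential_on_chart(1)[OF assms] by (simp add: coord_frame_def)

text \<open>The classical coordinate expression of |df|^2 with the inverse metric. It eliminates the
  selected orthonormal basis, so the energy density inherits the regularity of \<open>f\<close> and
  of the chart.\<close>

lemma differential_norm_sq_chart:
  assumes lp: "local_parametrization M W \<psi>" and u: "u \<in> W" and f: "smooth_map_on M f"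
  shows "differential_norm_sq M f (\<psi> u) = (\<Sum>i\<in>UNIV. \<Sum>j\<in>UNIV.
    matrix_inv (gram_matrix \<psi> u) $ i $ j * (coord_frame (\<lambda>u. f (\<psi> u)) u i \<bullet> coord_frame (\<lambda>u. f (\<psi> u)) u j))"
proof -
  let ?T = "span (range (coord_frame \<psi> u))"
  let ?B = "SOME B. orthonormal_basis_of (tangent_space M (\<psi> u)) B"
  have "\<exists>B. orthonormal_basis_of ?T B" by (meson orthonormal_basis_exists subspace_span)
  then have B: "orthonormal_basis_of ?T ?B"
    unfolding tangent_space_chart[OF lp u] by (rule someI_ex)
  show ?thesis
    unfolding differential_norm_sq_def power2_norm_eq_inner
    by (subst orthonormal_contraction_eq_frame[OF frame_coord_frame(1)[OF lp u] B])
      (simp_all add: differential_on_chart(2)[OF lp u f] differential_on_coord_frame[OF lp u f]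
        dual_frame_inner_dual[OF frame_coord_frame(1)[OF lp u]] gram_matrix_eq)
qed

lemma smooth_map_on_slice:
  assumes "smooth_map_on (I \<times> M) (\<lambda>(t, x). F t x)" "t \<in> I"
  shows "smooth_map_on M (F t)"
  unfolding smooth_map_on_def
proof
  fix p assume "p \<in> M"
  then have "(t, p) \<in> I \<times> M" using assms(2) by simp
  from smooth_map_onE[OF assms(1) this]
  obtain U g where U: "(t, p) \<in> U" "open U" "\<And>k. ck_on k U g"
    and g: "\<And>y. y \<in> I \<times> M \<Longrightarrow> y \<in> U \<Longrightarrow> g y = (case y of (t, x) \<Rightarrow> F t x)" by metis
  let ?V = "(\<lambda>x. (t, x)) -` U"
  have V: "open ?V" using U(2) by (intro open_vimage) (auto intro!: continuous_intros)
  have "ck_on k ?V (\<lambda>x. g (t, x))" for k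
    by (rule ck_on_compose[OF V U(2) ck_on_Pair[OF V ck_on_const ck_on_id] U(3)]) auto
  then have "smooth_on_open ?V (\<lambda>x. g (t, x))" using V by (simp add: smooth_on_open_def)
  moreover have "g (t, x) = F t x" if "x \<in> M \<inter> ?V" for x using g[of "(t, x)"] that assms(2) by simp
  ultimately show "\<exists>U g. p \<in> U \<and> smooth_on_open U g \<and> (\<forall>x\<in>M \<inter> U. g x = F t x)"
    using U(1) by blast
qed

lemma smooth_variation_chart:
  assumes "smooth_map_on (I \<times> M) (\<lambda>(t, x). F t x)" "open I" "local_parametrization M W \<psi>"
  shows "smooth_on_open (I \<times> W) (\<lambda>(t, u). F t (\<psi> u))"
proof -
  note W = local_parametrizationD[OF assms(3)]
  have op: "open (I \<times> W)" using assms(2) W(1) by (simp add: open_Times)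
  have fst: "ck_on k (I \<times> W) fst" and snd: "ck_on k (I \<times> W) snd" for k
    using ck_on_bounded_linear[OF op bounded_linear_fst ck_on_id]
      ck_on_bounded_linear[OF op bounded_linear_snd ck_on_id] by auto
  have "ck_on k (I \<times> W) (\<lambda>z. (fst z, \<psi> (snd z)))" for k
    by (intro ck_on_Pair op fst ck_on_compose[OF op W(1) snd W(2)]) auto
  then have "smooth_on_open (I \<times> W) (\<lambda>z. (fst z, \<psi> (snd z)))"
    using op by (simp add: smooth_on_open_def)
  from smooth_map_on_compose[OF assms(1) this] W(4)
  show ?thesis by (simp add: case_prod_unfold image_subset_iff mem_Times_iff)
qed

section \<open>Change of variables\<close>

text \<open>The change of variables theorem of the library needs a well-ordered index type; a copy of an
  arbitrary finite type with a well-order carries it over to all finite index types.\<close>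

typedef 'a ordered_copy = "UNIV :: 'a set" morphisms of_copy to_copy by simp

lemma bij_of_copy: "bij of_copy"
  by (rule bijI') (auto simp: of_copy_inject intro: to_copy_inverse[symmetric])

instance ordered_copy :: (finite) finite
proof
  have "inj (of_copy :: 'a ordered_copy \<Rightarrow> 'a)" using bij_of_copy by (rule bij_is_inj)
  then show "finite (UNIV :: 'a ordered_copy set)"
    by (rule finite_imageD[rotated]) (rule finite_subset[OF subset_UNIV finite])
qed

instantiation ordered_copy :: (finite) wellorder
begin

definition copy_index :: "'a ordered_copy \<Rightarrow> nat" where
  "copy_index = (SOME f. inj f)"

definition less_eq_ordered_copy :: "'a ordered_copy \<Rightarrow> 'a ordered_copy \<Rightarrow> bool" where
  "less_eq_ordered_copy x y \<longleftrightarrow> copy_index x \<le> copy_index y"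

definition less_ordered_copy :: "'a ordered_copy \<Rightarrow> 'a ordered_copy \<Rightarrow> bool" where
  "less_ordered_copy x y \<longleftrightarrow> copy_index x < copy_index y"

lemma inj_copy_index: "inj (copy_index :: 'a ordered_copy \<Rightarrow> nat)"
proof -
  obtain f :: "'a ordered_copy \<Rightarrow> nat" and n where "inj f"
    using finite_imp_inj_to_nat_seg[of "UNIV :: 'a ordered_copy set"] by auto
  then have "\<exists>f :: 'a ordered_copy \<Rightarrow> nat. inj f" by blast
  then show "inj (copy_index :: 'a ordered_copy \<Rightarrow> nat)"
    unfolding copy_index_def by (rule someI_ex)
qed

instance
proof
  fix P :: "'a ordered_copy \<Rightarrow> bool" and a
  assume step: "\<And>x. (\<And>y. y < x \<Longrightarrow> P y) \<Longrightarrow> P x"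
  show "P a"
    by (induction a rule: measure_induct_rule[of copy_index]) (rule step, simp add: less_ordered_copy_def)
qed (auto simp: less_eq_ordered_copy_def less_ordered_copy_def intro: injD[OF inj_copy_index])

end

definition reindex :: "real^'n \<Rightarrow> real^('n ordered_copy)" where
  "reindex x = (\<chi> i. x $ of_copy i)"

definition unindex :: "real^('n ordered_copy) \<Rightarrow> real^'n" where
  "unindex y = (\<chi> i. y $ to_copy i)"

lemma unindex_reindex [simp]: "unindex (reindex x) = x" "reindex (unindex y) = y"
  by (simp_all add: unindex_def reindex_def vec_eq_iff to_copy_inverse of_copy_inverse)

lemma bounded_linear_reindex: "bounded_linear reindex" "bounded_linear unindex"
  by (auto simp: linear_conv_bounded_linear[symmetric] reindex_def unindex_def vec_eq_iff
      intro!: linearI)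

lemma reindex_measurable: "reindex \<in> borel_measurable borel" "unindex \<in> borel_measurable borel"
  by (intro borel_measurable_continuous_onI linear_continuous_on bounded_linear_reindex)+

lemma prod_Basis_cart:
  fixes x :: "real^'n"
  shows "(\<Prod>b\<in>Basis. x \<bullet> b) = (\<Prod>i\<in>UNIV. x $ i)"
proof -
  have B: "(Basis :: (real^'n) set) = (\<lambda>i. axis i 1) ` UNIV" by (auto simp: Basis_vec_def)
  have inj: "inj (\<lambda>i. axis i (1::real) :: real^'n)" by (auto simp: inj_on_def axis_eq_axis)
  have "(\<Prod>b\<in>Basis. x \<bullet> b) = (\<Prod>i\<in>UNIV. x \<bullet> axis i 1)"
    unfolding B by (rule prod.reindex[OF inj, unfolded o_def])
  then show ?thesis by (simp add: inner_axis)
qed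

text \<open>Lebesgue measure is determined by boxes, and renaming the coordinates only permutes the
  side lengths.\<close>

lemma lborel_distr_reindex: "distr lborel lborel (reindex :: real^'n \<Rightarrow> _) = lborel"
proof (rule lborel_eqI[symmetric])
  fix l u :: "real^('n ordered_copy)"
  assume "\<And>b. b \<in> Basis \<Longrightarrow> l \<bullet> b \<le> u \<bullet> b"
  from this[of "axis i 1" for i] have lu: "l $ i \<le> u $ i" for i by (simp add: inner_axis)
  have box: "reindex -` box l u = box (unindex l) (unindex u)"
  proof (intro set_eqI iffI)
    fix x assume x: "x \<in> reindex -` box l u"
    have "l $ i < x $ of_copy i \<and> x $ of_copy i < u $ i" for i
      using x by (simp add: mem_box_cart reindex_def)
    from this[of "to_copy i" for i] show "x \<in> box (unindex l) (unindex u)"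
      by (simp add: mem_box_cart unindex_def to_copy_inverse)
  next
    fix x assume x: "x \<in> box (unindex l) (unindex u)"
    have "l $ to_copy i < x $ i \<and> x $ i < u $ to_copy i" for i
      using x by (simp add: mem_box_cart unindex_def)
    from this[of "of_copy i" for i] show "x \<in> reindex -` box l u"
      by (simp add: mem_box_cart reindex_def of_copy_inverse)
  qed
  have "(\<Prod>i\<in>UNIV. (u - l) $ to_copy i) = (\<Prod>i\<in>UNIV. (u - l) $ i)"
    by (rule prod.reindex_bij_betw[of to_copy UNIV UNIV])
      (rule bij_betw_byWitness[where f' = of_copy], auto simp: to_copy_inverse of_copy_inverse)
  then have p: "(\<Prod>b\<in>Basis. (unindex u - unindex l) \<bullet> b) = (\<Prod>b\<in>Basis. (u - l) \<bullet> b)"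
    by (simp add: prod_Basis_cart unindex_def)
  have "emeasure (distr lborel lborel reindex) (box l u) = emeasure lborel (box (unindex l) (unindex u))"
    using reindex_measurable(1) by (subst emeasure_distr) (auto simp: box)
  also have "\<dots> = (\<Prod>b\<in>Basis. (unindex u - unindex l) \<bullet> b)"
    by (rule emeasure_lborel_box) (auto simp: Basis_vec_def inner_axis unindex_def lu)
  finally show "emeasure (distr lborel lborel reindex) (box l u) = (\<Prod>b\<in>Basis. (u - l) \<bullet> b)"
    by (simp only: p)
qed simp

text \<open>Conjugation by \<open>f\<close> is a sign-preserving bijection between the permutations
  of the two index types, and it matches the terms of the Leibniz formula.\<close>

lemma det_reindex:
  fixes A :: "real^'n^'n"
  assumes f: "bij (f :: 'm::finite \<Rightarrow> 'n::finite)"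
  shows "det (\<chi> i j. A $ f i $ f j) = det A"
proof -
  have inj: "inj f" using f by (rule bij_is_inj)
  have surj: "f ` UNIV = UNIV" using f by (simp add: bij_def)
  let ?P = "\<lambda>S. {p. p permutes S}"
  have bij: "bij_betw (map_permutation UNIV f) (?P (UNIV :: 'm set)) (?P (UNIV :: 'n set))"
  proof (rule bij_betwI[where g = "map_permutation UNIV (inv f)"])
    have inv: "inj (inv f)" "inv f ` UNIV = UNIV" using f by (simp_all add: bij_imp_bij_inv bij_is_inj bij_is_surj)
    show "map_permutation UNIV f \<in> ?P UNIV \<rightarrow> ?P UNIV"
      using map_permutation_permutes[of f UNIV UNIV] f by auto
    show "map_permutation UNIV (inv f) \<in> ?P UNIV \<rightarrow> ?P UNIV"
      using map_permutation_permutes[of "inv f" UNIV UNIV] f by (auto simp: bij_imp_bij_inv)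
    show "map_permutation UNIV (inv f) (map_permutation UNIV f p) = p" if "p \<in> ?P UNIV" for p
      using inj surj inv by (auto simp: fun_eq_iff map_permutation_def restrict_id_def inv_f_f f_inv_into_f)
    show "map_permutation UNIV f (map_permutation UNIV (inv f) p) = p" if "p \<in> ?P UNIV" for p
      using inj surj inv f by (auto simp: fun_eq_iff map_permutation_def restrict_id_def inv_f_f
          surj_f_inv_f bij_is_surj inv_inv_eq)
  qed
  have app: "map_permutation UNIV f p (f i) = f (p i)" for p i
    using inj by (simp add: map_permutation_apply)
  have "det A = (\<Sum>q\<in>?P UNIV. of_int (sign q) * (\<Prod>i\<in>UNIV. A $ i $ q i))"
    by (simp add: det_def)
  also have "\<dots> = (\<Sum>p\<in>?P UNIV. of_int (sign (map_permutation UNIV f p)) *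
      (\<Prod>i\<in>UNIV. A $ i $ map_permutation UNIV f p i))"
    by (rule sum.reindex_bij_betw[OF bij, symmetric])
  also have "\<dots> = (\<Sum>p\<in>?P UNIV. of_int (sign p) * (\<Prod>i\<in>UNIV. A $ f i $ f (p i)))"
  proof (rule sum.cong[OF refl])
    fix p :: "'m \<Rightarrow> 'm" assume p: "p \<in> ?P UNIV"
    have "(\<Prod>i\<in>UNIV. A $ i $ map_permutation UNIV f p i) = (\<Prod>i\<in>UNIV. A $ f i $ map_permutation UNIV f p (f i))"
      by (rule prod.reindex_bij_betw[OF f, symmetric])
    moreover have "sign (map_permutation UNIV f p) = sign p"
      using p inj by (intro sign_map_permutation) auto
    ultimately show "of_int (sign (map_permutation UNIV f p)) * (\<Prod>i\<in>UNIV. A $ i $ map_permutation UNIV f p i)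
        = of_int (sign p) * (\<Prod>i\<in>UNIV. A $ f i $ f (p i))"
      by (simp only: app)
  qed
  finally show ?thesis by (simp add: det_def)
qed

text \<open>\<open>has_measure_differentiable_image\<close> equates a finite measure of the image
  with a finite integral. An infinite integral therefore excludes a finite measure, and then both
  sides are infinite.\<close>

lemma emeasure_differentiable_image_wellorder:
  fixes \<tau> :: "real^'m::{finite,wellorder} \<Rightarrow> real^'m::_"
  assumes A: "A \<in> sets borel" and tA: "\<tau> ` A \<in> sets borel"
    and der: "\<And>x. x \<in> A \<Longrightarrow> (\<tau> has_derivative \<tau>' x) (at x)" and inj: "inj_on \<tau> A"
    and meas: "(\<lambda>x. indicator A x * \<bar>det (matrix (\<tau>' x))\<bar>) \<in> borel_measurable borel"
  shows "emeasure lborel (\<tau> ` A) = (\<integral>\<^sup>+x\<in>A. ennreal \<bar>det (matrix (\<tau>' x))\<bar> \<partial>lborel)"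
proof -
  let ?d = "\<lambda>x. \<bar>det (matrix (\<tau>' x))\<bar>"
  have *: "\<tau> ` A \<in> lmeasurable \<and> measure lebesgue (\<tau> ` A) = m \<longleftrightarrow> (?d has_integral m) A" for m
    by (rule has_measure_differentiable_image) (use A der inj in \<open>auto intro: has_derivative_at_withinI\<close>)
  have eq: "(\<integral>\<^sup>+x. ennreal (indicator A x * ?d x) \<partial>lborel) = (\<integral>\<^sup>+x\<in>A. ennreal (?d x) \<partial>lborel)"
    by (intro nn_integral_cong) (auto simp: indicator_def)
  show ?thesis
  proof (cases "(\<integral>\<^sup>+x\<in>A. ennreal (?d x) \<partial>lborel) = \<infinity>")
    case False
    then obtain m where m: "0 \<le> m" "(\<integral>\<^sup>+x\<in>A. ennreal (?d x) \<partial>lborel) = ennreal m"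
      by (cases "\<integral>\<^sup>+x\<in>A. ennreal (?d x) \<partial>lborel") auto
    have "((\<lambda>x. indicator A x * ?d x) has_integral m) UNIV"
      by (rule nn_integral_has_integral[OF meas]) (use m eq in auto)
    moreover have "(\<lambda>x. indicator A x * ?d x) = (\<lambda>x. if x \<in> A then ?d x else 0)"
      by (auto simp: indicator_def)
    ultimately have "(?d has_integral m) A" by (simp only: has_integral_restrict_UNIV)
    then have "\<tau> ` A \<in> lmeasurable" "measure lebesgue (\<tau> ` A) = m" using * by auto
    then have "emeasure lebesgue (\<tau> ` A) = ennreal m"
      using emeasure_eq_ennreal_measure[OF fmeasurableD2] by blast
    then show ?thesis using m tA by simp
  next
    case True
    show ?thesis
    proof (rule ccontr)
      assume ne: "emeasure lborel (\<tau> ` A) \<noteq> (\<integral>\<^sup>+x\<in>A. ennreal (?d x) \<partial>lborel)"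
      then have "\<tau> ` A \<in> lmeasurable"
        using tA True by (auto simp: fmeasurable_def less_top)
      then have "(?d has_integral measure lebesgue (\<tau> ` A)) A" using * by blast
      from nn_integral_has_integral_lebesgue'[OF _ this]
      have "(\<integral>\<^sup>+x\<in>A. ennreal (?d x) \<partial>lborel) = ennreal (measure lebesgue (\<tau> ` A))" by simp
      with True show False by simp
    qed
  qed
qed

lemma emeasure_differentiable_image:
  fixes \<tau> :: "real^'n \<Rightarrow> real^'n"
  assumes A: "A \<in> sets borel" and tA: "\<tau> ` A \<in> sets borel"
    and der: "\<And>x. x \<in> A \<Longrightarrow> (\<tau> has_derivative \<tau>' x) (at x)" and inj: "inj_on \<tau> A"
    and meas: "(\<lambda>x. indicator A x * \<bar>det (matrix (\<tau>' x))\<bar>) \<in> borel_measurable borel"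
  shows "emeasure lborel (\<tau> ` A) = (\<integral>\<^sup>+x\<in>A. ennreal \<bar>det (matrix (\<tau>' x))\<bar> \<partial>lborel)"
proof -
  let ?h = "reindex :: real^'n \<Rightarrow> _" and ?k = "unindex :: _ \<Rightarrow> real^'n"
  let ?\<sigma> = "\<lambda>y. ?h (\<tau> (?k y))" and ?\<sigma>' = "\<lambda>y v. ?h (\<tau>' (?k y) (?k v))"
  have him: "?h ` S = ?k -` S" for S
    by (auto simp: image_iff) (metis unindex_reindex(2))
  have hb: "?h ` S \<in> sets borel" if "S \<in> sets borel" for S
    unfolding him using measurable_sets_borel[OF reindex_measurable(2) that] by simp
  have hS: "?h -` (?h ` S) = S" for S by (auto simp: him)
  have em: "emeasure lborel (?h ` S) = emeasure lborel S" if "S \<in> sets borel" for S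
  proof -
    have "emeasure (distr lborel lborel ?h) (?h ` S) = emeasure lborel S"
      by (subst emeasure_distr) (use hb[OF that] reindex_measurable(1) hS in auto)
    then show ?thesis by (simp add: lborel_distr_reindex)
  qed
  have nn: "(\<integral>\<^sup>+y. f y \<partial>lborel) = (\<integral>\<^sup>+x. f (?h x) \<partial>lborel)" if "f \<in> borel_measurable borel" for f
  proof -
    have "(\<integral>\<^sup>+y. f y \<partial>distr lborel lborel ?h) = (\<integral>\<^sup>+x. f (?h x) \<partial>lborel)"
      by (rule nn_integral_distr) (use that reindex_measurable(1) in auto)
    then show ?thesis by (simp add: lborel_distr_reindex)
  qed
  have \<sigma>A: "?\<sigma> ` (?h ` A) = ?h ` (\<tau> ` A)" by (simp add: image_image)
  have axis: "?k (axis j 1) = axis (of_copy j) 1" for j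
    by (auto simp: unindex_def axis_def vec_eq_iff to_copy_inverse of_copy_inverse)
  have det: "det (matrix (?\<sigma>' y)) = det (matrix (\<tau>' (?k y)))" for y
  proof -
    have "matrix (?\<sigma>' y) = (\<chi> i j. matrix (\<tau>' (?k y)) $ of_copy i $ of_copy j)"
      by (simp add: matrix_def axis reindex_def vec_eq_iff)
    then show ?thesis by (simp add: det_reindex[OF bij_of_copy])
  qed
  have ind: "indicator (?h ` A) (?h x) = (indicator A x :: ennreal)" for x
    by (simp add: him indicator_def)
  have ind': "indicator (?h ` A) y = (indicator A (?k y) :: real)" for y
    by (simp add: him indicator_def)
  have "emeasure lborel (\<tau> ` A) = emeasure lborel (?\<sigma> ` (?h ` A))"
    unfolding \<sigma>A by (rule em[OF tA, symmetric])
  also have "\<dots> = (\<integral>\<^sup>+y\<in>?h ` A. ennreal \<bar>det (matrix (?\<sigma>' y))\<bar> \<partial>lborel)"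
  proof (rule emeasure_differentiable_image_wellorder)
    show "?h ` A \<in> sets borel" by (rule hb[OF A])
    show "?\<sigma> ` (?h ` A) \<in> sets borel" unfolding \<sigma>A by (rule hb[OF tA])
    show "(?\<sigma> has_derivative ?\<sigma>' y) (at y)" if "y \<in> ?h ` A" for y
    proof (rule bounded_linear.has_derivative[OF bounded_linear_reindex(1)])
      have "?k y \<in> A" using that by auto
      then show "((\<lambda>y. \<tau> (?k y)) has_derivative (\<lambda>v. \<tau>' (?k y) (?k v))) (at y)"
        by (intro has_derivative_compose[OF bounded_linear_imp_has_derivative[OF bounded_linear_reindex(2)]] der)
    qed
    have "inj ?h" by (metis injI unindex_reindex(1))
    then show "inj_on ?\<sigma> (?h ` A)" using inj by (auto simp: inj_on_def)
    show "(\<lambda>y. indicator (?h ` A) y * \<bar>det (matrix (?\<sigma>' y))\<bar>) \<in> borel_measurable borel"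
      unfolding det ind' using measurable_compose[OF reindex_measurable(2) meas] by simp
  qed
  also have "\<dots> = (\<integral>\<^sup>+x. ennreal \<bar>det (matrix (\<tau>' x))\<bar> * indicator A x \<partial>lborel)"
  proof -
    let ?f = "\<lambda>y. ennreal \<bar>det (matrix (?\<sigma>' y))\<bar> * indicator (?h ` A) y"
    have "?f = (\<lambda>y. ennreal (indicator A (?k y) * \<bar>det (matrix (\<tau>' (?k y)))\<bar>))"
      unfolding det him by (auto simp: indicator_def fun_eq_iff)
    also have "\<dots> \<in> borel_measurable borel"
      using measurable_compose[OF reindex_measurable(2) meas] by measurable
    finally have m: "?f \<in> borel_measurable borel" .
    have "?f (?h x) = ennreal \<bar>det (matrix (\<tau>' x))\<bar> * indicator A x" for x
      using det[of "?h x"] ind[of x] by (simp only: unindex_reindex)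
    then show ?thesis by (simp only: nn[OF m])
  qed
  finally show ?thesis .
qed

section \<open>The Riemannian volume\<close>

definition volume_density :: "(real^'n \<Rightarrow> 'a::euclidean_space) \<Rightarrow> real^'n \<Rightarrow> real" where
  "volume_density \<psi> u = sqrt (det (gram_matrix \<psi> u))"

lemma borel_Int_vimage:
  assumes "S \<in> sets borel" "continuous_on S f" "B \<in> sets borel"
  shows "S \<inter> f -` B \<in> sets borel"
proof -
  have "f -` B \<inter> space (restrict_space borel S) \<in> sets (restrict_space borel S)"
    by (rule measurable_sets[OF borel_measurable_continuous_on_restrict[OF assms(2)] assms(3)])
  then show ?thesis
    using assms(1) by (simp add: sets_restrict_space_iff space_restrict_space Int_commute)
qed

lemma gram_matrix_ck_on:
  assumes "local_parametrization M W \<psi>"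
  shows "ck_on k W (\<lambda>u. gram_matrix \<psi> u $ i $ j)"
proof -
  have "ck_on (Suc k) W \<psi>" by (rule local_parametrizationD(2)[OF assms])
  then have "ck_on k W (ddiff \<psi> v)" for v by simp
  then show ?thesis
    unfolding gram_matrix_def by (simp add: ck_on_inner[OF local_parametrizationD(1)[OF assms]])
qed

lemma det_gram_matrix_pos:
  assumes "local_parametrization M W \<psi>" "u \<in> W"
  shows "det (gram_matrix \<psi> u) > 0"
  unfolding gram_matrix_eq by (rule det_gram_pos[OF frame_coord_frame(1)[OF assms]])

lemma volume_density_pos:
  assumes "local_parametrization M W \<psi>" "u \<in> W"
  shows "volume_density \<psi> u > 0"
  using det_gram_matrix_pos[OF assms] by (simp add: volume_density_def)

lemma volume_density_ck_on:
  assumes "local_parametrization M W \<psi>"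
  shows "ck_on k W (volume_density \<psi>)"
proof -
  note W = local_parametrizationD(1)[OF assms]
  have "ck_on k W (\<lambda>u. sqrt (det (gram_matrix \<psi> u)))"
    by (intro ck_on_sqrt W ck_on_det gram_matrix_ck_on[OF assms] det_gram_matrix_pos[OF assms])
  then show ?thesis by (simp add: volume_density_def[abs_def])
qed

section \<open>Volume of a compact submanifold: chart independence, existence, uniqueness\<close>

locale compact_submanifold =
  fixes M :: "'a::euclidean_space set" and n :: "'n::finite itself" and vol :: "'a measure"
  assumes compact: "compact M" and submanifold: "embedded_submanifold TYPE('n) M"
    and vol: "vol = riemannian_volume TYPE('n) M"
begin

lemma M_borel: "M \<in> sets borel"
  using compact by (simp add: compact_imp_closed borel_closed)

lemma sets_M_iff: "B \<in> sets (restrict_space borel M) \<longleftrightarrow> B \<in> sets borel \<and> B \<subseteq> M"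
  using M_borel by (auto simp: sets_restrict_space_iff)

lemma chart_image_borel:
  assumes lp: "local_parametrization M W (\<psi> :: real^'n \<Rightarrow> 'a)" and A: "A \<in> sets borel" "A \<subseteq> W"
  shows "\<psi> ` A \<in> sets borel"
proof -
  obtain S where S: "open S" "\<psi> ` W = M \<inter> S"
    using local_parametrizationD(5)[OF lp] by (auto simp: openin_open)
  then have b: "\<psi> ` W \<in> sets borel" using M_borel by simp
  obtain \<rho> where \<rho>: "continuous_on (\<psi> ` W) \<rho>" "\<And>u. u \<in> W \<Longrightarrow> \<rho> (\<psi> u) = u"
    using local_parametrization_inverse[OF lp] by blast
  have "\<psi> ` A = \<psi> ` W \<inter> \<rho> -` A" using A(2) \<rho>(2) by (auto simp: subset_iff)
  then show ?thesis using borel_Int_vimage[OF b \<rho>(1) A(1)] by simp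
qed

lemma chart_preimage_borel:
  assumes lp: "local_parametrization M W (\<psi> :: real^'n \<Rightarrow> 'a)" and B: "B \<in> sets borel"
  shows "W \<inter> \<psi> -` B \<in> sets borel"
  by (rule borel_Int_vimage[OF _ ck_on_imp_continuous_on[OF local_parametrizationD(2)[OF lp, of 0]] B])
    (use local_parametrizationD(1)[OF lp] in simp)

lemma density_measurable:
  assumes lp: "local_parametrization M W (\<psi> :: real^'n \<Rightarrow> 'a)"
  shows "(\<lambda>u. indicator W u * volume_density \<psi> u) \<in> borel_measurable borel"
  using borel_measurable_continuous_on_indicator[OF _
      ck_on_imp_continuous_on[OF volume_density_ck_on[OF lp, of 0]]]
    local_parametrizationD(1)[OF lp] by simp

text \<open>With T the Jacobian of the transition the Gram matrices satisfy G = T^t G' T, so the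
  roots of their determinants differ by the factor |det T|. That the transition is differentiable
  comes from \<open>has_derivative_lift\<close>.\<close>

lemma transition_density:
  assumes lp: "local_parametrization M W (\<psi> :: real^'n \<Rightarrow> 'a)"
    and lp': "local_parametrization M W' (\<psi>' :: real^'n \<Rightarrow> 'a)"
    and \<tau>: "\<And>u. u \<in> V \<Longrightarrow> \<psi>' (\<tau> u) = \<psi> u" "\<tau> ` V \<subseteq> W'" "V \<subseteq> W" "open V" "continuous_on V \<tau>"
    and u: "u \<in> V"
  shows "(\<tau> has_derivative frechet_derivative \<tau> (at u)) (at u)"
    and "\<bar>det (matrix (frechet_derivative \<tau> (at u)))\<bar> * volume_density \<psi>' (\<tau> u) = volume_density \<psi> u"
proof -
  have uW: "u \<in> W" "\<tau> u \<in> W'" using \<tau>(2,3) u by auto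
  have "((\<lambda>u. \<psi>' (\<tau> u)) has_derivative frechet_derivative \<psi> (at u)) (at u)"
    by (rule has_derivative_transform_within_open[OF local_parametrizationD(8)[OF lp uW(1)] \<tau>(4) u])
      (simp add: \<tau>(1))
  moreover have "isCont \<tau> u" using \<tau>(4,5) u by (simp add: continuous_on_eq_continuous_at)
  ultimately obtain t where t: "(\<tau> has_derivative t) (at u)"
    and tt: "\<And>v. frechet_derivative \<psi>' (at (\<tau> u)) (t v) = frechet_derivative \<psi> (at u) v"
    using has_derivative_lift[where h = \<tau> and x = u, OF local_parametrizationD(8,7)[OF lp' uW(2)]] by blast
  have ft: "frechet_derivative \<tau> (at u) = t" using frechet_derivative_at[OF t] by simp
  then show "(\<tau> has_derivative frechet_derivative \<tau> (at u)) (at u)" using t by simp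
  let ?T = "matrix t"
  have "gram_matrix \<psi> u $ i $ j = (transpose ?T ** (gram_matrix \<psi>' (\<tau> u) ** ?T)) $ i $ j" for i j
  proof -
    have "gram_matrix \<psi> u $ i $ j
        = frechet_derivative \<psi>' (at (\<tau> u)) (t (axis i 1)) \<bullet> frechet_derivative \<psi>' (at (\<tau> u)) (t (axis j 1))"
      by (simp add: gram_matrix_def tt)
    also have "\<dots> = t (axis i 1) \<bullet> (gram_matrix \<psi>' (\<tau> u) *v t (axis j 1))"
      unfolding gram_matrix_eq inner_gram
      by (subst frame_coord_frame(3)[OF lp' uW(2)])+ simp
    also have "\<dots> = (transpose ?T ** (gram_matrix \<psi>' (\<tau> u) ** ?T)) $ i $ j"
      by (simp add: inner_vec_def matrix_vector_mult_def matrix_matrix_mult_def matrix_def transpose_def)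
    finally show ?thesis .
  qed
  then have "gram_matrix \<psi> u = transpose ?T ** (gram_matrix \<psi>' (\<tau> u) ** ?T)"
    by (simp add: vec_eq_iff)
  then have "det (gram_matrix \<psi> u) = (det ?T)\<^sup>2 * det (gram_matrix \<psi>' (\<tau> u))"
    by (simp add: det_mul power2_eq_square)
  then show "\<bar>det (matrix (frechet_derivative \<tau> (at u)))\<bar> * volume_density \<psi>' (\<tau> u) = volume_density \<psi> u"
    by (simp add: volume_density_def real_sqrt_mult ft)
qed

text \<open>The change of variables formula concerns measures of images. Applied to all Borel
  subsets of \<open>A\<close> it becomes the equality \<open>key\<close> of measures, against which
  the density of the second chart is then integrated.\<close>

lemma chart_volume_eq:
  assumes lp: "local_parametrization M W (\<psi> :: real^'n \<Rightarrow> 'a)"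
    and lp': "local_parametrization M W' (\<psi>' :: real^'n \<Rightarrow> 'a)"
    and A: "A \<in> sets borel" "A \<subseteq> W" "\<psi> ` A \<subseteq> \<psi>' ` W'"
  shows "(\<integral>\<^sup>+u\<in>A. ennreal (volume_density \<psi> u) \<partial>lborel)
    = (\<integral>\<^sup>+u\<in>W' \<inter> \<psi>' -` (\<psi> ` A). ennreal (volume_density \<psi>' u) \<partial>lborel)"
proof -
  note W = local_parametrizationD[OF lp] and W' = local_parametrizationD[OF lp']
  obtain S where S: "open S" "\<psi>' ` W' = M \<inter> S"
    using W'(5) by (auto simp: openin_open)
  obtain \<rho> where \<rho>: "continuous_on (\<psi>' ` W') \<rho>" "\<And>u. u \<in> W' \<Longrightarrow> \<rho> (\<psi>' u) = u"
    using local_parametrization_inverse[OF lp'] by blast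
  define V where "V = W \<inter> \<psi> -` S"
  define \<tau> where "\<tau> u = \<rho> (\<psi> u)" for u
  have cont: "continuous_on W \<psi>" by (rule ck_on_imp_continuous_on[OF W(2)[of 0]])
  have V: "open V" "V \<subseteq> W" "\<psi> ` V \<subseteq> \<psi>' ` W'"
    using continuous_open_preimage[OF cont W(1) S(1)] S(2) W(4) by (auto simp: V_def)
  have VW: "\<exists>w\<in>W'. \<psi> u = \<psi>' w" if "u \<in> V" for u using V(3) that by auto
  have \<tau>1: "\<psi>' (\<tau> u) = \<psi> u" if "u \<in> V" for u using VW[OF that] \<rho>(2) by (auto simp: \<tau>_def)
  have \<tau>2: "\<tau> ` V \<subseteq> W'"
  proof
    fix y assume "y \<in> \<tau> ` V"
    then obtain u where "u \<in> V" "y = \<tau> u" by auto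
    with VW[of u] \<rho>(2) show "y \<in> W'" by (auto simp: \<tau>_def)
  qed
  have \<tau>c: "continuous_on V \<tau>"
    unfolding \<tau>_def by (rule continuous_on_compose2[OF \<rho>(1) continuous_on_subset[OF cont V(2)] V(3)])
  have trans: "(\<tau> has_derivative frechet_derivative \<tau> (at u)) (at u)"
      "\<bar>det (matrix (frechet_derivative \<tau> (at u)))\<bar> * volume_density \<psi>' (\<tau> u) = volume_density \<psi> u"
    if "u \<in> V" for u
    by (rule transition_density[OF lp lp' _ \<tau>2 V(2,1) \<tau>c that]; rule \<tau>1; assumption)+
  have AV: "A \<subseteq> V" using A S by (auto simp: V_def)
  have \<tau>im: "\<tau> ` B = W' \<inter> \<psi>' -` (\<psi> ` B)" if "B \<subseteq> A" for B
  proof (intro set_eqI iffI)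
    fix y assume "y \<in> \<tau> ` B"
    then obtain u where "u \<in> B" "y = \<tau> u" by auto
    then show "y \<in> W' \<inter> \<psi>' -` (\<psi> ` B)" using \<tau>1[of u] \<tau>2 that AV by auto
  next
    fix y assume y: "y \<in> W' \<inter> \<psi>' -` (\<psi> ` B)"
    then obtain u where "u \<in> B" "\<psi>' y = \<psi> u" by auto
    then have "\<tau> u = y" using \<rho>(2) y by (simp add: \<tau>_def flip: \<open>\<psi>' y = \<psi> u\<close>)
    then show "y \<in> \<tau> ` B" using \<open>u \<in> B\<close> by auto
  qed
  have inj: "inj_on \<tau> A"
  proof (rule inj_onI)
    fix x y assume xy: "x \<in> A" "y \<in> A" "\<tau> x = \<tau> y"
    then have "x \<in> V" "y \<in> V" using AV by auto
    then have "\<psi> x = \<psi> y" using \<tau>1[of x] \<tau>1[of y] xy(3) by simp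
    then show "x = y" using W(6) xy A(2) by (auto dest: inj_onD)
  qed
  define J where "J u = \<bar>det (matrix (frechet_derivative \<tau> (at u)))\<bar>" for u
  have J: "J u * volume_density \<psi>' (\<tau> u) = volume_density \<psi> u" if "u \<in> V" for u
    unfolding J_def using that by (rule trans(2))
  have Jm: "(\<lambda>u. indicator B u * J u) \<in> borel_measurable borel" if "B \<in> sets borel" "B \<subseteq> A" for B
  proof -
    have "J u = volume_density \<psi> u / volume_density \<psi>' (\<tau> u)" if "u \<in> V" for u
    proof -
      have "volume_density \<psi>' (\<tau> u) \<noteq> 0" using volume_density_pos[OF lp', of "\<tau> u"] \<tau>2 that by auto
      then show ?thesis using J[OF that] by (simp add: field_simps)
    qed
    moreover have "continuous_on V (\<lambda>u. volume_density \<psi> u / volume_density \<psi>' (\<tau> u))"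
    proof (intro continuous_on_divide)
      show "continuous_on V (volume_density \<psi>)"
        by (rule continuous_on_subset[OF ck_on_imp_continuous_on[OF volume_density_ck_on[OF lp, of 0]] V(2)])
      show "continuous_on V (\<lambda>u. volume_density \<psi>' (\<tau> u))"
        by (rule continuous_on_compose2[OF ck_on_imp_continuous_on[OF volume_density_ck_on[OF lp', of 0]] \<tau>c \<tau>2])
      show "\<forall>u\<in>V. volume_density \<psi>' (\<tau> u) \<noteq> 0"
        using volume_density_pos[OF lp'] \<tau>2 by (metis image_subset_iff less_irrefl)
    qed
    ultimately have "continuous_on V J" by (simp cong: continuous_on_cong)
    then have "continuous_on B J" using AV that by (meson continuous_on_subset order_trans)
    from borel_measurable_continuous_on_indicator[OF that(1) this] show ?thesis by simp
  qed
  have J0: "J u \<ge> 0" for u by (simp add: J_def)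
  let ?A' = "W' \<inter> \<psi>' -` (\<psi> ` A)"
  have A'b: "?A' \<in> sets borel" by (rule chart_preimage_borel[OF lp' chart_image_borel[OF lp A(1,2)]])
  have A'eq: "\<tau> ` A = ?A'" by (rule \<tau>im) simp
  \<comment> \<open>Extension by 0 makes the transition Borel on the whole space; the value chosen
    is irrelevant, as the density \<open>indicator A u * J u\<close> vanishes off
    \<open>A\<close>.\<close>
  define \<tau>0 where "\<tau>0 u = (if u \<in> A then \<tau> u else 0)" for u
  have \<tau>0m: "\<tau>0 \<in> borel_measurable borel"
    unfolding \<tau>0_def
    by (rule borel_measurable_continuous_on_if[OF A(1) continuous_on_subset[OF \<tau>c AV]]) simp
  have Jm': "(\<lambda>u. ennreal (indicator A u * J u)) \<in> borel_measurable lborel"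
    using Jm[OF A(1)] by simp
  have key: "distr (density lborel (\<lambda>u. ennreal (indicator A u * J u))) borel \<tau>0 = density lborel (indicator ?A')"
  proof (rule measure_eqI)
    fix B assume "B \<in> sets (distr (density lborel (\<lambda>u. ennreal (indicator A u * J u))) borel \<tau>0)"
    then have B: "B \<in> sets borel" by simp
    let ?B = "A \<inter> \<tau> -` B"
    have Bb: "?B \<in> sets borel" by (rule borel_Int_vimage[OF A(1) continuous_on_subset[OF \<tau>c AV] B])
    have \<tau>B: "\<tau> ` ?B = ?A' \<inter> B" unfolding A'eq[symmetric] by auto
    have vB: "\<tau>0 -` B \<in> sets borel" using measurable_sets_borel[OF \<tau>0m B] .
    have "emeasure (distr (density lborel (\<lambda>u. ennreal (indicator A u * J u))) borel \<tau>0) B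
        = (\<integral>\<^sup>+u. ennreal (indicator A u * J u) * indicator (\<tau>0 -` B) u \<partial>lborel)"
      using \<tau>0m B vB by (subst emeasure_distr) (auto simp: emeasure_density[OF Jm'])
    also have "\<dots> = (\<integral>\<^sup>+u\<in>?B. ennreal (J u) \<partial>lborel)"
      by (intro nn_integral_cong) (auto simp: indicator_def \<tau>0_def)
    also have "\<dots> = emeasure lborel (\<tau> ` ?B)"
      unfolding J_def
    proof (rule emeasure_differentiable_image[symmetric])
      show "\<tau> ` ?B \<in> sets borel" unfolding \<tau>B using A'b B by simp
      show "(\<lambda>x. indicator ?B x * \<bar>det (matrix (frechet_derivative \<tau> (at x)))\<bar>) \<in> borel_measurable borel"
        using Jm[OF Bb] by (simp add: J_def)
      show "inj_on \<tau> ?B" by (rule inj_on_subset[OF inj]) auto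
      show "(\<tau> has_derivative frechet_derivative \<tau> (at x)) (at x)" if "x \<in> ?B" for x
        using that AV by (intro trans(1)) auto
    qed (rule Bb)
    also have "\<dots> = emeasure (density lborel (indicator ?A')) B"
      unfolding \<tau>B using A'b B by (subst emeasure_density) (auto simp: indicator_inter_arith[symmetric])
    finally show "emeasure (distr (density lborel (\<lambda>u. ennreal (indicator A u * J u))) borel \<tau>0) B
        = emeasure (density lborel (indicator ?A')) B" .
  qed simp
  let ?g = "\<lambda>u. ennreal (indicator W' u * volume_density \<psi>' u)"
  have gm: "?g \<in> borel_measurable borel" using density_measurable[OF lp'] by simp
  have "(\<integral>\<^sup>+u\<in>?A'. ennreal (volume_density \<psi>' u) \<partial>lborel) = (\<integral>\<^sup>+u. ?g u \<partial>density lborel (indicator ?A'))"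
    using A'b gm by (subst nn_integral_density) (auto intro!: nn_integral_cong simp: indicator_def)
  also have "\<dots> = (\<integral>\<^sup>+u. ?g u \<partial>distr (density lborel (\<lambda>u. ennreal (indicator A u * J u))) borel \<tau>0)"
    by (simp only: key)
  also have "\<dots> = (\<integral>\<^sup>+u. ?g (\<tau>0 u) \<partial>density lborel (\<lambda>u. ennreal (indicator A u * J u)))"
    by (rule nn_integral_distr) (use \<tau>0m gm in auto)
  also have "\<dots> = (\<integral>\<^sup>+u. ennreal (indicator A u * J u) * ?g (\<tau>0 u) \<partial>lborel)"
    by (rule nn_integral_density[OF Jm']) (use measurable_compose[OF \<tau>0m gm] in simp)
  also have "\<dots> = (\<integral>\<^sup>+u\<in>A. ennreal (volume_density \<psi> u) \<partial>lborel)"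
  proof (intro nn_integral_cong)
    fix u :: "real^'n"
    show "ennreal (indicator A u * J u) * ?g (\<tau>0 u) = ennreal (volume_density \<psi> u) * indicator A u"
    proof (cases "u \<in> A")
      case True
      then have "u \<in> V" "\<tau> u \<in> W'" using AV \<tau>2 by auto
      then show ?thesis using True J0[of u] J[of u]
        by (simp add: \<tau>0_def flip: ennreal_mult')
    qed simp
  qed
  finally show ?thesis ..
qed

text \<open>The indicator belongs to the density because \<open>volume_density\<close> is controlled
  on \<open>W\<close> only.\<close>

definition chart_measure :: "(real^'n) set \<Rightarrow> (real^'n \<Rightarrow> 'a) \<Rightarrow> (real^'n) measure" where
  "chart_measure W \<psi> = density lborel (\<lambda>u. ennreal (indicator W u * volume_density \<psi> u))"

lemma sets_chart_measure [simp, measurable_cong]: "sets (chart_measure W \<psi>) = sets borel"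
  by (simp add: chart_measure_def)

lemma emeasure_chart_measure:
  assumes lp: "local_parametrization M W \<psi>" and A: "A \<in> sets borel" "A \<subseteq> W"
  shows "emeasure (chart_measure W \<psi>) A = (\<integral>\<^sup>+u\<in>A. ennreal (volume_density \<psi> u) \<partial>lborel)"
proof -
  have "(\<lambda>u. ennreal (indicator W u * volume_density \<psi> u)) \<in> borel_measurable lborel"
    using density_measurable[OF lp] by simp
  then have "emeasure (chart_measure W \<psi>) A
      = (\<integral>\<^sup>+u. ennreal (indicator W u * volume_density \<psi> u) * indicator A u \<partial>lborel)"
    unfolding chart_measure_def by (rule emeasure_density) (use A in simp)
  also have "\<dots> = (\<integral>\<^sup>+u\<in>A. ennreal (volume_density \<psi> u) \<partial>lborel)"
    using A(2) by (intro nn_integral_cong) (auto simp: indicator_def)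
  finally show ?thesis .
qed

lemma is_riemannian_volumeD:
  assumes "is_riemannian_volume TYPE('n) M \<mu>"
  shows "space \<mu> = M" "sets \<mu> = sets (restrict_space borel M)"
    and "\<And>W (\<psi> :: real^'n \<Rightarrow> 'a) A. local_parametrization M W \<psi> \<Longrightarrow> A \<in> sets borel \<Longrightarrow> A \<subseteq> W \<Longrightarrow>
      emeasure \<mu> (\<psi> ` A) = emeasure (chart_measure W \<psi>) A"
  using assms by (simp_all add: is_riemannian_volume_def emeasure_chart_measure volume_density_def)

text \<open>Every later passage from local to global on M is an instance: the disjoint pieces,
  finite volume, uniform bounds, the cover of the focal set, the partition of unity.\<close>

lemma finite_atlas:
  assumes "\<And>p. p \<in> M \<Longrightarrow> \<exists>S. open S \<and> p \<in> S \<and> P S"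
  obtains \<S> where "finite \<S>" "M \<subseteq> \<Union>\<S>" "\<And>S. S \<in> \<S> \<Longrightarrow> open S \<and> P S"
proof -
  let ?C = "{S. open S \<and> P S}"
  have "M \<subseteq> \<Union>?C" using assms by blast
  then obtain \<S> where "\<S> \<subseteq> ?C" "finite \<S>" "M \<subseteq> \<Union>\<S>"
    using compactE[OF compact, of ?C] by blast
  then show thesis by (intro that[of \<S>]) auto
qed

lemma chart_at:
  assumes "p \<in> M"
  obtains W and \<psi> :: "real^'n \<Rightarrow> 'a" and u where "local_parametrization M W \<psi>" "u \<in> W" "p = \<psi> u"
  using bspec[OF submanifold[unfolded embedded_submanifold_def] assms] by auto

text \<open>Disjointness of the pieces makes chart volumes add up; existence and uniqueness of the
  volume measure are both proved piece by piece.\<close>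

lemma chart_partition:
  obtains N :: nat and W :: "nat \<Rightarrow> (real^'n) set" and \<psi> :: "nat \<Rightarrow> real^'n \<Rightarrow> 'a" and D :: "nat \<Rightarrow> 'a set"
  where "\<And>k. k < N \<Longrightarrow> local_parametrization M (W k) (\<psi> k)" "\<And>k. k < N \<Longrightarrow> D k \<subseteq> \<psi> k ` W k"
    "\<And>k. D k \<in> sets borel" "disjoint_family D" "(\<Union>k<N. D k) = M"
proof -
  let ?Q = "\<lambda>S c. local_parametrization M (fst c) (snd c :: real^'n \<Rightarrow> 'a) \<and> M \<inter> S = snd c ` fst c"
  have "\<exists>S. open S \<and> p \<in> S \<and> (\<exists>c. ?Q S c)" if p: "p \<in> M" for p
  proof -
    obtain W and \<psi> :: "real^'n \<Rightarrow> 'a" and u where c: "local_parametrization M W \<psi>" "u \<in> W" "p = \<psi> u"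
      using chart_at[OF p] by metis
    obtain S where "open S" "\<psi> ` W = M \<inter> S"
      using local_parametrizationD(5)[OF c(1)] by (auto simp: openin_open)
    moreover have "p \<in> \<psi> ` W" using c by auto
    ultimately show ?thesis using c(1) by (intro exI[of _ S] conjI exI[of _ "(W, \<psi>)"]) auto
  qed
  from finite_atlas[of "\<lambda>S. \<exists>c. ?Q S c", OF this]
  obtain \<S> where S: "finite \<S>" "M \<subseteq> \<Union>\<S>" "\<And>S. S \<in> \<S> \<Longrightarrow> open S \<and> (\<exists>c. ?Q S c)" by metis
  obtain xs where xs: "set xs = \<S>" using finite_list[OF S(1)] by blast
  define N where "N = length xs"
  define c where "c k = (SOME c. ?Q (xs ! k) c)" for k
  have c: "?Q (xs ! k) (c k)" if "k < N" for k
    unfolding c_def using S(3)[of "xs ! k"] that xs by (intro someI_ex[of "?Q (xs ! k)"]) (auto simp: N_def)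
  have op: "open (xs ! k)" if "k < N" for k using S(3)[of "xs ! k"] that xs by (auto simp: N_def)
  \<comment> \<open>Each set loses what the earlier ones cover, so a point belongs to the piece of
    the least index whose set contains it.\<close>
  define D where "D k = (if k < N then (M \<inter> xs ! k) - (\<Union>j<k. xs ! j) else {})" for k
  show thesis
  proof (rule that[of N "\<lambda>k. fst (c k)" "\<lambda>k. snd (c k)" D])
    show "local_parametrization M (fst (c k)) (snd (c k))" if "k < N" for k using c[OF that] by simp
    show "D k \<subseteq> snd (c k) ` fst (c k)" if "k < N" for k using c[OF that] by (auto simp: D_def)
    show "D k \<in> sets borel" for k
      using M_borel op by (auto simp: D_def intro!: sets.Diff sets.Int sets.finite_UN borel_open)
    show "disjoint_family D"
      unfolding disjoint_family_on_def
    proof (intro ballI impI)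
      fix i j :: nat assume "i \<noteq> j"
      then consider "i < j" | "j < i" by linarith
      then show "D i \<inter> D j = {}" by cases (auto simp: D_def split: if_splits)
    qed
    show "(\<Union>k<N. D k) = M"
    proof
      show "M \<subseteq> (\<Union>k<N. D k)"
      proof
        fix p assume p: "p \<in> M"
        have ex: "\<exists>k. k < N \<and> p \<in> xs ! k" using S(2) p xs by (auto simp: N_def set_conv_nth)
        define k where "k = (LEAST k. k < N \<and> p \<in> xs ! k)"
        have k: "k < N \<and> p \<in> xs ! k" unfolding k_def using ex by (rule LeastI_ex)
        have "p \<notin> xs ! j" if "j < k" for j
          using not_less_Least[of j "\<lambda>k. k < N \<and> p \<in> xs ! k"] that k by (auto simp: k_def)
        then show "p \<in> (\<Union>k<N. D k)" using k p by (auto simp: D_def intro!: bexI[of _ k])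
      qed
    qed (auto simp: D_def)
  qed
qed

text \<open>\<open>riemannian_volume\<close> is a definite description, so nothing is known about it
  before existence and uniqueness. The measure is the sum of the chart volumes of the parts in the
  pieces \<open>D k\<close>; countable additivity is inherited from each chart.\<close>

lemma riemannian_volume_exists: "\<exists>\<mu>. is_riemannian_volume TYPE('n) M \<mu>"
proof -
  obtain N and W :: "nat \<Rightarrow> (real^'n) set" and \<psi> and D
    where lp: "\<And>k. k < N \<Longrightarrow> local_parametrization M (W k) (\<psi> k)"
      and D: "\<And>k. k < N \<Longrightarrow> D k \<subseteq> \<psi> k ` W k" "\<And>k. D k \<in> sets borel" "disjoint_family D" "(\<Union>k<N. D k) = M"
    using chart_partition by metis
  define \<nu> where "\<nu> k B = emeasure (chart_measure (W k) (\<psi> k)) (W k \<inter> \<psi> k -` (B \<inter> D k))" for k B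
  let ?\<Sigma> = "sets (restrict_space borel M)"
  define \<mu> where "\<mu> = measure_of M ?\<Sigma> (\<lambda>B. \<Sum>k<N. \<nu> k B)"
  have sa: "sigma_algebra M ?\<Sigma>"
    using sets.sigma_algebra_axioms[of "restrict_space borel M"] by (simp add: space_restrict_space)
  have ca: "countably_additive ?\<Sigma> (\<lambda>B. \<Sum>k<N. \<nu> k B)"
  proof (rule countably_additiveI)
    fix B :: "nat \<Rightarrow> 'a set"
    assume B: "range B \<subseteq> ?\<Sigma>" "disjoint_family B" "\<Union> (range B) \<in> ?\<Sigma>"
    have Bb: "B i \<in> sets borel" for i using B(1) sets_M_iff by auto
    have "(\<Sum>i. \<nu> k (B i)) = \<nu> k (\<Union> (range B))" if "k < N" for k
    proof -
      have "(\<Sum>i. \<nu> k (B i)) = emeasure (chart_measure (W k) (\<psi> k)) (\<Union>i. W k \<inter> \<psi> k -` (B i \<inter> D k))"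
        unfolding \<nu>_def
      proof (rule suminf_emeasure)
        show "range (\<lambda>i. W k \<inter> \<psi> k -` (B i \<inter> D k)) \<subseteq> sets (chart_measure (W k) (\<psi> k))"
          using chart_preimage_borel[OF lp[OF that] sets.Int[OF Bb D(2)]] by (simp add: image_subset_iff)
        show "disjoint_family (\<lambda>i. W k \<inter> \<psi> k -` (B i \<inter> D k))"
          using B(2) by (auto simp: disjoint_family_on_def)
      qed
      also have "(\<Union>i. W k \<inter> \<psi> k -` (B i \<inter> D k)) = W k \<inter> \<psi> k -` (\<Union> (range B) \<inter> D k)" by auto
      finally show ?thesis by (simp add: \<nu>_def)
    qed
    then show "(\<Sum>i. \<Sum>k<N. \<nu> k (B i)) = (\<Sum>k<N. \<nu> k (\<Union> (range B)))"
      by (subst suminf_sum) (auto intro: summableI)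
  qed
  have \<mu>: "emeasure \<mu> B = (\<Sum>k<N. \<nu> k B)" if "B \<in> ?\<Sigma>" for B
    unfolding \<mu>_def
    by (rule emeasure_measure_of_sigma[OF sa _ ca that]) (simp add: positive_def \<nu>_def)
  have sub: "?\<Sigma> \<subseteq> Pow M" using sets_M_iff by auto
  have "is_riemannian_volume TYPE('n) M \<mu>"
    unfolding is_riemannian_volume_def
  proof (intro conjI allI impI ballI)
    show "space \<mu> = M" by (simp add: \<mu>_def space_measure_of[OF sub])
    show "sets \<mu> = ?\<Sigma>" by (simp add: \<mu>_def sets_measure_of[OF sub] sigma_algebra.sigma_sets_eq[OF sa])
    fix V :: "(real^'n) set" and \<phi> :: "real^'n \<Rightarrow> 'a" and A
    assume lpV: "local_parametrization M V \<phi>" and A: "A \<in> sets borel" "A \<subseteq> V"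
    have im: "\<phi> ` A \<in> ?\<Sigma>"
      using chart_image_borel[OF lpV A] A(2) local_parametrizationD(4)[OF lpV] by (auto simp: sets_M_iff)
    \<comment> \<open>The domain of an arbitrary chart need not fit into one piece. Its part over
      \<open>D k\<close> is mapped into the image of the k-th chart, where
      \<open>chart_volume_eq\<close> compares the two.\<close>
    define A' where "A' k = V \<inter> \<phi> -` (D k) \<inter> A" for k
    have A'b: "A' k \<in> sets borel" for k
      unfolding A'_def using chart_preimage_borel[OF lpV D(2)] A(1) by simp
    have "\<nu> k (\<phi> ` A) = emeasure (chart_measure V \<phi>) (A' k)" if k: "k < N" for k
    proof -
      have eq: "\<phi> ` A' k = \<phi> ` A \<inter> D k" using A(2) by (auto simp: A'_def)
      have sub: "\<phi> ` A' k \<subseteq> \<psi> k ` W k" unfolding eq using D(1)[OF k] by blast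
      have "emeasure (chart_measure V \<phi>) (A' k) = (\<integral>\<^sup>+u\<in>A' k. ennreal (volume_density \<phi> u) \<partial>lborel)"
        by (rule emeasure_chart_measure[OF lpV A'b]) (auto simp: A'_def)
      also have "\<dots> = (\<integral>\<^sup>+u\<in>W k \<inter> \<psi> k -` (\<phi> ` A' k). ennreal (volume_density (\<psi> k) u) \<partial>lborel)"
        by (rule chart_volume_eq[OF lpV lp[OF k] A'b _ sub]) (auto simp: A'_def)
      also have "\<dots> = \<nu> k (\<phi> ` A)"
        unfolding \<nu>_def eq
        by (rule emeasure_chart_measure[OF lp[OF k], symmetric])
          (rule chart_preimage_borel[OF lp[OF k] sets.Int[OF chart_image_borel[OF lpV A] D(2)]], blast)
      finally show ?thesis ..
    qed
    then have "emeasure \<mu> (\<phi> ` A) = (\<Sum>k<N. emeasure (chart_measure V \<phi>) (A' k))"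
      by (simp add: \<mu>[OF im])
    also have "\<dots> = emeasure (chart_measure V \<phi>) (\<Union>k<N. A' k)"
      by (rule sum_emeasure) (use A'b D(3) in \<open>auto simp: disjoint_family_on_def A'_def\<close>)
    also have "(\<Union>k<N. A' k) = A"
    proof
      show "A \<subseteq> (\<Union>k<N. A' k)"
      proof
        fix u assume "u \<in> A"
        then have "\<phi> u \<in> M" using A(2) local_parametrizationD(4)[OF lpV] by auto
        then obtain k where "k < N" "\<phi> u \<in> D k" using D(4) by blast
        then show "u \<in> (\<Union>k<N. A' k)" using \<open>u \<in> A\<close> A(2) by (auto simp: A'_def)
      qed
    qed (auto simp: A'_def)
    finally show "emeasure \<mu> (\<phi> ` A) = (\<integral>\<^sup>+u\<in>A. ennreal (sqrt (det (gram_matrix \<phi> u))) \<partial>lborel)"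
      by (simp add: emeasure_chart_measure[OF lpV A] volume_density_def)
  qed
  then show ?thesis by blast
qed

text \<open>A Borel set is a finite disjoint union of parts lying in single charts, and there the
  defining equation fixes the measure.\<close>

lemma riemannian_volume_unique:
  assumes "is_riemannian_volume TYPE('n) M \<mu>" "is_riemannian_volume TYPE('n) M \<mu>'"
  shows "\<mu> = \<mu>'"
proof (rule measure_eqI)
  note \<mu> = is_riemannian_volumeD[OF assms(1)] and \<mu>' = is_riemannian_volumeD[OF assms(2)]
  show "sets \<mu> = sets \<mu>'" by (simp add: \<mu>(2) \<mu>'(2))
  fix B assume "B \<in> sets \<mu>"
  then have B: "B \<in> sets borel" "B \<subseteq> M" by (auto simp: \<mu>(2) sets_M_iff)
  obtain N and W :: "nat \<Rightarrow> (real^'n) set" and \<psi> and D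
    where lp: "\<And>k. k < N \<Longrightarrow> local_parametrization M (W k) (\<psi> k)"
      and D: "\<And>k. k < N \<Longrightarrow> D k \<subseteq> \<psi> k ` W k" "\<And>k. D k \<in> sets borel" "disjoint_family D" "(\<Union>k<N. D k) = M"
    using chart_partition by metis
  have Beq: "(\<Union>k<N. B \<inter> D k) = B" using D(4) B(2) by auto
  have piece: "emeasure \<mu> (B \<inter> D k) = emeasure \<mu>' (B \<inter> D k)" if k: "k < N" for k
  proof -
    let ?A = "W k \<inter> \<psi> k -` (B \<inter> D k)"
    have A: "?A \<in> sets borel" "?A \<subseteq> W k"
      by (rule chart_preimage_borel[OF lp[OF k] sets.Int[OF B(1) D(2)]]) auto
    have "\<psi> k ` ?A = B \<inter> D k" using D(1)[OF k] by auto
    then show ?thesis using \<mu>(3)[OF lp[OF k] A] \<mu>'(3)[OF lp[OF k] A] by simp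
  qed
  have BD: "B \<inter> D k \<in> sets (restrict_space borel M)" for k using B D(2) by (auto simp: sets_M_iff)
  have dis: "disjoint_family_on (\<lambda>k. B \<inter> D k) {..<N}" using D(3) by (auto simp: disjoint_family_on_def)
  have "emeasure \<mu> B = (\<Sum>k<N. emeasure \<mu> (B \<inter> D k))"
    using sum_emeasure[OF _ dis, of \<mu>] BD unfolding Beq by (simp add: \<mu>(2) image_subset_iff)
  moreover have "emeasure \<mu>' B = (\<Sum>k<N. emeasure \<mu>' (B \<inter> D k))"
    using sum_emeasure[OF _ dis, of \<mu>'] BD unfolding Beq by (simp add: \<mu>'(2) image_subset_iff)
  ultimately show "emeasure \<mu> B = emeasure \<mu>' B" using piece by simp
qed

lemma riemannian_volume: "is_riemannian_volume TYPE('n) M vol"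
  unfolding vol riemannian_volume_def
  by (rule theI') (use riemannian_volume_exists riemannian_volume_unique in blast)

lemmas vol_simps = is_riemannian_volumeD[OF riemannian_volume]

section \<open>Finiteness of the volume and integration in charts\<close>

lemma local_parametrization_subset:
  assumes lp: "local_parametrization M W (\<psi> :: real^'n \<Rightarrow> 'a)" and V: "open V" "V \<subseteq> W"
  shows "local_parametrization M V \<psi>"
proof -
  obtain \<rho> where h: "homeomorphism W (\<psi> ` W) \<psi> \<rho>" using lp by (auto simp: local_parametrization_def)
  have "openin (top_of_set W) V" using V by (simp add: open_subset)
  from homeomorphism_imp_open_map[OF h this]
  have "openin (top_of_set M) (\<psi> ` V)" using local_parametrizationD(5)[OF lp] openin_trans by blast
  moreover have "homeomorphism V (\<psi> ` V) \<psi> \<rho>" using homeomorphism_of_subsets[OF h V(2)] V(2) by auto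
  moreover have "smooth_on_open V \<psi>"
    using ck_on_subset[OF local_parametrizationD(2)[OF lp] V(2)] V(1) by (simp add: smooth_on_open_def)
  ultimately show ?thesis using lp V(2) by (auto simp: local_parametrization_def)
qed

text \<open>The compact set \<open>C\<close> keeps continuous functions of the chart coordinates
  bounded near \<open>p\<close>.\<close>

lemma compact_chart_at:
  assumes "p \<in> M"
  obtains W C S and \<psi> :: "real^'n \<Rightarrow> 'a"
  where "local_parametrization M W \<psi>" "compact C" "C \<subseteq> W" "open S" "p \<in> S" "M \<inter> S \<subseteq> \<psi> ` C"
proof -
  obtain W and \<psi> :: "real^'n \<Rightarrow> 'a" and u where c: "local_parametrization M W \<psi>" "u \<in> W" "p = \<psi> u"
    using chart_at[OF assms] by metis
  obtain r where r: "r > 0" "cball u r \<subseteq> W"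
    using local_parametrizationD(1)[OF c(1)] c(2) by (meson open_contains_cball)
  have "local_parametrization M (ball u r) \<psi>"
    by (rule local_parametrization_subset[OF c(1)]) (use r in auto)
  then obtain S where S: "open S" "\<psi> ` ball u r = M \<inter> S"
    using local_parametrizationD(5) by (metis openin_open)
  have "p \<in> \<psi> ` ball u r" using c(3) r(1) by auto
  then have "p \<in> S" using S(2) by blast
  moreover have "M \<inter> S \<subseteq> \<psi> ` cball u r" unfolding S(2)[symmetric] by (intro image_mono) auto
  ultimately show thesis by (rule that[OF c(1) compact_cball r(2) S(1)])
qed

text \<open>Finiteness makes constants, and hence bounded measurable functions, integrable over
  M.\<close>

lemma finite_measure_vol: "finite_measure vol"
proof (rule finite_measureI)
  have "\<exists>S. open S \<and> p \<in> S \<and> emeasure vol (M \<inter> S) < \<infinity>" if p: "p \<in> M" for p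
  proof -
    obtain W C S and \<psi> :: "real^'n \<Rightarrow> 'a"
      where c: "local_parametrization M W \<psi>" "compact C" "C \<subseteq> W" "open S" "p \<in> S" "M \<inter> S \<subseteq> \<psi> ` C"
      using compact_chart_at[OF p] by metis
    have Cb: "C \<in> sets borel" using c(2) by (simp add: compact_imp_closed borel_closed)
    have "continuous_on C (volume_density \<psi>)"
      using continuous_on_subset[OF ck_on_imp_continuous_on[OF volume_density_ck_on[OF c(1), of 0]] c(3)] .
    then have "bounded (volume_density \<psi> ` C)" using c(2) compact_continuous_image compact_imp_bounded by blast
    then obtain K where K: "\<And>u. u \<in> C \<Longrightarrow> \<bar>volume_density \<psi> u\<bar> \<le> K" by (auto simp: bounded_iff)
    have "emeasure vol (M \<inter> S) \<le> emeasure vol (\<psi> ` C)"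
      by (rule emeasure_mono[OF c(6)])
        (use chart_image_borel[OF c(1) Cb c(3)] c(3) local_parametrizationD(4)[OF c(1)]
          in \<open>auto simp: vol_simps(2) sets_M_iff\<close>)
    also have "\<dots> = (\<integral>\<^sup>+u\<in>C. ennreal (volume_density \<psi> u) \<partial>lborel)"
      by (simp add: vol_simps(3)[OF c(1) Cb c(3)] emeasure_chart_measure[OF c(1) Cb c(3)])
    also have "\<dots> \<le> (\<integral>\<^sup>+u\<in>C. ennreal K \<partial>lborel)"
    proof (rule nn_integral_mono)
      fix u
      show "ennreal (volume_density \<psi> u) * indicator C u \<le> ennreal K * indicator C u"
        using K[of u] by (auto simp: indicator_def intro!: ennreal_leI)
    qed
    also have "\<dots> = ennreal K * emeasure lborel C" using Cb by (simp add: nn_integral_cmult_indicator)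
    also have "\<dots> < \<infinity>"
      using emeasure_compact_finite[OF c(2)] by (simp add: ennreal_mult_less_top)
    finally show ?thesis using c(4,5) by blast
  qed
  from finite_atlas[of "\<lambda>S. emeasure vol (M \<inter> S) < \<infinity>", OF this]
  obtain \<S> where S: "finite \<S>" "M \<subseteq> \<Union>\<S>" "\<And>S. S \<in> \<S> \<Longrightarrow> open S \<and> emeasure vol (M \<inter> S) < \<infinity>" by metis
  have "(\<Union>S\<in>\<S>. M \<inter> S) = M" using S(2) by auto
  then have "emeasure vol M \<le> (\<Sum>S\<in>\<S>. emeasure vol (M \<inter> S))"
    using emeasure_subadditive_finite[OF S(1), of "\<lambda>S. M \<inter> S" vol] S(3) M_borel
    by (auto simp: vol_simps(2) sets_M_iff image_subset_iff)
  also have "\<dots> < \<infinity>" using S(1,3) by (simp add: less_top)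
  finally show "emeasure vol (space vol) \<noteq> \<infinity>" by (simp add: vol_simps(1))
qed

lemma measurable_vol_if_charts:
  fixes f :: "'a \<Rightarrow> real"
  assumes "\<And>W (\<psi> :: real^'n \<Rightarrow> 'a). local_parametrization M W \<psi> \<Longrightarrow> continuous_on W (\<lambda>u. f (\<psi> u))"
  shows "continuous_on M f" "f \<in> borel_measurable vol"
proof -
  show "continuous_on M f"
    unfolding continuous_on_eq_continuous_within
  proof
    fix p assume p: "p \<in> M"
    obtain W and \<psi> :: "real^'n \<Rightarrow> 'a" and u where c: "local_parametrization M W \<psi>" "u \<in> W" "p = \<psi> u"
      using chart_at[OF p] by metis
    obtain \<rho> where h: "homeomorphism W (\<psi> ` W) \<psi> \<rho>" using c(1) by (auto simp: local_parametrization_def)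
    have "continuous_on (\<psi> ` W) (\<lambda>x. f (\<psi> (\<rho> x)))"
      by (rule continuous_on_compose2[OF assms[OF c(1)]]) (use h in \<open>auto simp: homeomorphism_def\<close>)
    then have "continuous_on (\<psi> ` W) f"
      by (rule continuous_on_eq) (use h in \<open>auto simp: homeomorphism_def\<close>)
    moreover have pW: "p \<in> \<psi> ` W" using c by auto
    ultimately have "continuous (at p within \<psi> ` W) f"
      unfolding continuous_on_eq_continuous_within by (rule bspec)
    moreover obtain S where S: "open S" "\<psi> ` W = M \<inter> S"
      using local_parametrizationD(5)[OF c(1)] by (auto simp: openin_open)
    moreover have "at p within M \<inter> S = at p within M"
      by (rule at_within_nhd[of p S]) (use S pW in auto)
    ultimately show "continuous (at p within M) f" by simp
  qed
  then have "f \<in> borel_measurable (restrict_space borel M)" by (rule borel_measurable_continuous_on_restrict)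
  then show "f \<in> borel_measurable vol"
    by (simp cong: measurable_cong_sets add: vol_simps(2))
qed

text \<open>Pushing \<open>chart_measure\<close> forward gives the volume restricted to the chart
  image, so the defining equation for sets carries over to Bochner integrals of signed
  functions.\<close>

lemma integral_chart:
  fixes f :: "'a \<Rightarrow> real"
  assumes lp: "local_parametrization M W (\<psi> :: real^'n \<Rightarrow> 'a)"
    and f: "f \<in> borel_measurable vol" and supp: "\<And>x. x \<in> M \<Longrightarrow> x \<notin> \<psi> ` W \<Longrightarrow> f x = 0"
  shows "(\<integral>x. f x \<partial>vol) = (\<integral>u. indicator W u * volume_density \<psi> u * f (\<psi> u) \<partial>lborel)"
proof (cases "W = {}")
  case True
  then have "(\<integral>x. f x \<partial>vol) = (\<integral>x. 0 \<partial>vol)"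
    using supp by (intro Bochner_Integration.integral_cong) (auto simp: vol_simps(1))
  then show ?thesis using True by simp
next
  case False
  then obtain u0 where u0: "u0 \<in> W" by blast
  note W = local_parametrizationD[OF lp]
  \<comment> \<open>Off \<open>W\<close> the chart is replaced by one of its values, so that all
    values lie in M, as measurability into \<open>vol\<close> requires. The case of empty
    \<open>W\<close> was separated because it offers no such value.\<close>
  define \<psi>0 where "\<psi>0 u = (if u \<in> W then \<psi> u else \<psi> u0)" for u
  have "\<psi>0 \<in> borel_measurable borel"
    unfolding \<psi>0_def
    by (rule borel_measurable_continuous_on_if)
      (use W(1) ck_on_imp_continuous_on[OF W(2)[of 0]] in auto)
  moreover have "\<psi>0 u \<in> M" for u using W(4) u0 by (auto simp: \<psi>0_def)
  ultimately have \<psi>0: "\<psi>0 \<in> borel \<rightarrow>\<^sub>M vol"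
    by (subst measurable_cong_sets[OF refl vol_simps(2)]) (auto intro!: measurable_restrict_space2)
  have Wb: "W \<in> sets borel" using W(1) by simp
  have WM: "\<psi> ` W \<in> sets vol"
    using chart_image_borel[OF lp Wb] W(4) by (simp add: vol_simps(2) sets_M_iff)
  have dm: "(\<lambda>u. indicator W u * volume_density \<psi> u) \<in> borel_measurable lborel"
    using density_measurable[OF lp] by simp
  have key: "distr (chart_measure W \<psi>) vol \<psi>0 = density vol (\<lambda>x. ennreal (indicator (\<psi> ` W) x))"
  proof (rule measure_eqI)
    fix B assume "B \<in> sets (distr (chart_measure W \<psi>) vol \<psi>0)"
    then have B: "B \<in> sets vol" by simp
    have Bb: "B \<in> sets borel" "B \<subseteq> M" using B by (auto simp: vol_simps(2) sets_M_iff)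
    let ?A = "W \<inter> \<psi> -` B"
    have A: "?A \<in> sets borel" by (rule chart_preimage_borel[OF lp Bb(1)])
    have vB: "\<psi>0 -` B \<in> sets borel" using measurable_sets[OF \<psi>0 B] by simp
    have "emeasure (distr (chart_measure W \<psi>) vol \<psi>0) B = emeasure (chart_measure W \<psi>) (\<psi>0 -` B)"
      using \<psi>0 B by (subst emeasure_distr) (auto simp: chart_measure_def)
    also have "\<dots> = (\<integral>\<^sup>+u. ennreal (indicator W u * volume_density \<psi> u) * indicator (\<psi>0 -` B) u \<partial>lborel)"
      unfolding chart_measure_def by (rule emeasure_density) (use dm vB in auto)
    also have "\<dots> = (\<integral>\<^sup>+u\<in>?A. ennreal (volume_density \<psi> u) \<partial>lborel)"
      by (intro nn_integral_cong) (auto simp: indicator_def \<psi>0_def)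
    also have "\<dots> = emeasure vol (\<psi> ` ?A)"
      by (subst vol_simps(3)[OF lp A]) (auto simp: emeasure_chart_measure[OF lp A])
    also have "\<psi> ` ?A = \<psi> ` W \<inter> B" by auto
    also have "emeasure vol (\<psi> ` W \<inter> B) = emeasure (density vol (\<lambda>x. ennreal (indicator (\<psi> ` W) x))) B"
      using WM B by (subst emeasure_density) (auto simp: ennreal_indicator indicator_inter_arith[symmetric])
    finally show "emeasure (distr (chart_measure W \<psi>) vol \<psi>0) B
        = emeasure (density vol (\<lambda>x. ennreal (indicator (\<psi> ` W) x))) B" .
  qed simp
  have nn: "AE u in lborel. 0 \<le> indicator W u * volume_density \<psi> u"
    using volume_density_pos[OF lp] by (auto simp: indicator_def less_imp_le)
  have "(\<integral>x. f x \<partial>vol) = (\<integral>x. indicator (\<psi> ` W) x *\<^sub>R f x \<partial>vol)"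
    using supp by (intro Bochner_Integration.integral_cong) (auto simp: vol_simps(1) indicator_def)
  also have "\<dots> = (\<integral>x. f x \<partial>density vol (\<lambda>x. ennreal (indicator (\<psi> ` W) x)))"
    by (rule integral_density[symmetric, OF f]) (use WM in auto)
  also have "\<dots> = (\<integral>u. f (\<psi>0 u) \<partial>chart_measure W \<psi>)"
    unfolding key[symmetric] by (rule integral_distr[OF _ f]) (use \<psi>0 in \<open>simp add: chart_measure_def\<close>)
  also have "\<dots> = (\<integral>u. (indicator W u * volume_density \<psi> u) *\<^sub>R f (\<psi>0 u) \<partial>lborel)"
    unfolding chart_measure_def
    by (rule integral_density[OF _ dm nn]) (use measurable_compose[OF \<psi>0 f] in simp)
  also have "\<dots> = (\<integral>u. indicator W u * volume_density \<psi> u * f (\<psi> u) \<partial>lborel)"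
    by (intro Bochner_Integration.integral_cong) (auto simp: \<psi>0_def indicator_def)
  finally show ?thesis .
qed

end

section \<open>Differentiation under the integral, constant rank\<close>

text \<open>Dominated convergence for difference quotients, which the mean value theorem bounds by
  \<open>w\<close>. Measurability of \<open>f' 0\<close> comes out as well, since it is a limit of
  measurable quotients.\<close>

lemma has_real_derivative_integral:
  fixes f :: "real \<Rightarrow> 'x \<Rightarrow> real"
  assumes "\<delta> > 0"
    and int: "\<And>t. \<bar>t\<bar> < \<delta> \<Longrightarrow> integrable M (f t)"
    and der: "\<And>t x. \<bar>t\<bar> < \<delta> \<Longrightarrow> x \<in> space M \<Longrightarrow> ((\<lambda>t. f t x) has_real_derivative f' t x) (at t)"
    and bound: "\<And>t x. \<bar>t\<bar> < \<delta> \<Longrightarrow> x \<in> space M \<Longrightarrow> \<bar>f' t x\<bar> \<le> w x"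
    and w: "integrable M w"
  shows "((\<lambda>t. \<integral>x. f t x \<partial>M) has_real_derivative (\<integral>x. f' 0 x \<partial>M)) (at 0)"
    and "f' 0 \<in> borel_measurable M"
proof -
  have quot: "\<bar>(f h x - f 0 x) / h\<bar> \<le> w x" if h: "\<bar>h\<bar> < \<delta>" "h \<noteq> 0" and x: "x \<in> space M" for h x
  proof -
    have "\<exists>z. \<bar>z\<bar> < \<delta> \<and> f h x - f 0 x = h * f' z x"
    proof (cases "0 < h")
      case True
      have "\<exists>z>0. z < h \<and> f h x - f 0 x = (h - 0) * f' z x"
        by (rule MVT2[OF True]) (use h x in \<open>auto intro!: der\<close>)
      then obtain z where "0 < z" "z < h" "f h x - f 0 x = h * f' z x" by auto
      then show ?thesis using h by (intro exI[of _ z]) auto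
    next
      case False
      then have h0: "h < 0" using h by simp
      have "\<exists>z>h. z < 0 \<and> f 0 x - f h x = (0 - h) * f' z x"
        by (rule MVT2[OF h0]) (use h x in \<open>auto intro!: der\<close>)
      then obtain z where "h < z" "z < 0" "f 0 x - f h x = - h * f' z x" by auto
      then show ?thesis using h by (intro exI[of _ z]) auto
    qed
    then obtain z where "\<bar>z\<bar> < \<delta>" "f h x - f 0 x = h * f' z x" by blast
    then show ?thesis using bound[of z x] x h by simp
  qed
  have seq: "(\<lambda>n. ((\<integral>x. f (X n) x \<partial>M) - (\<integral>x. f 0 x \<partial>M)) / X n) \<longlonglongrightarrow> (\<integral>x. f' 0 x \<partial>M)
      \<and> f' 0 \<in> borel_measurable M"
    if X: "\<And>n. X n \<noteq> 0" "X \<longlonglongrightarrow> 0" for X :: "nat \<Rightarrow> real"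
  proof -
    \<comment> \<open>Quotients at parameters outside the interval are set to 0: integrability and
      the bound are available only inside, and the tail of \<open>X\<close> lies inside.\<close>
    define s where "s n x = (if \<bar>X n\<bar> < \<delta> then (f (X n) x - f 0 x) / X n else 0)" for n x
    have ev: "eventually (\<lambda>n. \<bar>X n\<bar> < \<delta>) sequentially"
      using order_tendstoD(2)[OF tendsto_rabs_zero[OF X(2)] assms(1)] .
    have i0: "integrable M (f 0)" by (rule int) (use assms(1) in simp)
    have sm: "s n \<in> borel_measurable M" for n
      using int[of "X n"] i0 by (cases "\<bar>X n\<bar> < \<delta>") (auto simp: s_def[abs_def])
    have lim: "(\<lambda>n. s n x) \<longlonglongrightarrow> f' 0 x" if x: "x \<in> space M" for x
    proof -
      have "((\<lambda>h. (f (0 + h) x - f 0 x) / h) \<longlongrightarrow> f' 0 x) (at 0)"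
        using der[of 0 x] x assms(1) by (simp add: DERIV_def)
      moreover have "filterlim X (at 0) sequentially"
        using X by (simp add: filterlim_at)
      ultimately have "(\<lambda>n. (f (0 + X n) x - f 0 x) / X n) \<longlonglongrightarrow> f' 0 x"
        by (rule filterlim_compose)
      then show ?thesis
        by (rule Lim_transform_eventually) (use ev in \<open>auto simp: s_def elim: eventually_mono\<close>)
    qed
    have m0: "f' 0 \<in> borel_measurable M" by (rule borel_measurable_LIMSEQ_real[OF lim sm])
    have "(\<lambda>n. \<integral>x. s n x \<partial>M) \<longlonglongrightarrow> (\<integral>x. f' 0 x \<partial>M)"
    proof (rule integral_dominated_convergence[OF m0 sm w])
      show "AE x in M. (\<lambda>n. s n x) \<longlonglongrightarrow> f' 0 x" using lim by (intro AE_I2) auto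
      show "AE x in M. norm (s n x) \<le> w x" for n
      proof (intro AE_I2)
        fix x assume x: "x \<in> space M"
        have "0 \<le> w x" using bound[of 0 x] x assms(1) by (simp add: order_trans[OF abs_ge_zero])
        then show "norm (s n x) \<le> w x" using quot[of "X n" x] X(1) x by (simp add: s_def)
      qed
    qed
    then have "(\<lambda>n. ((\<integral>x. f (X n) x \<partial>M) - (\<integral>x. f 0 x \<partial>M)) / X n) \<longlonglongrightarrow> (\<integral>x. f' 0 x \<partial>M)"
    proof (rule Lim_transform_eventually)
      show "eventually (\<lambda>n. (\<integral>x. s n x \<partial>M) = ((\<integral>x. f (X n) x \<partial>M) - (\<integral>x. f 0 x \<partial>M)) / X n) sequentially"
        using ev by eventually_elim (simp add: s_def[abs_def] int i0)
    qed
    with m0 show ?thesis by blast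
  qed
  show "((\<lambda>t. \<integral>x. f t x \<partial>M) has_real_derivative (\<integral>x. f' 0 x \<partial>M)) (at 0)"
    unfolding DERIV_def tendsto_at_iff_sequentially
    using seq by (auto simp: o_def)
  show "f' 0 \<in> borel_measurable M"
    using seq[of "\<lambda>n. inverse (real (Suc n))", OF _ LIMSEQ_inverse_real_of_nat] by simp
qed

text \<open>By translation invariance the integral of g(u + t v) does not depend on t; its
  derivative at t = 0, taken under the integral, is the integral in question.\<close>

lemma integral_ddiff_compact_support:
  fixes g :: "real^'n \<Rightarrow> real"
  assumes g: "ck_on (Suc 0) UNIV g" and C: "compact C" and supp: "\<And>u. u \<notin> C \<Longrightarrow> g u = 0"
  shows "(\<integral>u. ddiff g v u \<partial>lborel) = 0"
proof -
  \<comment> \<open>All points from which some shift by t v with |t| at most 1 reaches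
    \<open>C\<close>. This compact set supports the dominating function for all these t at
    once.\<close>
  let ?C = "(\<lambda>(c, t). c - t *\<^sub>R v) ` (C \<times> {-1..1})"
  have C': "compact ?C"
    by (intro compact_continuous_image compact_Times C)
      (auto simp: case_prod_unfold intro!: continuous_intros)
  have contg: "continuous_on UNIV g" and contd: "continuous_on UNIV (ddiff g v)"
    using ck_on_imp_continuous_on[OF g] g by auto
  have supp': "ddiff g v u = 0" if "u \<notin> C" for u
  proof -
    have "open (- C)" using C by (simp add: compact_imp_closed open_Compl)
    then have "frechet_derivative g (at u) = frechet_derivative (\<lambda>u. 0) (at u)"
      by (rule frechet_derivative_cong_open(1)) (use that supp in auto)
    then show ?thesis by simp
  qed
  have "bounded (ddiff g v ` C)"
    using compact_continuous_image[OF continuous_on_subset[OF contd subset_UNIV] C] compact_imp_bounded by blast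
  then obtain K where K: "\<And>u. u \<in> C \<Longrightarrow> \<bar>ddiff g v u\<bar> \<le> K" by (auto simp: bounded_iff)
  have gi: "integrable lborel g"
  proof -
    have "integrable lborel (\<lambda>u. indicator C u *\<^sub>R g u)"
      by (rule borel_integrable_compact[OF C continuous_on_subset[OF contg subset_UNIV]])
    then show ?thesis
      by (rule Bochner_Integration.integrable_cong[THEN iffD1, rotated -1]) (auto simp: indicator_def supp)
  qed
  have dist: "distr lborel borel ((+) c) = lborel" for c :: "real^'n" by (rule lborel_distr_plus)
  have gshift: "integrable lborel (\<lambda>u. g (u + c)) \<and> (\<integral>u. g (u + c) \<partial>lborel) = (\<integral>u. g u \<partial>lborel)" for c
  proof -
    have gm: "g \<in> borel_measurable borel" using contg by (rule borel_measurable_continuous_onI)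
    have "integrable (distr lborel borel ((+) c)) g \<longleftrightarrow> integrable lborel (\<lambda>u. g (c + u))"
      by (rule integrable_distr_eq) (use gm in auto)
    moreover have "(\<integral>u. g u \<partial>distr lborel borel ((+) c)) = (\<integral>u. g (c + u) \<partial>lborel)"
      by (rule integral_distr) (use gm in auto)
    ultimately show ?thesis using gi by (simp add: dist add.commute)
  qed
  have "((\<lambda>t. \<integral>u. g (u + t *\<^sub>R v) \<partial>lborel) has_real_derivative (\<integral>u. ddiff g v (u + 0 *\<^sub>R v) \<partial>lborel)) (at 0)"
  proof (rule has_real_derivative_integral(1)[where \<delta> = 1 and w = "\<lambda>u. indicator ?C u *\<^sub>R \<bar>K\<bar>"])
    show "integrable lborel (\<lambda>u. g (u + t *\<^sub>R v))" for t using gshift by blast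
    show "((\<lambda>t. g (u + t *\<^sub>R v)) has_real_derivative ddiff g v (u + t *\<^sub>R v)) (at t)" for t u
      by (rule has_real_derivative_line[OF ck_on_has_derivative[OF g]]) simp
    show "\<bar>ddiff g v (u + t *\<^sub>R v)\<bar> \<le> indicator ?C u *\<^sub>R \<bar>K\<bar>" if "\<bar>t\<bar> < 1" for t u
    proof (cases "u + t *\<^sub>R v \<in> C")
      case True
      then have "u \<in> ?C" using that by (intro image_eqI[of _ _ "(u + t *\<^sub>R v, t)"]) auto
      then show ?thesis using K[OF True] by simp
    next
      case False
      then show ?thesis by (simp add: supp' indicator_def)
    qed
    show "integrable lborel (\<lambda>u. indicator ?C u *\<^sub>R \<bar>K\<bar>)"
      by (rule borel_integrable_compact[OF C']) simp
  qed simp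
  moreover have "((\<lambda>t. \<integral>u. g (u + t *\<^sub>R v) \<partial>lborel) has_real_derivative 0) (at 0)"
    using gshift by simp
  ultimately show ?thesis by (metis (no_types, lifting) DERIV_unique add.right_neutral scale_zero_left Bochner_Integration.integral_cong)
qed

text \<open>On the orthogonal complement of its kernel \<open>L\<close> is injective and has the
  same image as on the whole space; \<open>P\<close> is a left inverse of that restriction, with
  values in the complement.\<close>

lemma generalized_inverse:
  fixes L :: "'a::euclidean_space \<Rightarrow> 'b::euclidean_space"
  assumes L: "linear L"
  obtains P where "linear P" "\<And>y. P (L (P y)) = P y" "\<And>x. L (P (L x)) = L x"
proof -
  let ?K = "{x. L x = 0}"
  have K: "subspace ?K" 
    by (auto simp: subspace_def linear_0[OF L] linear_add[OF L] linear_scale[OF L])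
  let ?S = "{x. \<forall>z\<in>?K. x \<bullet> z = 0}"
  have S: "subspace ?S" by (auto simp: subspace_def inner_add_left)
  have dec: "\<exists>s\<in>?S. L x = L s" for x
  proof -
    obtain y z where yz: "y \<in> span ?K" "\<And>w. w \<in> span ?K \<Longrightarrow> orthogonal z w" "x = y + z"
      using orthogonal_subspace_decomp_exists[of ?K x] by blast
    have "span ?K = ?K" using K by (rule span_eq_iff[THEN iffD2])
    note yz = yz[unfolded this]
    have "L x = L z" "z \<in> ?S" using yz by (auto simp: linear_add[OF L] orthogonal_def)
    then show ?thesis by blast
  qed
  have inj: "inj_on L ?S"
  proof (rule inj_onI)
    fix x y assume xy: "x \<in> ?S" "y \<in> ?S" "L x = L y"
    then have "x - y \<in> ?S" "x - y \<in> ?K" using subspace_diff[OF S] by (auto simp: linear_diff[OF L])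
    then have "(x - y) \<bullet> (x - y) = 0" by blast
    then show "x = y" by simp
  qed
  obtain P where P: "P ` UNIV \<subseteq> ?S" "linear P" "\<forall>v\<in>?S. P (L v) = v"
    using linear_exists_left_inverse_on[OF L S inj] by blast
  show thesis
  proof (rule that[OF P(2)])
    show "P (L (P y)) = P y" for y using P by blast
    show "L (P (L x)) = L x" for x using dec[of x] P(3) by auto
  qed
qed

text \<open>Every vector of \<open>A\<close> can be made orthogonal to \<open>x\<close> by
  subtracting a multiple of \<open>x\<close>, which does not change its image; so a proper subspace
  of \<open>A\<close> already has the full image.\<close>

lemma linear_image_dim_less:
  fixes P :: "'a::euclidean_space \<Rightarrow> 'b::euclidean_space"
  assumes P: "linear P" and A: "subspace A" and x: "x \<in> A" "x \<noteq> 0" "P x = 0"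
  shows "dim (P ` A) < dim A"
proof -
  let ?A = "{a \<in> A. a \<bullet> x = 0}"
  have sub: "subspace ?A" using A by (auto simp: subspace_def inner_add_left)
  have "P ` A \<subseteq> P ` ?A"
  proof
    fix y assume "y \<in> P ` A"
    then obtain a where a: "a \<in> A" "y = P a" by blast
    let ?a = "a - ((a \<bullet> x) / (x \<bullet> x)) *\<^sub>R x"
    have "?a \<in> ?A" using a x A by (auto simp: inner_diff_left intro!: subspace_diff subspace_scale)
    moreover have "P ?a = y" using x(3) a by (simp add: linear_diff[OF P] linear_scale[OF P])
    ultimately show "y \<in> P ` ?A" by blast
  qed
  then have "dim (P ` A) \<le> dim (P ` ?A)" by (rule dim_subset)
  also have "\<dots> \<le> dim ?A" by (rule dim_image_le[OF P])
  also have "\<dots> < dim A"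
  proof (rule dim_psubset)
    have "x \<notin> ?A" using x by simp
    then have "?A \<subset> A" using x(1) by blast
    moreover have "span ?A = ?A" "span A = A" using sub A by (simp_all only: span_eq_iff)
    ultimately show "span ?A \<subset> span A" by (simp only:)
  qed
  finally show ?thesis .
qed

text \<open>A form of the constant rank theorem: with \<open>P\<close> a generalized inverse of the derivative at
  \<open>u0\<close>, the map \<open>u \<mapsto> P (f u) + u - P (L u)\<close> is a local diffeomorphism, and in the coordinates it
  provides \<open>f\<close> depends on \<open>P (f u)\<close> only.\<close>

lemma constant_rank_tangent_cone:
  fixes f :: "'a::euclidean_space \<Rightarrow> 'b::euclidean_space"
  assumes W: "open W" and f: "ck_on (Suc 0) W f"
    and rank: "\<And>u. u \<in> W \<Longrightarrow> dim (range (frechet_derivative f (at u))) = r" and u0: "u0 \<in> W"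
  obtains C S where "compact C" "C \<subseteq> W" "open S" "u0 \<in> S" "S \<subseteq> C"
    "\<And>u t p v. u \<in> C \<Longrightarrow> (\<And>n::nat. p n \<in> f ` C) \<Longrightarrow> t \<longlonglongrightarrow> 0 \<Longrightarrow> (\<And>n. t n \<noteq> (0::real)) \<Longrightarrow>
      (\<lambda>n. (p n - f u) /\<^sub>R t n) \<longlonglongrightarrow> v \<Longrightarrow> v \<in> range (frechet_derivative f (at u))"
proof -
  let ?D = "\<lambda>u. frechet_derivative f (at u)"
  have der: "(f has_derivative ?D u) (at u)" if "u \<in> W" for u by (rule ck_on_has_derivative[OF f that])
  have linD: "linear (?D u)" if "u \<in> W" for u using der[OF that] by (rule has_derivative_linear)
  have L: "linear (?D u0)" by (rule linD[OF u0])
  obtain P where P: "linear P" and PLP: "\<And>y. P (?D u0 (P y)) = P y" and LPL: "\<And>x. ?D u0 (P (?D u0 x)) = ?D u0 x"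
    using generalized_inverse[OF L] by metis
  \<comment> \<open>\<open>E\<close> is idempotent and projects onto the range of \<open>P\<close>.
    In the coordinates constructed below, the composite of \<open>f\<close> with the inverse
    coordinate map will depend on the \<open>E\<close>-part only.\<close>
  define E where "E x = P (?D u0 x)" for x
  have E: "linear E" unfolding E_def[abs_def] using linear_compose[OF L P] by (simp add: o_def)
  have EP: "E (P y) = P y" for y by (simp add: E_def PLP)
  have EE: "E (E x) = E x" for x by (simp add: E_def PLP)
  have blP: "bounded_linear P" and blE: "bounded_linear E" using P E by (simp_all add: linear_conv_bounded_linear)
  define G where "G u = P (f u) + (u - E u)" for u
  let ?G' = "\<lambda>u v. P (?D u v) + (v - E v)"
  have derG: "(G has_derivative ?G' u) (at u)" if "u \<in> W" for u
    unfolding G_def[abs_def]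
    by (intro has_derivative_add has_derivative_diff has_derivative_ident bounded_linear.has_derivative[OF blP]
        bounded_linear_imp_has_derivative[OF blE] der that)
  define G'' where "G'' u = Blinfun (?G' u)" for u
  have G'': "blinfun_apply (G'' u) = ?G' u" if "u \<in> W" for u
    unfolding G''_def using derG[OF that] by (intro bounded_linear_Blinfun_apply has_derivative_bounded_linear)
  have contG'': "continuous_on W G''"
  proof (rule continuous_on_blinfun_componentwise)
    fix i :: 'a
    have "continuous_on W (\<lambda>u. ?G' u i)"
      using f by (intro continuous_intros bounded_linear.continuous_on[OF blP]) auto
    then show "continuous_on W (\<lambda>u. blinfun_apply (G'' u) i)" using G'' by (simp cong: continuous_on_cong)
  qed
  \<comment> \<open>At \<open>u0\<close> the derivative of \<open>G\<close> is the identity, because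
    \<open>P (?D u0 v)\<close> and \<open>E v\<close> cancel.\<close>
  have inv: "id_blinfun o\<^sub>L G'' u0 = id_blinfun"
    by (rule blinfun_eqI) (simp add: G''[OF u0] E_def)
  obtain U' V g g' where U': "open U'" "U' \<subseteq> W" "u0 \<in> U'" and V: "open V" "G u0 \<in> V"
    and hom: "homeomorphism U' V G g" and derg: "\<And>y. y \<in> V \<Longrightarrow> (g has_derivative g' y) (at y)"
    using inverse_function_theorem[OF W, of G G'' u0 id_blinfun] derG G'' contG'' u0 inv by (metis (no_types, lifting))
  have gU: "g y \<in> U'" and Gg: "G (g y) = y" if "y \<in> V" for y
    using hom that by (auto simp: homeomorphism_def)
  have gW: "g y \<in> W" if "y \<in> V" for y using gU[OF that] U'(2) by blast
  define k where "k y = f (g y)" for y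
  define k' where "k' y v = ?D (g y) (g' y v)" for y v
  have derk: "(k has_derivative k' y) (at y)" if "y \<in> V" for y
    unfolding k_def[abs_def] k'_def[abs_def]
    by (rule has_derivative_compose[OF derg[OF that] der[OF gW[OF that]]])
  have lin_k': "linear (k' y)" if "y \<in> V" for y using derk[OF that] by (rule has_derivative_linear)
  have Pk: "P (k y) = E y" if "y \<in> V" for y
  proof -
    have "E y = E (P (k y) + (g y - E (g y)))" using Gg[OF that] by (simp add: G_def k_def)
    also have "\<dots> = P (k y)" by (simp add: linear_add[OF E] linear_diff[OF E] EP EE)
    finally show ?thesis ..
  qed
  have Pk': "P (k' y v) = E v" if "y \<in> V" for y v
  proof -
    have "((\<lambda>y. P (k y)) has_derivative (\<lambda>v. P (k' y v))) (at y)"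
      by (rule bounded_linear.has_derivative[OF blP derk[OF that]])
    then have "(E has_derivative (\<lambda>v. P (k' y v))) (at y)"
      by (rule has_derivative_transform_within_open[OF _ V(1) that]) (rule Pk)
    from has_derivative_unique[OF this bounded_linear_imp_has_derivative[OF blE]]
    show ?thesis by metis
  qed
  \<comment> \<open>\<open>P\<close> maps the range of \<open>k' y\<close> onto
    \<open>range E\<close>, whose dimension is at least that of \<open>range (?D u0)\<close> and
    thus, by constancy of the rank, at least that of the range of \<open>k' y\<close>. So
    \<open>P\<close> is injective on this range, and \<open>P (k' y w) = E w = 0\<close> forces
    \<open>k' y w = 0\<close>.\<close>
  have k'0: "k' y w = 0" if y: "y \<in> V" and w: "E w = 0" for y w
  proof (rule ccontr)
    assume nz: "k' y w \<noteq> 0"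
    have "dim (P ` range (k' y)) < dim (range (k' y))"
      by (rule linear_image_dim_less[OF P linear_subspace_image[OF lin_k'[OF y] subspace_UNIV] _ nz])
        (use Pk'[OF y] w in auto)
    also have "\<dots> \<le> dim (range (?D (g y)))" by (rule dim_subset) (auto simp: k'_def)
    also have "\<dots> = dim (range (?D u0))" using rank[OF gW[OF y]] rank[OF u0] by simp
    also have "range (?D u0) \<subseteq> ?D u0 ` range E"
    proof
      fix z assume "z \<in> range (?D u0)"
      then obtain x where "z = ?D u0 x" by blast
      then have "z = ?D u0 (E x)" using LPL by (simp add: E_def)
      then show "z \<in> ?D u0 ` range E" by blast
    qed
    then have "dim (range (?D u0)) \<le> dim (?D u0 ` range E)" by (rule dim_subset)
    also have "\<dots> \<le> dim (range E)" by (rule dim_image_le[OF L])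
    also have "range E = P ` range (k' y)" using Pk'[OF y] by (auto simp: image_iff)
    finally show False by simp
  qed
  obtain B where B: "B > 0" "\<And>x. norm (E x) \<le> norm x * B"
    using bounded_linear.pos_bounded[OF blE] by blast
  obtain \<rho> where \<rho>: "\<rho> > 0" "ball (G u0) \<rho> \<subseteq> V" using V openE by blast
  \<comment> \<open>The derivative of \<open>k\<close> vanishes in the direction of the segment from
    \<open>y'\<close> to \<open>y\<close>, and convexity of the ball keeps this segment in the
    domain.\<close>
  have kconst: "k y = k y'" if y: "y \<in> ball (G u0) \<rho>" "y' \<in> ball (G u0) \<rho>" "E (y - y') = 0" for y y'
  proof -
    define h where "h s = k (y' + s *\<^sub>R (y - y'))" for s :: real
    have "(h has_derivative (\<lambda>_. 0)) (at s within {0..1})" if s: "s \<in> {0..1}" for s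
    proof -
      have "y' + s *\<^sub>R (y - y') = (1 - s) *\<^sub>R y' + s *\<^sub>R y" by (simp add: algebra_simps)
      also have "\<dots> \<in> ball (G u0) \<rho>"
        using s y by (intro convexD[OF convex_ball]) auto
      finally have inV: "y' + s *\<^sub>R (y - y') \<in> V" using \<rho> by blast
      have "((\<lambda>s. y' + s *\<^sub>R (y - y')) has_derivative (\<lambda>s. s *\<^sub>R (y - y'))) (at s)"
        by (auto intro!: derivative_eq_intros)
      from has_derivative_compose[OF this derk[OF inV]]
      have "(h has_derivative (\<lambda>s'. k' (y' + s *\<^sub>R (y - y')) (s' *\<^sub>R (y - y')))) (at s)"
        by (simp add: h_def[abs_def])
      then have "(h has_derivative (\<lambda>_. 0)) (at s)"
        using k'0[OF inV y(3)] by (simp add: linear_scale[OF lin_k'[OF inV]])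
      then show ?thesis by (rule has_derivative_at_withinI)
    qed
    then obtain c where "\<And>s. s \<in> {0..1} \<Longrightarrow> h s = c"
      using has_derivative_zero_constant[of "{0..1::real}" h] by auto
    from this[of 0] this[of 1] show ?thesis by (simp add: h_def)
  qed
  \<comment> \<open>For \<open>y\<close> and \<open>z\<close> in the closed ball of radius \<sigma>
    about \<open>G u0\<close>, the point \<open>y + E (z - y)\<close> is within \<sigma> + 2
    \<sigma> B < \<rho> of the centre, so \<open>kconst\<close> applies to it.\<close>
  define \<sigma> where "\<sigma> = \<rho> / (2 * (1 + 2 * B))"
  have \<sigma>: "\<sigma> > 0" "\<sigma> * (1 + 2 * B) < \<rho>"
  proof -
    have "1 + 2 * B > 0" using B by simp
    then show "\<sigma> > 0" using \<rho>(1) by (simp add: \<sigma>_def)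
    have "\<sigma> * (1 + 2 * B) = \<rho> / 2" unfolding \<sigma>_def using \<open>1 + 2 * B > 0\<close> by (simp add: divide_simps)
    then show "\<sigma> * (1 + 2 * B) < \<rho>" using \<rho>(1) by linarith
  qed
  have "B * (\<sigma> * 2) > 0" using \<sigma>(1) B(1) by simp
  then have \<sigma>\<rho>: "\<sigma> < \<rho>" using \<sigma>(2) by (simp add: algebra_simps)
  let ?B = "cball (G u0) \<sigma>"
  have B\<rho>: "?B \<subseteq> ball (G u0) \<rho>" using \<sigma>\<rho> by auto
  then have BV: "?B \<subseteq> V" using \<rho>(2) by blast
  have contg: "continuous_on V g" using hom by (simp add: homeomorphism_def)
  have C: "compact (g ` ?B)" by (intro compact_continuous_image continuous_on_subset[OF contg BV]) simp
  have CW: "g ` ?B \<subseteq> W" using BV gW by blast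
  have contG: "continuous_on U' G" using hom by (simp add: homeomorphism_def)
  let ?S = "U' \<inter> G -` ball (G u0) \<sigma>"
  have S: "open ?S" by (rule continuous_open_preimage[OF contG U'(1) open_ball])
  have SC: "?S \<subseteq> g ` ?B"
  proof
    fix u assume u: "u \<in> ?S"
    then have "g (G u) = u" using hom by (auto simp: homeomorphism_def)
    then show "u \<in> g ` ?B" using u by (intro image_eqI[of _ _ "G u"]) auto
  qed
  show thesis
  proof (rule that[OF C CW S _ SC])
    show "u0 \<in> ?S" using U'(3) \<sigma>(1) by simp
    fix u t p v
    assume u: "u \<in> g ` ?B" and p: "\<And>n::nat. p n \<in> f ` (g ` ?B)" and t: "t \<longlonglongrightarrow> 0" "\<And>n. t n \<noteq> (0::real)"
      and lim: "(\<lambda>n. (p n - f u) /\<^sub>R t n) \<longlonglongrightarrow> v"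
    obtain y where y: "y \<in> ?B" "u = g y" using u by blast
    have yV: "y \<in> V" using y BV by blast
    \<comment> \<open>This map of the ambient space is differentiable at \<open>f u\<close> and
      fixes \<open>f u\<close> and all \<open>p n\<close>. The secant limit \<open>v\<close> is
      therefore fixed by its derivative at \<open>f u\<close>, whose range lies in that of
      \<open>?D u\<close>.\<close>
    define m where "m q = k (y + P (q - f u))" for q
    have fu: "f u = k y" by (simp add: k_def y)
    have mp: "m (p n) = p n" for n
    proof -
      obtain z where z: "z \<in> ?B" "p n = k z" using p[of n] by (auto simp: k_def)
      have zV: "z \<in> V" using z BV by blast
      have eq: "y + P (p n - f u) = y + E (z - y)"
        by (simp add: fu z(2) linear_diff[OF P] linear_diff[OF E] Pk yV zV)
      have "dist (G u0) (y + E (z - y)) \<le> dist (G u0) y + norm (E (z - y))"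
        using norm_triangle_ineq4[of "G u0 - y" "E (z - y)"] by (simp add: dist_norm algebra_simps)
      also have "\<dots> \<le> \<sigma> + (2 * \<sigma>) * B"
      proof (rule add_mono)
        have "norm (z - y) \<le> 2 * \<sigma>"
          using y(1) z(1) dist_triangle[of z y "G u0"] by (simp add: dist_commute dist_norm[symmetric])
        then show "norm (E (z - y)) \<le> (2 * \<sigma>) * B"
          using B(2)[of "z - y"] B(1) by (meson mult_right_mono less_imp_le order_trans)
      qed (use y in simp)
      also have "\<dots> < \<rho>" using \<sigma>(2) by (simp add: algebra_simps)
      finally have "y + E (z - y) \<in> ball (G u0) \<rho>" by simp
      moreover have "E (y + E (z - y) - z) = 0"
        by (simp add: linear_add[OF E] linear_diff[OF E] EE)
      ultimately have "k (y + E (z - y)) = k z" using kconst[of _ z] z B\<rho> by blast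
      then show ?thesis unfolding m_def eq by (simp add: z(2))
    qed
    have "((\<lambda>q. y + P (q - f u)) has_derivative P) (at (f u))"
      using bounded_linear.has_derivative[OF blP has_derivative_diff[OF has_derivative_ident has_derivative_const]]
      by (auto intro!: derivative_eq_intros)
    moreover have "y + P (f u - f u) = y" by (simp add: linear_0[OF P])
    ultimately have derm: "(m has_derivative (\<lambda>w. k' y (P w))) (at (f u))"
      unfolding m_def[abs_def] using has_derivative_compose[of _ P "f u" UNIV k "k' y"] derk[OF yV] by metis
    have mfu: "m (f u) = f u" by (simp add: m_def linear_0[OF P] fu)
    define m' where "m' w = k' y (P w)" for w
    have derm': "(m has_derivative m') (at (f u))" using derm by (simp add: m'_def[abs_def])
    have blm': "bounded_linear m'" using derm' by (rule has_derivative_bounded_linear)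
    define q where "q n = (p n - f u) /\<^sub>R t n" for n
    have q: "q \<longlonglongrightarrow> v" using lim by (simp add: q_def[abs_def])
    have pq: "p n - f u = t n *\<^sub>R q n" for n using t(2)[of n] by (simp add: q_def)
    have plim: "(\<lambda>n. p n - f u) \<longlonglongrightarrow> 0"
      unfolding pq using tendsto_scaleR[OF t(1) q] by simp
    have small: "norm (v - m' v) \<le> e * norm v" if e: "e > 0" for e
    proof -
      obtain d where d: "d > 0" "\<And>x. norm (x - f u) < d \<Longrightarrow> norm (m x - m (f u) - m' (x - f u)) \<le> e * norm (x - f u)"
        using derm' e unfolding has_derivative_at_alt by blast
      have "eventually (\<lambda>n. norm (p n - f u) < d) sequentially"
        using order_tendstoD(2)[OF tendsto_norm_zero[OF plim] d(1)] .
      then have ev: "eventually (\<lambda>n. norm (q n - m' (q n)) \<le> e * norm (q n)) sequentially"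
      proof eventually_elim
        case (elim n)
        have "norm (t n *\<^sub>R q n - m' (t n *\<^sub>R q n)) \<le> e * norm (t n *\<^sub>R q n)"
          using d(2)[OF elim] by (simp add: mp mfu pq)
        also have "t n *\<^sub>R q n - m' (t n *\<^sub>R q n) = t n *\<^sub>R (q n - m' (q n))"
          by (simp add: linear_scale[OF bounded_linear.linear[OF blm']] scaleR_diff_right)
        finally have "\<bar>t n\<bar> * norm (q n - m' (q n)) \<le> \<bar>t n\<bar> * (e * norm (q n))" by (simp add: mult_ac)
        then show ?case using t(2)[of n] by simp
      qed
      show ?thesis
        by (rule tendsto_le[OF sequentially_bot _ _ ev])
          (intro tendsto_intros q bounded_linear.tendsto[OF blm'])+
    qed
    have "norm (v - m' v) \<le> 0"
    proof (rule ccontr)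
      assume "\<not> norm (v - m' v) \<le> 0"
      then have pos: "norm (v - m' v) > 0" by simp
      let ?e = "norm (v - m' v) / (2 * (norm v + 1))"
      have n1: "norm v + 1 > 0" by (simp add: add_nonneg_pos)
      have "norm (v - m' v) \<le> ?e * norm v" by (rule small) (use pos n1 in simp)
      also have "\<dots> \<le> ?e * (norm v + 1)" using pos n1 by (intro mult_left_mono) auto
      also have "\<dots> = norm (v - m' v) / 2"
      proof -
        have "a / (2 * b) * b = a / 2" if "b > 0" for a b :: real using that by simp
        from this[OF n1] show ?thesis .
      qed
      finally show False using pos by simp
    qed
    then have "v = k' y (P v)" by (simp add: m'_def)
    then have "v = ?D u (g' y (P v))" by (simp add: k'_def y(2))
    then show "v \<in> range (?D u)" by blast
  qed
qed

section \<open>Divergence in a chart\<close>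

lemma ddiff_bilinear:
  fixes prod :: "'b::euclidean_space \<Rightarrow> 'c::euclidean_space \<Rightarrow> 'd::euclidean_space"
  assumes "bounded_bilinear prod" "ck_on (Suc 0) U f" "ck_on (Suc 0) U g" "x \<in> U"
  shows "ddiff (\<lambda>x. prod (f x) (g x)) v x = prod (f x) (ddiff g v x) + prod (ddiff f v x) (g x)"
  using frechet_derivative_at[OF bounded_bilinear.FDERIV[OF assms(1) ck_on_has_derivative[OF assms(2,4)]
      ck_on_has_derivative[OF assms(3,4)]]] by metis

lemmas ddiff_scaleR = ddiff_bilinear[OF bounded_bilinear_scaleR]
lemmas ddiff_inner = ddiff_bilinear[OF bounded_bilinear_inner]
lemmas ddiff_mult = ddiff_bilinear[OF bounded_bilinear_mult[where 'a = real]]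

lemma ddiff_sum:
  assumes "\<And>i. i \<in> I \<Longrightarrow> ck_on (Suc 0) U (f i)" "x \<in> U"
  shows "ddiff (\<lambda>x. \<Sum>i\<in>I. f i x) v x = (\<Sum>i\<in>I. ddiff (f i) v x)"
proof -
  have "((\<lambda>x. \<Sum>i\<in>I. f i x) has_derivative (\<lambda>v. \<Sum>i\<in>I. ddiff (f i) v x)) (at x)"
    by (intro has_derivative_sum ck_on_has_derivative[OF assms(1) assms(2)])
  from frechet_derivative_at[OF this] show ?thesis by metis
qed

lemma ddiff_sum_scaleR:
  fixes c :: "'i \<Rightarrow> 'a::euclidean_space \<Rightarrow> real" and h :: "'i \<Rightarrow> 'a \<Rightarrow> 'b::euclidean_space"
  assumes "open U" "\<And>i. i \<in> I \<Longrightarrow> ck_on (Suc 0) U (c i)" "\<And>i. i \<in> I \<Longrightarrow> ck_on (Suc 0) U (h i)" "x \<in> U"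
  shows "ddiff (\<lambda>x. \<Sum>i\<in>I. c i x *\<^sub>R h i x) v x
    = (\<Sum>i\<in>I. c i x *\<^sub>R ddiff (h i) v x + ddiff (c i) v x *\<^sub>R h i x)"
proof -
  have "ddiff (\<lambda>x. \<Sum>i\<in>I. c i x *\<^sub>R h i x) v x = (\<Sum>i\<in>I. ddiff (\<lambda>x. c i x *\<^sub>R h i x) v x)"
    by (rule ddiff_sum[OF ck_on_scaleR[OF assms(1-3)] assms(4)])
  also have "\<dots> = (\<Sum>i\<in>I. c i x *\<^sub>R ddiff (h i) v x + ddiff (c i) v x *\<^sub>R h i x)"
    by (rule sum.cong[OF refl], rule ddiff_scaleR[OF assms(2,3,4)])
  finally show ?thesis .
qed

lemma ddiff_cong_open:
  assumes "open U" "\<And>y. y \<in> U \<Longrightarrow> f y = g y" "x \<in> U"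
  shows "ddiff f v x = ddiff g v x"
  using frechet_derivative_cong_open(1)[OF assms(1,3,2)] by simp

locale chart =
  fixes M :: "'a::euclidean_space set" and W :: "(real^'n) set" and \<psi> :: "real^'n \<Rightarrow> 'a"
  assumes lp: "local_parametrization M W \<psi>"
begin

abbreviation "bas i u \<equiv> coord_frame \<psi> u i"
abbreviation "dua i u \<equiv> dual_frame (coord_frame \<psi> u) i"
abbreviation "tansp u \<equiv> span (range (coord_frame \<psi> u))"

lemmas W_open = local_parametrizationD(1)[OF lp]

lemma frame: "u \<in> W \<Longrightarrow> frame (coord_frame \<psi> u)"
  by (rule frame_coord_frame(1)[OF lp])

lemma coord_frame_ck_on:
  fixes f :: "real^'n \<Rightarrow> 'b::euclidean_space"
  assumes "ck_on (Suc k) W f"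
  shows "ck_on k W (\<lambda>u. coord_frame f u i)"
  using assms by (simp add: coord_frame_def)

lemma bas_ck_on: "ck_on k W (bas i)"
  by (rule coord_frame_ck_on[OF local_parametrizationD(2)[OF lp]])

lemma dua_ck_on: "ck_on k W (dua i)"
proof -
  have "ck_on k W (\<lambda>u. matrix_inv (gram_matrix \<psi> u) $ i $ j)" for j
    by (rule ck_on_matrix_inv[OF W_open gram_matrix_ck_on[OF lp]]) (use det_gram_matrix_pos[OF lp] in force)
  then show ?thesis
    unfolding dual_frame_def gram_matrix_eq[symmetric]
    by (intro ck_on_sum ck_on_scaleR W_open bas_ck_on) auto
qed

lemma bas_commute: "u \<in> W \<Longrightarrow> ddiff (bas i) (axis j 1) u = ddiff (bas j) (axis i 1) u"
  unfolding coord_frame_def by (rule ddiff_commute[OF W_open local_parametrizationD(2)[OF lp]])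

lemma dua_bas: "u \<in> W \<Longrightarrow> dua i u \<bullet> bas j u = (if i = j then 1 else 0)"
  by (rule dual_frame_inner[OF frame])

lemma dua_expand: "u \<in> W \<Longrightarrow> (\<Sum>j\<in>UNIV. (dua i u \<bullet> dua j u) *\<^sub>R bas j u) = dua i u"
  by (rule dual_frame_expand_dual[OF frame])

lemma tan_expand: "u \<in> W \<Longrightarrow> x \<in> tansp u \<Longrightarrow> (\<Sum>j\<in>UNIV. (x \<bullet> dua j u) *\<^sub>R bas j u) = x"
  by (rule frame_expand_dual[OF frame])

text \<open>Jacobi's formula gives the logarithmic derivative of det G as the trace of the inverse
  of G times dG. The square root halves it, and the symmetry of G merges the two terms of dG. The
  sum on the right is the contracted Christoffel symbol.\<close>

lemma ddiff_volume_density: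
  assumes u: "u \<in> W"
  shows "ddiff (volume_density \<psi>) (axis k 1) u
    = volume_density \<psi> u * (\<Sum>j\<in>UNIV. dua j u \<bullet> ddiff (bas j) (axis k 1) u)"
proof -
  let ?e = "axis k 1 :: real^'n"
  let ?A = "\<lambda>t. gram_matrix \<psi> (u + t *\<^sub>R ?e)"
  let ?A' = "\<lambda>i j. bas i u \<bullet> ddiff (bas j) ?e u + ddiff (bas i) ?e u \<bullet> bas j u"
  let ?G = "matrix_inv (gram_matrix \<psi> u)"
  let ?s = "\<Sum>j\<in>UNIV. dua j u \<bullet> ddiff (bas j) ?e u"
  have entry: "((\<lambda>t. ?A t $ i $ j) has_real_derivative ?A' i j) (at 0)" for i j
  proof -
    have "((\<lambda>u. bas i u \<bullet> bas j u) has_derivative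
        (\<lambda>v. bas i u \<bullet> ddiff (bas j) v u + ddiff (bas i) v u \<bullet> bas j u)) (at u)"
      by (rule bounded_bilinear.FDERIV[OF bounded_bilinear_inner ck_on_has_derivative[OF bas_ck_on u]
            ck_on_has_derivative[OF bas_ck_on u]])
    then have "((\<lambda>t. bas i (u + t *\<^sub>R ?e) \<bullet> bas j (u + t *\<^sub>R ?e)) has_real_derivative ?A' i j) (at 0)"
      using has_real_derivative_line[of "\<lambda>u. bas i u \<bullet> bas j u" _ u 0 ?e] by simp
    then show ?thesis by (simp add: gram_matrix_eq gram_def)
  qed
  have inv: "?G ** ?A 0 = mat 1" by (simp add: gram_matrix_eq gram_matrix_inv(2)[OF frame[OF u]])
  have Gsym: "?G $ i $ j = ?G $ j $ i" for i j
    unfolding gram_matrix_eq by (rule gram_inv_symmetric[OF frame[OF u]])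
  have dG: "dua j u = (\<Sum>i\<in>UNIV. ?G $ j $ i *\<^sub>R bas i u)" for j
    by (simp add: dual_frame_def gram_matrix_eq)
  have tr: "(\<Sum>i\<in>UNIV. \<Sum>j\<in>UNIV. ?G $ i $ j * ?A' j i) = 2 * ?s"
  proof -
    have "(\<Sum>i\<in>UNIV. \<Sum>j\<in>UNIV. ?G $ i $ j * ?A' j i)
        = (\<Sum>i\<in>UNIV. \<Sum>j\<in>UNIV. ?G $ i $ j * (bas j u \<bullet> ddiff (bas i) ?e u))
          + (\<Sum>i\<in>UNIV. \<Sum>j\<in>UNIV. ?G $ i $ j * (ddiff (bas j) ?e u \<bullet> bas i u))"
      by (simp add: distrib_left sum.distrib)
    also have "(\<Sum>i\<in>UNIV. \<Sum>j\<in>UNIV. ?G $ i $ j * (bas j u \<bullet> ddiff (bas i) ?e u)) = ?s"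
      by (simp add: dG inner_sum_left)
    also have "(\<Sum>i\<in>UNIV. \<Sum>j\<in>UNIV. ?G $ i $ j * (ddiff (bas j) ?e u \<bullet> bas i u)) = ?s"
      by (subst sum.swap) (simp add: dG inner_sum_left Gsym inner_commute[of _ "bas _ _"])
    finally show ?thesis by simp
  qed
  have det: "((\<lambda>t. det (?A t)) has_real_derivative det (?A 0) * (2 * ?s)) (at 0)"
    using has_real_derivative_det[OF entry inv] by (simp only: tr)
  have pos: "det (?A 0) > 0" using det_gram_matrix_pos[OF lp u] by simp
  have "((\<lambda>t. volume_density \<psi> (u + t *\<^sub>R ?e)) has_real_derivative volume_density \<psi> u * ?s) (at 0)"
  proof -
    have D: "((\<lambda>t. sqrt (det (?A t))) has_real_derivative (det (?A 0) * (2 * ?s)) * (inverse (sqrt (det (?A 0))) / 2)) (at 0)"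
      using DERIV_chain2[OF DERIV_real_sqrt[OF pos] det] by (simp only: mult.commute)
    have eq: "(det (?A 0) * (2 * ?s)) * (inverse (sqrt (det (?A 0))) / 2) = sqrt (det (?A 0)) * ?s"
    proof -
      have "(x * (2 * s)) * (y / 2) = (x * y) * s" for x y s :: real by simp
      then show ?thesis
        by (simp only: real_div_sqrt[OF less_imp_le[OF pos], unfolded divide_inverse])
    qed
    from D[unfolded eq] show ?thesis by (simp add: volume_density_def)
  qed
  moreover have "((\<lambda>t. volume_density \<psi> (u + t *\<^sub>R ?e)) has_real_derivative ddiff (volume_density \<psi>) ?e u) (at 0)"
    by (rule has_real_derivative_line) (use ck_on_has_derivative[OF volume_density_ck_on[OF lp] u] in simp)
  ultimately show ?thesis by (rule DERIV_unique[symmetric])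
qed

text \<open>Both sides are the Riemannian divergence of \<open>X\<close> times the density. In the
  trace on the right the ambient derivative may stand for the covariant one, because pairing with
  the tangent vectors \<open>dua j u\<close> discards its normal part.\<close>

lemma divergence_chart:
  assumes X: "ck_on (Suc 0) W X" "\<And>u. u \<in> W \<Longrightarrow> X u \<in> tansp u" and u: "u \<in> W"
  shows "(\<Sum>k\<in>UNIV. ddiff (\<lambda>u. volume_density \<psi> u * (X u \<bullet> dua k u)) (axis k 1) u)
    = volume_density \<psi> u * (\<Sum>j\<in>UNIV. dua j u \<bullet> ddiff X (axis j 1) u)"
proof -
  let ?b = "\<lambda>k u. X u \<bullet> dua k u"
  have b: "ck_on (Suc 0) W (?b k)" for k by (rule ck_on_inner[OF W_open X(1) dua_ck_on])
  have vd: "ck_on (Suc 0) W (volume_density \<psi>)" by (rule volume_density_ck_on[OF lp])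
  have DX: "ddiff X v u = (\<Sum>k\<in>UNIV. ?b k u *\<^sub>R ddiff (bas k) v u + ddiff (?b k) v u *\<^sub>R bas k u)" for v
  proof -
    have "ddiff X v u = ddiff (\<lambda>u. \<Sum>k\<in>UNIV. ?b k u *\<^sub>R bas k u) v u"
      by (rule ddiff_cong_open[OF W_open _ u]) (simp add: tan_expand X(2))
    also have "\<dots> = (\<Sum>k\<in>UNIV. ?b k u *\<^sub>R ddiff (bas k) v u + ddiff (?b k) v u *\<^sub>R bas k u)"
      by (rule ddiff_sum_scaleR[OF W_open b bas_ck_on u])
    finally show ?thesis .
  qed
  have "dua j u \<bullet> ddiff X (axis j 1) u
      = (\<Sum>k\<in>UNIV. ?b k u * (dua j u \<bullet> ddiff (bas k) (axis j 1) u)) + ddiff (?b j) (axis j 1) u" for j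
    by (simp add: DX inner_sum_right inner_add_right sum.distrib dua_bas[OF u] if_distrib cong: if_cong)
  then have "(\<Sum>j\<in>UNIV. dua j u \<bullet> ddiff X (axis j 1) u)
      = (\<Sum>j\<in>UNIV. \<Sum>k\<in>UNIV. ?b k u * (dua j u \<bullet> ddiff (bas k) (axis j 1) u))
        + (\<Sum>j\<in>UNIV. ddiff (?b j) (axis j 1) u)"
    by (simp add: sum.distrib)
  also have "(\<Sum>j\<in>UNIV. \<Sum>k\<in>UNIV. ?b k u * (dua j u \<bullet> ddiff (bas k) (axis j 1) u))
      = (\<Sum>k\<in>UNIV. ?b k u * (\<Sum>j\<in>UNIV. dua j u \<bullet> ddiff (bas j) (axis k 1) u))"
    by (subst sum.swap) (simp add: sum_distrib_left bas_commute[OF u, of _ _])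
  finally have div: "(\<Sum>j\<in>UNIV. dua j u \<bullet> ddiff X (axis j 1) u)
      = (\<Sum>k\<in>UNIV. ?b k u * (\<Sum>j\<in>UNIV. dua j u \<bullet> ddiff (bas j) (axis k 1) u))
        + (\<Sum>j\<in>UNIV. ddiff (?b j) (axis j 1) u)" .
  have "ddiff (\<lambda>u. volume_density \<psi> u * ?b k u) (axis k 1) u = volume_density \<psi> u *
      (ddiff (?b k) (axis k 1) u + ?b k u * (\<Sum>j\<in>UNIV. dua j u \<bullet> ddiff (bas j) (axis k 1) u))" for k
    by (simp only: ddiff_mult[OF vd b u] ddiff_volume_density[OF u] algebra_simps)
  then show ?thesis
    by (simp only: div sum_distrib_left[symmetric] sum.distrib add.commute)
qed

end

text \<open>For the focal map \<open>f\<close> is \<open>\<phi> \<circ> \<psi>\<close>, and the symmetric endomorphism is \<open>cos \<theta> - sin \<theta> A\<close>.\<close>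

locale symmetric_map = chart M W \<psi> for M :: "'a::euclidean_space set" and W and \<psi> :: "real^'n \<Rightarrow> 'a" +
  fixes f :: "real^'n \<Rightarrow> 'a" and c :: real
  assumes f_ck: "ck_on (Suc (Suc 0)) W f"
    and f_tan: "\<And>u i. u \<in> W \<Longrightarrow> coord_frame f u i \<in> tansp u"
    and f_sym: "\<And>u i j. u \<in> W \<Longrightarrow> coord_frame f u i \<bullet> coord_frame \<psi> u j = coord_frame f u j \<bullet> coord_frame \<psi> u i"
    and f_trace: "\<And>u. u \<in> W \<Longrightarrow> (\<Sum>i\<in>UNIV. coord_frame f u i \<bullet> dua i u) = c"
begin

abbreviation "df i u \<equiv> coord_frame f u i"

lemma df_ck_on: "ck_on (Suc 0) W (df i)"
  by (rule coord_frame_ck_on[OF f_ck])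

lemma df_commute: "u \<in> W \<Longrightarrow> ddiff (df i) (axis j 1) u = ddiff (df j) (axis i 1) u"
  unfolding coord_frame_def by (rule ddiff_commute[OF W_open f_ck])

text \<open>The sum is S applied to \<open>dua j u\<close>; symmetry moves S over to
  \<open>bas k u\<close>.\<close>

lemma raised_inner:
  assumes u: "u \<in> W"
  shows "(\<Sum>i\<in>UNIV. (dua i u \<bullet> dua j u) *\<^sub>R df i u) \<bullet> bas k u = dua j u \<bullet> df k u"
proof -
  have "(\<Sum>i\<in>UNIV. (dua i u \<bullet> dua j u) *\<^sub>R df i u) \<bullet> bas k u
      = (\<Sum>i\<in>UNIV. (dua j u \<bullet> dua i u) *\<^sub>R bas i u) \<bullet> df k u"
    by (simp add: inner_sum_left f_sym[OF u, of _ k] inner_commute[of "dua _ u" "dua j u"]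
        inner_commute[of "df k u"])
  then show ?thesis by (simp only: dua_expand[OF u])
qed

text \<open>The symmetry of the second derivatives of \<open>f\<close> exchanges \<open>j\<close>
  and \<open>k\<close>. Expanding \<open>df j\<close> in the frame then leaves the derivative of the
  trace, which is 0, and derivatives of the frame, which the symmetry of S brings to the form on the
  right.\<close>

lemma codazzi_trace:
  assumes u: "u \<in> W"
  shows "(\<Sum>j\<in>UNIV. dua j u \<bullet> ddiff (df k) (axis j 1) u)
    = (\<Sum>j\<in>UNIV. (\<Sum>i\<in>UNIV. (dua i u \<bullet> dua j u) *\<^sub>R df i u) \<bullet> ddiff (bas k) (axis j 1) u)"
proof -
  let ?a = "\<lambda>i l u. df i u \<bullet> dua l u"
  let ?p = "\<lambda>l. ddiff (bas l) (axis k 1) u"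
  let ?q = "\<lambda>j. \<Sum>i\<in>UNIV. (dua i u \<bullet> dua j u) *\<^sub>R df i u"
  have a: "ck_on (Suc 0) W (?a i l)" for i l by (rule ck_on_inner[OF W_open df_ck_on dua_ck_on])
  have Ddf: "ddiff (df i) v u = (\<Sum>l\<in>UNIV. ?a i l u *\<^sub>R ddiff (bas l) v u + ddiff (?a i l) v u *\<^sub>R bas l u)" for i v
  proof -
    have "ddiff (df i) v u = ddiff (\<lambda>u. \<Sum>l\<in>UNIV. ?a i l u *\<^sub>R bas l u) v u"
      by (rule ddiff_cong_open[OF W_open _ u]) (simp add: tan_expand f_tan)
    also have "\<dots> = (\<Sum>l\<in>UNIV. ?a i l u *\<^sub>R ddiff (bas l) v u + ddiff (?a i l) v u *\<^sub>R bas l u)"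
      by (rule ddiff_sum_scaleR[OF W_open a bas_ck_on u])
    finally show ?thesis .
  qed
  have tr0: "(\<Sum>i\<in>UNIV. ddiff (?a i i) (axis k 1) u) = 0"
  proof -
    have "(\<Sum>i\<in>UNIV. ddiff (?a i i) (axis k 1) u) = ddiff (\<lambda>u. \<Sum>i\<in>UNIV. ?a i i u) (axis k 1) u"
      by (rule ddiff_sum[OF a u, symmetric])
    also have "\<dots> = ddiff (\<lambda>u. c) (axis k 1) u"
      by (rule ddiff_cong_open[OF W_open f_trace u])
    finally show ?thesis by simp
  qed
  \<comment> \<open>The matrix of S with both indices raised is symmetric.\<close>
  have N: "?q m \<bullet> dua l u = ?q l \<bullet> dua m u" for m l
  proof -
    have "?q m \<bullet> dua l u = (\<Sum>i\<in>UNIV. (dua l u \<bullet> dua i u) * (dua m u \<bullet> df i u))" for m l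
    proof -
      have "?q m \<bullet> dua l u = ?q m \<bullet> (\<Sum>i\<in>UNIV. (dua l u \<bullet> dua i u) *\<^sub>R bas i u)"
        by (simp only: dua_expand[OF u])
      also have "\<dots> = (\<Sum>i\<in>UNIV. (dua l u \<bullet> dua i u) * (?q m \<bullet> bas i u))"
        by (simp only: inner_sum_right inner_scaleR_right)
      finally show ?thesis by (simp only: raised_inner[OF u])
    qed
    moreover have "(\<Sum>i\<in>UNIV. (dua l u \<bullet> dua i u) * (dua m u \<bullet> df i u)) = ?q l \<bullet> dua m u"
      by (simp add: inner_sum_left inner_commute[of "dua l u"] inner_commute[of "dua m u"])
    ultimately show ?thesis by simp
  qed
  have "(\<Sum>j\<in>UNIV. dua j u \<bullet> ddiff (df k) (axis j 1) u) = (\<Sum>j\<in>UNIV. dua j u \<bullet> ddiff (df j) (axis k 1) u)"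
    by (simp only: df_commute[OF u, of k])
  also have "\<dots> = (\<Sum>j\<in>UNIV. (\<Sum>l\<in>UNIV. ?a j l u * (dua j u \<bullet> ?p l)) + ddiff (?a j j) (axis k 1) u)"
    by (intro sum.cong refl)
      (simp add: Ddf inner_sum_right inner_add_right sum.distrib dua_bas[OF u] if_distrib cong: if_cong)
  also have "\<dots> = (\<Sum>j\<in>UNIV. \<Sum>l\<in>UNIV. ?a j l u * (dua j u \<bullet> ?p l))"
    by (simp add: sum.distrib tr0)
  also have "\<dots> = (\<Sum>l\<in>UNIV. (\<Sum>j\<in>UNIV. ?a j l u *\<^sub>R dua j u) \<bullet> ?p l)"
    by (subst sum.swap) (simp add: inner_sum_left)
  also have "\<dots> = (\<Sum>l\<in>UNIV. ?q l \<bullet> ?p l)"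
  proof (intro sum.cong refl)
    fix l
    have "(\<Sum>j\<in>UNIV. ?a j l u *\<^sub>R dua j u)
        = (\<Sum>j\<in>UNIV. ?a j l u *\<^sub>R (\<Sum>m\<in>UNIV. (dua j u \<bullet> dua m u) *\<^sub>R bas m u))"
      by (simp only: dua_expand[OF u])
    also have "\<dots> = (\<Sum>m\<in>UNIV. (?q m \<bullet> dua l u) *\<^sub>R bas m u)"
      by (simp add: scaleR_sum_right inner_sum_left scaleR_sum_left mult.commute) (rule sum.swap)
    also have "\<dots> = (\<Sum>m\<in>UNIV. (?q l \<bullet> dua m u) *\<^sub>R bas m u)" by (simp only: N[of _ l])
    also have "\<dots> = ?q l"
      by (rule tan_expand[OF u]) (intro span_sum span_scale f_tan[OF u])
    finally show "(\<Sum>j\<in>UNIV. ?a j l u *\<^sub>R dua j u) \<bullet> ?p l = ?q l \<bullet> ?p l" by simp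
  qed
  also have "\<dots> = (\<Sum>j\<in>UNIV. ?q j \<bullet> ddiff (bas k) (axis j 1) u)"
    by (simp only: bas_commute[OF u, of k])
  finally show ?thesis .
qed

text \<open>S applied to a tangent field \<open>w\<close>, written in coordinates; for the focal map
  this is \<open>dphi\<close> applied to \<open>w\<close>.\<close>

definition image_field :: "(real^'n \<Rightarrow> 'a) \<Rightarrow> real^'n \<Rightarrow> 'a" where
  "image_field w u = (\<Sum>k\<in>UNIV. (w u \<bullet> dua k u) *\<^sub>R df k u)"

lemma image_field_ck_on: "ck_on (Suc 0) W w \<Longrightarrow> ck_on (Suc 0) W (image_field w)"
  unfolding image_field_def[abs_def]
  by (intro ck_on_sum ck_on_scaleR ck_on_inner W_open dua_ck_on df_ck_on)

lemma image_field_tan: "u \<in> W \<Longrightarrow> image_field w u \<in> tansp u"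
  unfolding image_field_def by (intro span_sum span_scale f_tan)

text \<open>The product rule yields terms with derivatives of \<open>df\<close> and terms with
  \<open>df\<close> itself. \<open>codazzi_trace\<close> and \<open>raised_inner\<close> rewrite
  both as pairings with the same vectors S(\<open>dua j u\<close>), and together they form the
  derivative of \<open>w\<close>. That no derivative of S is left expresses its vanishing
  divergence.\<close>

lemma divergence_image_field:
  assumes w: "ck_on (Suc 0) W w" "\<And>u. u \<in> W \<Longrightarrow> w u \<in> tansp u" and u: "u \<in> W"
  shows "(\<Sum>j\<in>UNIV. dua j u \<bullet> ddiff (image_field w) (axis j 1) u)
    = (\<Sum>i\<in>UNIV. \<Sum>j\<in>UNIV. (dua i u \<bullet> dua j u) * (df i u \<bullet> coord_frame w u j))"
proof -
  let ?c = "\<lambda>k u. w u \<bullet> dua k u"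
  let ?q = "\<lambda>j. \<Sum>i\<in>UNIV. (dua i u \<bullet> dua j u) *\<^sub>R df i u"
  have c: "ck_on (Suc 0) W (?c k)" for k by (rule ck_on_inner[OF W_open w(1) dua_ck_on])
  have DX: "ddiff (image_field w) v u = (\<Sum>k\<in>UNIV. ?c k u *\<^sub>R ddiff (df k) v u + ddiff (?c k) v u *\<^sub>R df k u)" for v
    unfolding image_field_def[abs_def] by (rule ddiff_sum_scaleR[OF W_open c df_ck_on u])
  have Dw: "ddiff w v u = (\<Sum>k\<in>UNIV. ?c k u *\<^sub>R ddiff (bas k) v u + ddiff (?c k) v u *\<^sub>R bas k u)" for v
  proof -
    have "ddiff w v u = ddiff (\<lambda>u. \<Sum>k\<in>UNIV. ?c k u *\<^sub>R bas k u) v u"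
      by (rule ddiff_cong_open[OF W_open _ u]) (simp add: tan_expand w(2))
    also have "\<dots> = (\<Sum>k\<in>UNIV. ?c k u *\<^sub>R ddiff (bas k) v u + ddiff (?c k) v u *\<^sub>R bas k u)"
      by (rule ddiff_sum_scaleR[OF W_open c bas_ck_on u])
    finally show ?thesis .
  qed
  have "(\<Sum>j\<in>UNIV. dua j u \<bullet> ddiff (image_field w) (axis j 1) u)
      = (\<Sum>j\<in>UNIV. \<Sum>k\<in>UNIV. ?c k u * (dua j u \<bullet> ddiff (df k) (axis j 1) u))
        + (\<Sum>j\<in>UNIV. \<Sum>k\<in>UNIV. ddiff (?c k) (axis j 1) u * (dua j u \<bullet> df k u))"
    by (simp add: DX inner_sum_right inner_add_right sum.distrib)
  also have "(\<Sum>j\<in>UNIV. \<Sum>k\<in>UNIV. ?c k u * (dua j u \<bullet> ddiff (df k) (axis j 1) u))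
      = (\<Sum>k\<in>UNIV. ?c k u * (\<Sum>j\<in>UNIV. ?q j \<bullet> ddiff (bas k) (axis j 1) u))"
    by (subst sum.swap) (simp only: sum_distrib_left[symmetric] codazzi_trace[OF u])
  also have "\<dots> = (\<Sum>j\<in>UNIV. \<Sum>k\<in>UNIV. ?c k u * (?q j \<bullet> ddiff (bas k) (axis j 1) u))"
    by (simp only: sum_distrib_left) (rule sum.swap)
  also have "(\<Sum>j\<in>UNIV. \<Sum>k\<in>UNIV. ddiff (?c k) (axis j 1) u * (dua j u \<bullet> df k u))
      = (\<Sum>j\<in>UNIV. \<Sum>k\<in>UNIV. ddiff (?c k) (axis j 1) u * (?q j \<bullet> bas k u))"
    by (simp only: raised_inner[OF u])
  also have "(\<Sum>j\<in>UNIV. \<Sum>k\<in>UNIV. ?c k u * (?q j \<bullet> ddiff (bas k) (axis j 1) u))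
        + (\<Sum>j\<in>UNIV. \<Sum>k\<in>UNIV. ddiff (?c k) (axis j 1) u * (?q j \<bullet> bas k u))
      = (\<Sum>j\<in>UNIV. ?q j \<bullet> ddiff w (axis j 1) u)"
    by (simp only: Dw inner_sum_right inner_add_right inner_scaleR_right sum.distrib)
  also have "\<dots> = (\<Sum>i\<in>UNIV. \<Sum>j\<in>UNIV. (dua i u \<bullet> dua j u) * (df i u \<bullet> coord_frame w u j))"
    by (simp only: inner_sum_left inner_scaleR_left coord_frame_def) (rule sum.swap)
  finally show ?thesis .
qed

end

section \<open>Isoparametric hypersurfaces\<close>

lemma rank_nullity_on:
  fixes S :: "'a::euclidean_space \<Rightarrow> 'b::euclidean_space"
  assumes S: "linear S" and T: "subspace T"
  shows "dim (S ` T) + dim {v \<in> T. S v = 0} = dim T"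
proof -
  let ?K = "{v \<in> T. S v = 0}"
  let ?T = "{y \<in> T. \<forall>x\<in>?K. orthogonal x y}"
  have K: "subspace ?K"
    using T by (auto simp: subspace_def linear_0[OF S] linear_add[OF S] linear_scale[OF S])
  have T': "subspace ?T"
    using T by (auto simp: subspace_def orthogonal_def inner_add_right)
  have sK: "span ?K = ?K" by (subst span_eq_iff) (rule K)
  have "S ` T = S ` ?T"
  proof
    show "S ` T \<subseteq> S ` ?T"
    proof
      fix z assume "z \<in> S ` T"
      then obtain x where x: "x \<in> T" "z = S x" by blast
      obtain a b where ab: "a \<in> span ?K" "\<And>w. w \<in> span ?K \<Longrightarrow> orthogonal b w" "x = a + b"
        using orthogonal_subspace_decomp_exists[of ?K x] by blast
      note ab = ab[unfolded sK]
      have "b = x - a" using ab(3) by simp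
      then have "b \<in> T" using x(1) ab(1) T by (auto intro: subspace_diff)
      then have "b \<in> ?T" using ab(2) by (auto simp: orthogonal_commute)
      moreover have "S b = z" using ab x by (simp add: linear_add[OF S])
      ultimately show "z \<in> S ` ?T" by blast
    qed
  qed auto
  moreover have "dim (S ` ?T) = dim ?T"
  proof (rule dim_image_eq[OF S])
    have sT: "span ?T = ?T" by (subst span_eq_iff) (rule T')
    show "inj_on S (span ?T)"
      unfolding sT
    proof (rule inj_onI)
      fix x y assume xy: "x \<in> ?T" "y \<in> ?T" "S x = S y"
      have "x - y \<in> ?T" using subspace_diff[OF T' xy(1,2)] .
      moreover from this have "x - y \<in> ?K" using xy(3) by (simp add: linear_diff[OF S])
      ultimately have "orthogonal (x - y) (x - y)" by blast
      then show "x = y" by (simp add: orthogonal_self)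
    qed
  qed
  moreover have "dim ?T + dim ?K = dim T"
    by (rule dim_subspace_orthogonal_to_vectors[OF K T]) auto
  ultimately show ?thesis by simp
qed

lemma ddiff_zero_of_constant:
  assumes "open U" "\<And>y. y \<in> U \<Longrightarrow> f y = c" "x \<in> U"
  shows "ddiff f v x = 0"
  using ddiff_cong_open[OF assms(1), of f "\<lambda>_. c" x v] assms(2,3) by simp

locale isoparametric = compact_submanifold M n vol
  for M :: "'a::euclidean_space set" and n :: "'n::finite itself" and vol :: "'a measure" +
  fixes \<xi> :: "'a \<Rightarrow> 'a" and \<theta> :: real
  assumes isop: "isoparametric_hypersurface TYPE('n) M \<xi>" and sin_nz: "sin \<theta> \<noteq> 0"
begin

abbreviation "\<phi> \<equiv> parallel_map \<xi> \<theta>"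

lemma M_facts: "DIM('a) = CARD('n) + 2" "M \<subseteq> sphere 0 1" "M \<noteq> {}" "smooth_map_on M \<xi>"
  using isop by (auto simp: isoparametric_hypersurface_def sphere_hypersurface_def unit_normal_field_def)

lemma normal_facts:
  assumes "x \<in> M"
  shows "x \<bullet> x = 1" "\<xi> x \<bullet> \<xi> x = 1" "\<xi> x \<bullet> x = 0" "v \<in> tangent_space M x \<Longrightarrow> \<xi> x \<bullet> v = 0"
  using isop assms M_facts(2)
  by (auto simp: isoparametric_hypersurface_def unit_normal_field_def norm_eq_1 subset_iff)

lemma smooth_phi: "smooth_map_on M \<phi>"
  unfolding smooth_map_on_def
proof
  fix p assume "p \<in> M"
  from smooth_map_onE[OF M_facts(4) this]
  obtain U g where U: "p \<in> U" "open U" "\<And>k. ck_on k U g" "\<And>x. x \<in> M \<Longrightarrow> x \<in> U \<Longrightarrow> g x = \<xi> x" by metis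
  have "ck_on k U (\<lambda>x. cos \<theta> *\<^sub>R x + sin \<theta> *\<^sub>R g x)" for k
    by (intro ck_on_add ck_on_scaleR ck_on_const ck_on_id U)
  then have "smooth_on_open U (\<lambda>x. cos \<theta> *\<^sub>R x + sin \<theta> *\<^sub>R g x)" using U(2) by (simp add: smooth_on_open_def)
  moreover have "cos \<theta> *\<^sub>R x + sin \<theta> *\<^sub>R g x = \<phi> x" if "x \<in> M \<inter> U" for x
    using U(4) that by (simp add: parallel_map_def)
  ultimately show "\<exists>U g. p \<in> U \<and> smooth_on_open U g \<and> (\<forall>x\<in>M \<inter> U. g x = \<phi> x)"
    using U(1) by (intro exI[of _ U] exI[of _ "\<lambda>x. cos \<theta> *\<^sub>R x + sin \<theta> *\<^sub>R g x"]) simp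
qed

text \<open>The endomorphism S = cos \<theta> - sin \<theta> A; the sign is plus because
  \<open>shape_operator\<close> is minus the differential of \<xi>.\<close>

definition dphi :: "'a \<Rightarrow> 'a \<Rightarrow> 'a" where
  "dphi x v = cos \<theta> *\<^sub>R v + sin \<theta> *\<^sub>R differential_on M \<xi> x v"

text \<open>The equation c = cos \<theta> - sin \<theta> \<kappa> is solved for \<kappa>.\<close>

lemma eigenspace_eq_curvature_space:
  assumes "x \<in> M"
  shows "eigenspace_on (tangent_space M x) (dphi x) c = curvature_space M \<xi> x ((cos \<theta> - c) / sin \<theta>)"
proof -
  have "dphi x v = c *\<^sub>R v \<longleftrightarrow> shape_operator M \<xi> x v = ((cos \<theta> - c) / sin \<theta>) *\<^sub>R v" for v
  proof -
    have "dphi x v = c *\<^sub>R v \<longleftrightarrow> sin \<theta> *\<^sub>R differential_on M \<xi> x v = (c - cos \<theta>) *\<^sub>R v"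
      by (auto simp: dphi_def algebra_simps)
    also have "\<dots> \<longleftrightarrow> inverse (sin \<theta>) *\<^sub>R (sin \<theta> *\<^sub>R differential_on M \<xi> x v) = inverse (sin \<theta>) *\<^sub>R ((c - cos \<theta>) *\<^sub>R v)"
      using sin_nz by (simp only: scaleR_left_imp_eq[of "inverse (sin \<theta>)"] scaleR_cancel_left) simp
    also have "\<dots> \<longleftrightarrow> differential_on M \<xi> x v = - (((cos \<theta> - c) / sin \<theta>) *\<^sub>R v)"
    proof -
      have "inverse (sin \<theta>) *\<^sub>R ((c - cos \<theta>) *\<^sub>R v) = - (((cos \<theta> - c) / sin \<theta>) *\<^sub>R v)"
        by (simp add: divide_inverse_commute scaleR_minus_left[symmetric] del: scaleR_minus_left)
          (simp add: algebra_simps)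
      then show ?thesis using sin_nz by simp
    qed
    also have "\<dots> \<longleftrightarrow> shape_operator M \<xi> x v = ((cos \<theta> - c) / sin \<theta>) *\<^sub>R v"
      unfolding shape_operator_def by (rule iffI) (simp, drule arg_cong[of _ _ uminus], simp)
    finally show ?thesis .
  qed
  then show ?thesis by (simp add: eigenspace_on_def curvature_space_def)
qed

definition base_point :: 'a where "base_point = (SOME x. x \<in> M)"

text \<open>Multiplicities are read off at one reference point, so that trace and rank of S become
  expressions without \<open>x\<close>. The value at 0 is the multiplicity of the principal
  curvature cot \<theta>.\<close>

definition eigen_mult :: "real \<Rightarrow> nat" where
  "eigen_mult c = dim (curvature_space M \<xi> base_point ((cos \<theta> - c) / sin \<theta>))"

lemma dim_eigenspace: "x \<in> M \<Longrightarrow> dim (eigenspace_on (tangent_space M x) (dphi x) c) = eigen_mult c"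
proof -
  assume x: "x \<in> M"
  have "base_point \<in> M" unfolding base_point_def using M_facts(3) some_in_eq by blast
  then show "dim (eigenspace_on (tangent_space M x) (dphi x) c) = eigen_mult c"
    unfolding eigenspace_eq_curvature_space[OF x] eigen_mult_def
    using isop[unfolded isoparametric_hypersurface_def constant_principal_curvatures_def] x by blast
qed

section \<open>The focal map in a chart\<close>

context
  fixes W and \<psi> :: "real^'n \<Rightarrow> 'a"
  assumes lp: "local_parametrization M W \<psi>"
begin

interpretation chart M W \<psi> by unfold_locales (rule lp)

lemma psi_in_M: "u \<in> W \<Longrightarrow> \<psi> u \<in> M"
  using local_parametrizationD(4)[OF lp] by auto

lemma tangent_space_eq: "u \<in> W \<Longrightarrow> tangent_space M (\<psi> u) = tansp u"
  by (rule tangent_space_chart[OF lp])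

lemma bas_tan: "bas i u \<in> tansp u"
  by (intro span_base) auto

lemma normal_smooth: "ck_on k W (\<lambda>u. \<xi> (\<psi> u))"
  using smooth_map_on_compose[OF M_facts(4) local_parametrizationD(3,4)[OF lp]] by (simp add: smooth_on_open_def)

lemma phi_smooth: "ck_on k W (\<lambda>u. \<phi> (\<psi> u))"
  using smooth_map_on_compose[OF smooth_phi local_parametrizationD(3,4)[OF lp]] by (simp add: smooth_on_open_def)

lemma psi_smooth: "ck_on k W \<psi>"
  by (rule local_parametrizationD(2)[OF lp])

lemma inner_deriv:
  fixes f g :: "real^'n \<Rightarrow> 'a"
  assumes "ck_on (Suc 0) W f" "ck_on (Suc 0) W g" "\<And>u. u \<in> W \<Longrightarrow> f u \<bullet> g u = c" "u \<in> W"
  shows "f u \<bullet> ddiff g v u + ddiff f v u \<bullet> g u = 0"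
  using ddiff_zero_of_constant[OF W_open, of "\<lambda>u. f u \<bullet> g u" c u v] assms(3,4) ddiff_inner[OF assms(1,2,4)]
  by simp

lemma tan_orthogonal_position: "u \<in> W \<Longrightarrow> v \<in> tansp u \<Longrightarrow> v \<bullet> \<psi> u = 0"
proof -
  assume u: "u \<in> W" and v: "v \<in> tansp u"
  have "bas i u \<bullet> \<psi> u = 0" for i
  proof -
    have "\<psi> u \<bullet> ddiff \<psi> (axis i 1) u + ddiff \<psi> (axis i 1) u \<bullet> \<psi> u = 0"
      by (rule inner_deriv[OF psi_smooth psi_smooth _ u]) (use normal_facts(1) psi_in_M in auto)
    then show ?thesis by (simp add: coord_frame_def inner_commute)
  qed
  then have "(\<Sum>j\<in>UNIV. (v \<bullet> dua j u) *\<^sub>R bas j u) \<bullet> \<psi> u = 0" by (simp add: inner_sum_left)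
  then show "v \<bullet> \<psi> u = 0" by (simp add: tan_expand[OF u v])
qed

lemma tan_orthogonal_normal: "u \<in> W \<Longrightarrow> v \<in> tansp u \<Longrightarrow> v \<bullet> \<xi> (\<psi> u) = 0"
  using normal_facts(4)[OF psi_in_M] tangent_space_eq by (simp add: inner_commute)

text \<open>The position and the normal vector are orthonormal, so by the count (n + 2) - 2 = n the
  tangent space fills their orthogonal complement. Tangency thus becomes two equations, which can be
  checked by continuity.\<close>

lemma tan_iff:
  assumes u: "u \<in> W"
  shows "v \<in> tansp u \<longleftrightarrow> v \<bullet> \<psi> u = 0 \<and> v \<bullet> \<xi> (\<psi> u) = 0"
proof -
  let ?A = "{\<psi> u, \<xi> (\<psi> u)}"
  note nf = normal_facts[OF psi_in_M[OF u]]
  let ?T = "{y \<in> UNIV. \<forall>x\<in>span ?A. orthogonal x y}"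
  have "dim ?T + dim (span ?A) = dim (UNIV :: 'a set)"
    by (rule dim_subspace_orthogonal_to_vectors) auto
  moreover have "dim (span ?A) = 2"
  proof -
    have ne: "\<psi> u \<noteq> \<xi> (\<psi> u)" using nf by auto
    have "independent ?A"
      by (rule pairwise_orthogonal_independent)
        (use nf in \<open>auto simp: pairwise_def orthogonal_def inner_commute\<close>)
    then have "dim (span ?A) = card ?A" by (simp add: dim_eq_card_independent)
    then show ?thesis using ne by simp
  qed
  ultimately have "dim ?T = CARD('n)" using M_facts(1) by simp
  then have dim: "dim ?T \<le> dim (tansp u)" by (simp only: dim_span_frame[OF frame[OF u]])
  have Teq: "?T = {y. y \<bullet> \<psi> u = 0 \<and> y \<bullet> \<xi> (\<psi> u) = 0}"
  proof (intro set_eqI iffI)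
    fix y assume "y \<in> ?T"
    then have "\<forall>x\<in>span ?A. orthogonal x y" by simp
    then have "orthogonal (\<psi> u) y" "orthogonal (\<xi> (\<psi> u)) y" by (auto intro: span_base)
    then show "y \<in> {y. y \<bullet> \<psi> u = 0 \<and> y \<bullet> \<xi> (\<psi> u) = 0}" by (simp add: orthogonal_def inner_commute)
  next
    fix y assume y: "y \<in> {y. y \<bullet> \<psi> u = 0 \<and> y \<bullet> \<xi> (\<psi> u) = 0}"
    have "orthogonal y x" if "x \<in> span ?A" for x
      by (rule orthogonal_to_span[OF that]) (use y in \<open>auto simp: orthogonal_def\<close>)
    then show "y \<in> ?T" by (simp add: orthogonal_commute)
  qed
  have "tansp u \<subseteq> ?T"
    unfolding Teq using tan_orthogonal_position[OF u] tan_orthogonal_normal[OF u] by auto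
  moreover have "subspace ?T" unfolding Teq by (auto simp: subspace_def inner_add_left)
  ultimately have "tansp u = ?T" using dim by (intro subspace_dim_equal subspace_span)
  then show ?thesis unfolding Teq by simp
qed

text \<open>The constant functions \<open>\<xi> x \<bullet> \<xi> x\<close> and
  \<open>\<xi> x \<bullet> x\<close> are differentiated along the chart.\<close>

lemma dnormal_tan: "u \<in> W \<Longrightarrow> coord_frame (\<lambda>u. \<xi> (\<psi> u)) u i \<in> tansp u"
proof -
  assume u: "u \<in> W"
  let ?d = "coord_frame (\<lambda>u. \<xi> (\<psi> u)) u i"
  have "\<xi> (\<psi> u) \<bullet> ?d + ?d \<bullet> \<xi> (\<psi> u) = 0"
    unfolding coord_frame_def
    by (rule inner_deriv[OF normal_smooth normal_smooth _ u]) (use normal_facts(2) psi_in_M in auto)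
  moreover have "\<xi> (\<psi> u) \<bullet> bas i u + ?d \<bullet> \<psi> u = 0"
    unfolding coord_frame_def
    by (rule inner_deriv[OF normal_smooth psi_smooth _ u]) (use normal_facts(3) psi_in_M in auto)
  ultimately show "?d \<in> tansp u"
    using tan_orthogonal_normal[OF u bas_tan] by (simp add: tan_iff[OF u] inner_commute)
qed

text \<open>Differentiating the orthogonality of \<xi> to the coordinate vectors expresses both
  sides by second derivatives of the chart, which commute.\<close>

lemma dnormal_sym:
  assumes u: "u \<in> W"
  shows "coord_frame (\<lambda>u. \<xi> (\<psi> u)) u i \<bullet> bas j u = coord_frame (\<lambda>u. \<xi> (\<psi> u)) u j \<bullet> bas i u"
proof -
  have "\<xi> (\<psi> u) \<bullet> ddiff (bas j) (axis i 1) u + coord_frame (\<lambda>u. \<xi> (\<psi> u)) u i \<bullet> bas j u = 0" for i j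
    unfolding coord_frame_def[of "\<lambda>u. \<xi> (\<psi> u)"]
    by (rule inner_deriv[OF normal_smooth bas_ck_on _ u])
      (use tan_orthogonal_normal[OF _ bas_tan] in \<open>simp add: inner_commute\<close>)
  from this[of i j] this[of j i] show ?thesis by (simp add: bas_commute[OF u, of i j])
qed

lemma dphi_linear: "u \<in> W \<Longrightarrow> linear (dphi (\<psi> u))"
proof -
  assume u: "u \<in> W"
  have D: "linear (differential_on M \<xi> (\<psi> u))" by (rule differential_on_chart(2)[OF lp u M_facts(4)])
  show "linear (dphi (\<psi> u))"
    unfolding dphi_def[abs_def]
    by (rule linearI) (simp_all add: linear_add[OF D] linear_scale[OF D] scaleR_add_right algebra_simps)
qed

lemma dphi_bas: "u \<in> W \<Longrightarrow> dphi (\<psi> u) (bas i u) = coord_frame (\<lambda>u. \<phi> (\<psi> u)) u i"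
proof -
  assume u: "u \<in> W"
  have "((\<lambda>u. \<phi> (\<psi> u)) has_derivative (\<lambda>v. cos \<theta> *\<^sub>R ddiff \<psi> v u + sin \<theta> *\<^sub>R ddiff (\<lambda>u. \<xi> (\<psi> u)) v u)) (at u)"
    unfolding parallel_map_def
    by (intro has_derivative_add has_derivative_scaleR_right ck_on_has_derivative[OF psi_smooth u]
        ck_on_has_derivative[OF normal_smooth u])
  from frechet_derivative_at[OF this]
  have "coord_frame (\<lambda>u. \<phi> (\<psi> u)) u i = cos \<theta> *\<^sub>R bas i u + sin \<theta> *\<^sub>R coord_frame (\<lambda>u. \<xi> (\<psi> u)) u i"
    unfolding coord_frame_def by metis
  then show "dphi (\<psi> u) (bas i u) = coord_frame (\<lambda>u. \<phi> (\<psi> u)) u i"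
    by (simp add: dphi_def differential_on_coord_frame[OF lp u M_facts(4)])
qed

lemma dphi_bas': "u \<in> W \<Longrightarrow> dphi (\<psi> u) (bas i u) = cos \<theta> *\<^sub>R bas i u + sin \<theta> *\<^sub>R coord_frame (\<lambda>u. \<xi> (\<psi> u)) u i"
  by (simp add: dphi_def differential_on_coord_frame[OF lp _ M_facts(4)])

lemma dphi_expand: "u \<in> W \<Longrightarrow> v \<in> tansp u \<Longrightarrow> dphi (\<psi> u) v = (\<Sum>j\<in>UNIV. (v \<bullet> dua j u) *\<^sub>R coord_frame (\<lambda>u. \<phi> (\<psi> u)) u j)"
  by (subst tan_expand[symmetric], assumption, assumption)
    (simp add: linear_sum[OF dphi_linear] linear_scale[OF dphi_linear] dphi_bas)

lemma dphi_tan: "u \<in> W \<Longrightarrow> coord_frame (\<lambda>u. \<phi> (\<psi> u)) u i \<in> tansp u"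
  by (subst dphi_bas[symmetric], assumption) (auto simp: dphi_bas' intro!: span_add span_scale bas_tan dnormal_tan)

lemma dphi_sym:
  assumes u: "u \<in> W"
  shows "coord_frame (\<lambda>u. \<phi> (\<psi> u)) u i \<bullet> bas j u = coord_frame (\<lambda>u. \<phi> (\<psi> u)) u j \<bullet> bas i u"
  unfolding dphi_bas[OF u, symmetric] dphi_bas'[OF u]
  by (simp only: inner_add_left inner_scaleR_left dnormal_sym[OF u, of i j] inner_commute[of "bas i u" "bas j u"])

text \<open>The first part identifies the tangent directions of the focal set that \<phi> produces
  near a point with the image of S; by the second, these are tangent to M as well.\<close>

lemma dphi_range:
  assumes u: "u \<in> W"
  shows "dphi (\<psi> u) ` tansp u = range (frechet_derivative (\<lambda>u. \<phi> (\<psi> u)) (at u))"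
    and "dphi (\<psi> u) ` tansp u \<subseteq> tansp u"
proof -
  let ?f = "\<lambda>u. \<phi> (\<psi> u)"
  have lin: "linear (frechet_derivative ?f (at u))"
    using ck_on_has_derivative[OF phi_smooth u] by (rule has_derivative_linear)
  have fd: "frechet_derivative ?f (at u) z = (\<Sum>i\<in>UNIV. z $ i *\<^sub>R coord_frame ?f u i)" for z
    unfolding coord_frame_def by (rule linear_eq_sum_axis[OF lin])
  have "frechet_derivative ?f (at u) z = dphi (\<psi> u) (\<Sum>i\<in>UNIV. z $ i *\<^sub>R bas i u)" for z
    unfolding fd by (simp add: linear_sum[OF dphi_linear[OF u]] linear_scale[OF dphi_linear[OF u]] dphi_bas[OF u])
  then have "frechet_derivative ?f (at u) z \<in> dphi (\<psi> u) ` tansp u" for z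
    by (auto intro!: imageI span_sum span_scale bas_tan)
  moreover have "dphi (\<psi> u) v \<in> range (frechet_derivative ?f (at u))" if "v \<in> tansp u" for v
    using fd[of "\<chi> i. v \<bullet> dua i u"] by (simp add: dphi_expand[OF u that]) (metis rangeI)
  ultimately show "dphi (\<psi> u) ` tansp u = range (frechet_derivative ?f (at u))" by blast
  show "dphi (\<psi> u) ` tansp u \<subseteq> tansp u"
    by (auto simp: dphi_expand[OF u] intro!: span_sum span_scale dphi_tan[OF u])
qed

lemma dphi_symmetric:
  assumes u: "u \<in> W" and v: "v \<in> tansp u" and w: "w \<in> tansp u"
  shows "dphi (\<psi> u) v \<bullet> w = v \<bullet> dphi (\<psi> u) w"
proof -
  let ?F = "\<lambda>i. coord_frame (\<lambda>u. \<phi> (\<psi> u)) u i"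
  have *: "dphi (\<psi> u) v \<bullet> w = (\<Sum>i\<in>UNIV. \<Sum>j\<in>UNIV. (v \<bullet> dua i u) * ((w \<bullet> dua j u) * (?F i \<bullet> bas j u)))"
    if v: "v \<in> tansp u" and w: "w \<in> tansp u" for v w
  proof -
    have "dphi (\<psi> u) v \<bullet> w = (\<Sum>i\<in>UNIV. (v \<bullet> dua i u) *\<^sub>R ?F i) \<bullet> (\<Sum>j\<in>UNIV. (w \<bullet> dua j u) *\<^sub>R bas j u)"
      by (simp only: dphi_expand[OF u v] tan_expand[OF u w])
    then show ?thesis by (simp only: inner_sum_left) (simp add: inner_sum_right sum_distrib_left mult_ac)
  qed
  have "v \<bullet> dphi (\<psi> u) w = dphi (\<psi> u) w \<bullet> v" by (rule inner_commute)
  also have "\<dots> = (\<Sum>j\<in>UNIV. \<Sum>i\<in>UNIV. (w \<bullet> dua j u) * ((v \<bullet> dua i u) * (?F j \<bullet> bas i u)))"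
    by (rule *[OF w v])
  also have "\<dots> = (\<Sum>i\<in>UNIV. \<Sum>j\<in>UNIV. (v \<bullet> dua i u) * ((w \<bullet> dua j u) * (?F i \<bullet> bas j u)))"
  proof (subst sum.swap, intro sum.cong refl)
    fix i j
    show "(w \<bullet> dua j u) * ((v \<bullet> dua i u) * (?F j \<bullet> bas i u)) = (v \<bullet> dua i u) * ((w \<bullet> dua j u) * (?F i \<bullet> bas j u))"
      using dphi_sym[OF u, of i j] by simp
  qed
  finally have "v \<bullet> dphi (\<psi> u) w = (\<Sum>i\<in>UNIV. \<Sum>j\<in>UNIV. (v \<bullet> dua i u) * ((w \<bullet> dua j u) * (?F i \<bullet> bas j u)))" .
  then show ?thesis using *[OF v w] by (simp only:)
qed

lemma dphi_trace:
  assumes u: "u \<in> W"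
  shows "(\<Sum>i\<in>UNIV. coord_frame (\<lambda>u. \<phi> (\<psi> u)) u i \<bullet> dua i u) = (\<Sum>c | eigen_mult c \<noteq> 0. c * real (eigen_mult c))"
proof -
  obtain B where B: "orthonormal_basis_of (tansp u) B"
    "(\<Sum>e\<in>B. dphi (\<psi> u) e \<bullet> e) = (\<Sum>c | dim (eigenspace_on (tansp u) (dphi (\<psi> u)) c) \<noteq> 0.
       c * real (dim (eigenspace_on (tansp u) (dphi (\<psi> u)) c)))"
    using symmetric_operator_trace[OF subspace_span dphi_linear[OF u] dphi_range(2)[OF u] dphi_symmetric[OF u]]
    by blast
  have "dim (eigenspace_on (tansp u) (dphi (\<psi> u)) c) = eigen_mult c" for c
    using dim_eigenspace[OF psi_in_M[OF u]] by (simp add: tangent_space_eq[OF u])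
  then have "(\<Sum>e\<in>B. dphi (\<psi> u) e \<bullet> e) = (\<Sum>c | eigen_mult c \<noteq> 0. c * real (eigen_mult c))" using B(2) by simp
  moreover have "(\<Sum>e\<in>B. dphi (\<psi> u) e \<bullet> e) = (\<Sum>i\<in>UNIV. dphi (\<psi> u) (bas i u) \<bullet> dua i u)"
    by (rule orthonormal_trace_eq_frame[OF frame[OF u] B(1) dphi_linear[OF u]])
  ultimately show ?thesis by (simp add: dphi_bas[OF u])
qed

text \<open>The kernel of S on the tangent space is its eigenspace for 0.\<close>

lemma dphi_rank:
  assumes u: "u \<in> W"
  shows "dim (range (frechet_derivative (\<lambda>u. \<phi> (\<psi> u)) (at u))) = CARD('n) - eigen_mult 0"
proof -
  have "dim (dphi (\<psi> u) ` tansp u) + dim {v \<in> tansp u. dphi (\<psi> u) v = 0} = dim (tansp u)"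
    by (rule rank_nullity_on[OF dphi_linear[OF u] subspace_span])
  moreover have "{v \<in> tansp u. dphi (\<psi> u) v = 0} = eigenspace_on (tangent_space M (\<psi> u)) (dphi (\<psi> u)) 0"
    by (simp add: eigenspace_on_def tangent_space_eq[OF u])
  moreover have "dim (tansp u) = CARD('n)" by (rule dim_span_frame[OF frame[OF u]])
  ultimately show ?thesis
    using dim_eigenspace[OF psi_in_M[OF u], of 0] by (simp add: dphi_range(1)[OF u])
qed

lemma symmetric_map_phi: "symmetric_map M W \<psi> (\<lambda>u. \<phi> (\<psi> u)) (\<Sum>c | eigen_mult c \<noteq> 0. c * real (eigen_mult c))"
  by unfold_locales (rule phi_smooth dphi_tan dphi_sym dphi_trace; assumption?)+

end

end

section \<open>Variations of the focal map\<close>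

lemma frechet_derivative_slice:
  fixes \<Phi> :: "'b::euclidean_space \<times> 'c::euclidean_space \<Rightarrow> 'd::euclidean_space"
  assumes "ck_on (Suc 0) U \<Phi>" "(t, u) \<in> U"
  shows "frechet_derivative (\<lambda>u. \<Phi> (t, u)) (at u) v = ddiff \<Phi> (0, v) (t, u)"
proof -
  have "((\<lambda>u. (t, u)) has_derivative (\<lambda>v. (0, v))) (at u)"
    by (intro has_derivative_Pair has_derivative_const has_derivative_ident)
  from has_derivative_compose[OF this ck_on_has_derivative[OF assms]]
  have "((\<lambda>u. \<Phi> (t, u)) has_derivative (\<lambda>v. ddiff \<Phi> (0, v) (t, u))) (at u)" .
  from frechet_derivative_at[OF this] show ?thesis by metis
qed

lemma ck_on_slice:
  fixes \<Phi> :: "'b::euclidean_space \<times> 'c::euclidean_space \<Rightarrow> 'd::euclidean_space"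
  assumes "ck_on k (I \<times> W) \<Phi>" "open I" "open W" "t \<in> I"
  shows "ck_on k W (\<lambda>u. \<Phi> (t, u))"
  by (rule ck_on_compose[OF assms(3) open_Times[OF assms(2,3)] ck_on_Pair[OF assms(3) ck_on_const ck_on_id] assms(1)])
    (use assms(4) in auto)

lemma has_vector_derivative_quotient:
  fixes g :: "real \<Rightarrow> 'a::euclidean_space"
  assumes g: "(g has_vector_derivative v) (at 0)" and t: "t \<longlonglongrightarrow> 0" "\<And>n. t n \<noteq> 0"
  shows "(\<lambda>n. (g (t n) - g 0) /\<^sub>R t n) \<longlonglongrightarrow> v"
  unfolding tendsto_componentwise_iff[of _ v]
proof
  fix b :: 'a assume "b \<in> Basis"
  have "((\<lambda>s. g s \<bullet> b) has_real_derivative v \<bullet> b) (at 0)"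
    using bounded_linear.has_vector_derivative[OF bounded_linear_inner_left g]
    by (simp add: has_real_derivative_iff_has_vector_derivative)
  then have "((\<lambda>h. (g (0 + h) \<bullet> b - g 0 \<bullet> b) / h) \<longlongrightarrow> v \<bullet> b) (at 0)" by (simp only: DERIV_def)
  moreover have "filterlim t (at 0) sequentially" using t by (simp add: filterlim_at)
  ultimately have "(\<lambda>n. (g (0 + t n) \<bullet> b - g 0 \<bullet> b) / t n) \<longlonglongrightarrow> v \<bullet> b" by (rule filterlim_compose)
  then show "(\<lambda>n. ((g (t n) - g 0) /\<^sub>R t n) \<bullet> b) \<longlonglongrightarrow> v \<bullet> b"
    by (simp add: inner_diff_left divide_inverse mult.commute)
qed

text \<open>The vectors \<open>v\<close> are the limits of secants of \<open>K\<close> at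
  \<open>q\<close>. A subspace around them is bounded in dimension, because the limits themselves
  need not form a subspace when \<open>K\<close> is merely the image of a compact set.\<close>

definition tangent_cone_dim_le :: "'a::euclidean_space set \<Rightarrow> nat \<Rightarrow> bool" where
  "tangent_cone_dim_le K r \<longleftrightarrow> (\<forall>q\<in>K. \<exists>T. subspace T \<and> dim T \<le> r \<and>
     (\<forall>p t v. (\<forall>n::nat. p n \<in> K) \<longrightarrow> t \<longlonglongrightarrow> (0::real) \<longrightarrow> (\<forall>n. t n \<noteq> 0) \<longrightarrow>
        (\<lambda>n. (p n - q) /\<^sub>R t n) \<longlonglongrightarrow> v \<longrightarrow> v \<in> T))"

lemma finite_union_subsequence:
  fixes s :: "nat \<Rightarrow> 'b"
  assumes "finite \<K>" "\<And>n. s n \<in> \<Union>\<K>"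
  obtains K and r :: "nat \<Rightarrow> nat" where "K \<in> \<K>" "strict_mono r" "\<And>n. s (r n) \<in> K"
proof -
  have "(\<Union>K\<in>\<K>. {n. s n \<in> K}) = UNIV" using assms(2) by auto
  then have "infinite (\<Union>K\<in>\<K>. {n. s n \<in> K})" by simp
  then obtain K where K: "K \<in> \<K>" "infinite {n. s n \<in> K}" using assms(1) finite_UN_I by blast
  obtain r :: "nat \<Rightarrow> nat" where "strict_mono r" "\<forall>n. r n \<in> {n. s n \<in> K}"
    using infinite_enumerate[OF K(2)] by blast
  then show thesis using K(1) by (intro that[of K r]) auto
qed

text \<open>The closed sets are treated one by one: if the image of the current open set is not
  inside \<open>K\<close>, a smaller open set misses \<open>K\<close>. Points with this dichotomy
  thus occur in every open set, and there a closed set containing \<open>h y\<close> contains the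
  image of a whole neighbourhood of \<open>y\<close>.\<close>

lemma open_subset_decides_closed_sets:
  fixes h :: "'a::euclidean_space \<Rightarrow> 'b::euclidean_space"
  assumes "finite \<K>" "\<And>K. K \<in> \<K> \<Longrightarrow> closed K" "continuous_on M h" "x \<in> M" "open S" "x \<in> S"
  shows "\<exists>y S'. y \<in> M \<and> open S' \<and> y \<in> S' \<and> S' \<subseteq> S \<and>
    (\<forall>K\<in>\<K>. h ` (M \<inter> S') \<subseteq> K \<or> h ` (M \<inter> S') \<inter> K = {})"
  using assms(1,2)
proof (induction \<K> rule: finite_induct)
  case empty
  then show ?case using assms(4-6) by (intro exI[of _ x] exI[of _ S]) simp
next
  case (insert K \<K>)
  then obtain y S' where y: "y \<in> M" "open S'" "y \<in> S'" "S' \<subseteq> S"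
    "\<And>K. K \<in> \<K> \<Longrightarrow> h ` (M \<inter> S') \<subseteq> K \<or> h ` (M \<inter> S') \<inter> K = {}" by auto
  show ?case
  proof (cases "h ` (M \<inter> S') \<subseteq> K")
    case True
    then show ?thesis using y by (intro exI[of _ y] exI[of _ S']) simp
  next
    case False
    then obtain z where z: "z \<in> M" "z \<in> S'" "h z \<notin> K" by auto
    have "openin (top_of_set M) (M \<inter> h -` (- K))"
      by (rule continuous_openin_preimage_gen[OF assms(3)]) (use insert.prems in auto)
    then obtain O' where O': "open O'" "M \<inter> h -` (- K) = M \<inter> O'" by (auto simp: openin_open)
    have "z \<in> M \<inter> h -` (- K)" using z by simp
    then have zO: "z \<in> O'" unfolding O'(2) by simp
    have "h ` (M \<inter> (S' \<inter> O')) \<inter> K = {}"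
    proof (rule ccontr)
      assume "h ` (M \<inter> (S' \<inter> O')) \<inter> K \<noteq> {}"
      then obtain a where "a \<in> M \<inter> O'" "h a \<in> K" by auto
      then show False unfolding O'(2)[symmetric] by simp
    qed
    moreover have "h ` (M \<inter> (S' \<inter> O')) \<subseteq> L \<or> h ` (M \<inter> (S' \<inter> O')) \<inter> L = {}" if "L \<in> \<K>" for L
      using y(5)[OF that] by auto
    ultimately show ?thesis
      using z y zO O'(1) by (intro exI[of _ z] exI[of _ "S' \<inter> O'"]) auto
  qed
qed

section \<open>Closed pieces of the focal set and their tangent cones\<close>

context isoparametric
begin

lemma continuous_phi: "continuous_on M \<phi>"
proof -
  have "continuous (at x within M) \<phi>" if "x \<in> M" for x
    by (rule has_derivative_continuous[OF smooth_map_on_has_derivative_within[OF smooth_phi that]])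
  then show ?thesis by (simp add: continuous_on_eq_continuous_within)
qed

text \<open>The pieces are images under \<phi> of the compact coordinate sets that
  \<open>constant_rank_tangent_cone\<close> provides; compactness of M leaves finitely many of
  them.\<close>

lemma focal_set_cover:
  obtains \<K> where "finite \<K>" "\<phi> ` M \<subseteq> \<Union>\<K>" "\<And>K. K \<in> \<K> \<Longrightarrow> closed K"
    "\<And>K. K \<in> \<K> \<Longrightarrow> tangent_cone_dim_le K (CARD('n) - eigen_mult 0)"
proof -
  let ?P = "\<lambda>S K. compact K \<and> tangent_cone_dim_le K (CARD('n) - eigen_mult 0) \<and> \<phi> ` (M \<inter> S) \<subseteq> K"
  have "\<exists>S. open S \<and> p \<in> S \<and> (\<exists>K. ?P S K)" if p: "p \<in> M" for p
  proof -
    obtain W and \<psi> :: "real^'n \<Rightarrow> 'a" and u where c: "local_parametrization M W \<psi>" "u \<in> W" "p = \<psi> u"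
      using chart_at[OF p] by metis
    note lp = c(1)
    let ?f = "\<lambda>u. \<phi> (\<psi> u)"
    obtain C S where C: "compact C" "C \<subseteq> W" "open S" "u \<in> S" "S \<subseteq> C"
      and cone: "\<And>u t p v. u \<in> C \<Longrightarrow> (\<And>n::nat. p n \<in> ?f ` C) \<Longrightarrow> t \<longlonglongrightarrow> 0 \<Longrightarrow> (\<And>n. t n \<noteq> (0::real)) \<Longrightarrow>
        (\<lambda>n. (p n - ?f u) /\<^sub>R t n) \<longlonglongrightarrow> v \<Longrightarrow> v \<in> range (frechet_derivative ?f (at u))"
      using constant_rank_tangent_cone[OF local_parametrizationD(1)[OF lp] phi_smooth[OF lp] dphi_rank[OF lp] c(2)]
      by blast
    have "local_parametrization M S \<psi>"
      by (rule local_parametrization_subset[OF lp]) (use C in auto)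
    then obtain O' where O': "open O'" "\<psi> ` S = M \<inter> O'"
      using local_parametrizationD(5) by (metis openin_open)
    have cont: "continuous_on C ?f"
      by (rule continuous_on_subset[OF ck_on_imp_continuous_on[OF phi_smooth[OF lp, of 0]] C(2)])
    have "compact (?f ` C)" by (rule compact_continuous_image[OF cont C(1)])
    moreover have "tangent_cone_dim_le (?f ` C) (CARD('n) - eigen_mult 0)"
      unfolding tangent_cone_dim_le_def
    proof
      fix q assume "q \<in> ?f ` C"
      then obtain u where u: "u \<in> C" "q = ?f u" by blast
      have uW: "u \<in> W" using u C(2) by blast
      have "linear (frechet_derivative ?f (at u))"
        using ck_on_has_derivative[OF phi_smooth[OF lp] uW] by (rule has_derivative_linear)
      then have sub: "subspace (range (frechet_derivative ?f (at u)))"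
        by (rule linear_subspace_image) (rule subspace_UNIV)
      have "v \<in> range (frechet_derivative ?f (at u))"
        if "\<forall>n::nat. p n \<in> ?f ` C" "t \<longlonglongrightarrow> (0::real)" "\<forall>n. t n \<noteq> 0" "(\<lambda>n. (p n - q) /\<^sub>R t n) \<longlonglongrightarrow> v"
        for p t v
        by (rule cone[OF u(1), of p t v]) (use that u(2) in auto)
      with sub show "\<exists>T. subspace T \<and> dim T \<le> CARD('n) - eigen_mult 0 \<and>
          (\<forall>p t v. (\<forall>n::nat. p n \<in> ?f ` C) \<longrightarrow> t \<longlonglongrightarrow> (0::real) \<longrightarrow> (\<forall>n. t n \<noteq> 0) \<longrightarrow>
            (\<lambda>n. (p n - q) /\<^sub>R t n) \<longlonglongrightarrow> v \<longrightarrow> v \<in> T)"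
        using dphi_rank[OF lp uW] by (intro exI[of _ "range (frechet_derivative ?f (at u))"]) auto
    qed
    moreover have "\<phi> ` (M \<inter> O') \<subseteq> ?f ` C" unfolding O'(2)[symmetric] using C(5) by auto
    moreover have "p \<in> O'"
    proof -
      have "p \<in> \<psi> ` S" using c(3) C(4) by blast
      then show ?thesis unfolding O'(2) by simp
    qed
    ultimately show ?thesis using O'(1) by (intro exI[of _ O']) blast
  qed
  from finite_atlas[of "\<lambda>S. \<exists>K. ?P S K", OF this]
  obtain \<S> where S: "finite \<S>" "M \<subseteq> \<Union>\<S>" "\<And>S. S \<in> \<S> \<Longrightarrow> open S \<and> (\<exists>K. ?P S K)" by metis
  then obtain k where k: "\<And>S. S \<in> \<S> \<Longrightarrow> ?P S (k S)" by metis
  show thesis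
  proof (rule that[of "k ` \<S>"])
    show "finite (k ` \<S>)" using S(1) by simp
    show "\<phi> ` M \<subseteq> \<Union>(k ` \<S>)"
    proof
      fix z assume "z \<in> \<phi> ` M"
      then obtain x where x: "x \<in> M" "z = \<phi> x" by blast
      then obtain S where "S \<in> \<S>" "x \<in> S" using S(2) by blast
      then show "z \<in> \<Union>(k ` \<S>)" using k[of S] x by blast
    qed
    show "closed K" if "K \<in> k ` \<S>" for K using that k compact_imp_closed by blast
    show "tangent_cone_dim_le K (CARD('n) - eigen_mult 0)" if "K \<in> k ` \<S>" for K using that k by blast
  qed
qed

end

section \<open>The velocity field of a variation\<close>

locale focal_variation = isoparametric M n vol \<xi> \<theta>
  for M :: "'a::euclidean_space set" and n :: "'n::finite itself" and vol \<xi> \<theta> +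
  fixes \<epsilon> :: real and F :: "real \<Rightarrow> 'a \<Rightarrow> 'a"
  assumes var: "smooth_variation M (\<phi> ` M) \<phi> \<epsilon> F"
begin

abbreviation "I \<equiv> {-\<epsilon><..<\<epsilon>}"

lemma variation_facts: "\<epsilon> > 0" "smooth_map_on (I \<times> M) (\<lambda>(t, x). F t x)"
  "t \<in> I \<Longrightarrow> x \<in> M \<Longrightarrow> F t x \<in> \<phi> ` M" "x \<in> M \<Longrightarrow> F 0 x = \<phi> x"
proof -
  show "\<epsilon> > 0" "smooth_map_on (I \<times> M) (\<lambda>(t, x). F t x)" "x \<in> M \<Longrightarrow> F 0 x = \<phi> x"
    using var by (simp_all add: smooth_variation_def)
  have "\<forall>t\<in>I. F t ` M \<subseteq> \<phi> ` M" using var unfolding smooth_variation_def by (elim conjE)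
  then show "t \<in> I \<Longrightarrow> x \<in> M \<Longrightarrow> F t x \<in> \<phi> ` M" by blast
qed

lemma zero_in_I: "0 \<in> I" using variation_facts(1) by simp

lemma smooth_F: "t \<in> I \<Longrightarrow> smooth_map_on M (F t)"
  by (rule smooth_map_on_slice[OF variation_facts(2)])

definition velocity :: "'a \<Rightarrow> 'a" where "velocity x = vector_derivative (\<lambda>t. F t x) (at 0)"

text \<open>The variation in a chart as one map of time and coordinates: \<open>(1, 0)\<close> is
  the time direction, \<open>(0, axis i 1)\<close> a coordinate direction.\<close>

definition \<Phi> :: "(real^'n \<Rightarrow> 'a) \<Rightarrow> real \<times> (real^'n) \<Rightarrow> 'a" where
  "\<Phi> \<psi> z = F (fst z) (\<psi> (snd z))"

context
  fixes W and \<psi> :: "real^'n \<Rightarrow> 'a"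
  assumes lp: "local_parametrization M W \<psi>"
begin

lemma W_open: "open W" by (rule local_parametrizationD(1)[OF lp])

lemma IW_open: "open (I \<times> W)"
  using W_open by (simp add: open_Times)

lemma Phi_smooth: "ck_on k (I \<times> W) (\<Phi> \<psi>)"
  using smooth_variation_chart[OF variation_facts(2) open_greaterThanLessThan lp]
  by (simp add: smooth_on_open_def \<Phi>_def[abs_def] case_prod_unfold)

lemma F_time_derivative:
  assumes "t \<in> I" "u \<in> W"
  shows "((\<lambda>s. F s (\<psi> u)) has_vector_derivative ddiff (\<Phi> \<psi>) (1, 0) (t, u)) (at t)"
proof -
  have "((\<lambda>s. \<Phi> \<psi> ((0, u) + s *\<^sub>R (1, 0))) has_vector_derivative ddiff (\<Phi> \<psi>) (1, 0) (t, u)) (at t)"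
    by (rule has_vector_derivative_line) (use ck_on_has_derivative[OF Phi_smooth, of "(t, u)"] assms in simp)
  then show ?thesis by (simp add: \<Phi>_def)
qed

lemma velocity_chart: "u \<in> W \<Longrightarrow> velocity (\<psi> u) = ddiff (\<Phi> \<psi>) (1, 0) (0, u)"
  unfolding velocity_def by (rule vector_derivative_at[OF F_time_derivative[OF zero_in_I]])

lemma velocity_smooth: "ck_on k W (\<lambda>u. velocity (\<psi> u))"
proof -
  have "ck_on (Suc k) (I \<times> W) (\<Phi> \<psi>)" by (rule Phi_smooth)
  then have "ck_on k (I \<times> W) (ddiff (\<Phi> \<psi>) (1, 0))" by simp
  then have "ck_on k W (\<lambda>u. ddiff (\<Phi> \<psi>) (1, 0) (0, u))"
    by (rule ck_on_slice) (use W_open zero_in_I in auto)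
  then show ?thesis by (subst ck_on_cong[OF W_open velocity_chart])
qed

lemma F_coord_frame:
  assumes "t \<in> I" "u \<in> W"
  shows "coord_frame (\<lambda>u. F t (\<psi> u)) u i = ddiff (\<Phi> \<psi>) (0, axis i 1) (t, u)"
  using frechet_derivative_slice[OF Phi_smooth, of t u] assms by (simp add: coord_frame_def \<Phi>_def)

text \<open>Time and coordinate derivatives commute, so the time derivative of dF at 0 is
  dV.\<close>

lemma mixed_derivative:
  assumes u: "u \<in> W"
  shows "ddiff (ddiff (\<Phi> \<psi>) (0, axis i 1)) (1, 0) (0, u) = coord_frame (\<lambda>u. velocity (\<psi> u)) u i"
proof -
  have in_IW: "(0, u) \<in> I \<times> W" using u zero_in_I by simp
  have ck: "ck_on (Suc 0) (I \<times> W) (ddiff (\<Phi> \<psi>) (1, 0))" using Phi_smooth[of "Suc (Suc 0)"] by simp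
  have "coord_frame (\<lambda>u. velocity (\<psi> u)) u i = ddiff (\<lambda>u. ddiff (\<Phi> \<psi>) (1, 0) (0, u)) (axis i 1) u"
    unfolding coord_frame_def by (rule ddiff_cong_open[OF W_open velocity_chart u])
  also have "\<dots> = ddiff (ddiff (\<Phi> \<psi>) (1, 0)) (0, axis i 1) (0, u)"
    by (rule frechet_derivative_slice[OF ck in_IW])
  also have "\<dots> = ddiff (ddiff (\<Phi> \<psi>) (0, axis i 1)) (1, 0) (0, u)"
    by (rule ddiff_commute[OF IW_open Phi_smooth in_IW])
  finally show ?thesis ..
qed

end

lemma velocity_derivative: "x \<in> M \<Longrightarrow> ((\<lambda>t. F t x) has_vector_derivative velocity x) (at 0)"
proof -
  assume "x \<in> M"
  then obtain W and \<psi> :: "real^'n \<Rightarrow> 'a" and u where c: "local_parametrization M W \<psi>" "u \<in> W" "x = \<psi> u"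
    using chart_at by metis
  show "((\<lambda>t. F t x) has_vector_derivative velocity x) (at 0)"
    using F_time_derivative[OF c(1) zero_in_I c(2)] by (simp add: c(3) velocity_chart[OF c(1,2)])
qed

text \<open>At a point \<open>y\<close> supplied by \<open>open_subset_decides_closed_sets\<close>,
  a piece containing \<phi> y contains \<phi> of a neighbourhood. The subspace \<open>T\<close>
  around its cone then contains the range of the differential and, having at most that dimension,
  equals it; the velocity lies in the cone of such a piece.\<close>

lemma velocity_orthogonal_dense:
  assumes x: "x \<in> M" "open A" "x \<in> A"
  obtains y where "y \<in> M" "y \<in> A" "velocity y \<bullet> y = 0" "velocity y \<bullet> \<xi> y = 0"
proof -
  obtain \<K> where \<K>: "finite \<K>" "\<phi> ` M \<subseteq> \<Union>\<K>" "\<And>K. K \<in> \<K> \<Longrightarrow> closed K"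
    "\<And>K. K \<in> \<K> \<Longrightarrow> tangent_cone_dim_le K (CARD('n) - eigen_mult 0)"
    using focal_set_cover by blast
  obtain y S' where y: "y \<in> M" "open S'" "y \<in> S'" "S' \<subseteq> A"
    and dec: "\<And>K. K \<in> \<K> \<Longrightarrow> \<phi> ` (M \<inter> S') \<subseteq> K \<or> \<phi> ` (M \<inter> S') \<inter> K = {}"
    using open_subset_decides_closed_sets[OF \<K>(1,3) continuous_phi x(1,2,3)] by metis
  \<comment> \<open>The shift by 2 keeps all times strictly below \<epsilon>, where the variation
    takes values in the focal set.\<close>
  define t where "t k = \<epsilon> / real (Suc (Suc k))" for k
  have t_in: "t k \<in> I" and t_nz: "t k \<noteq> 0" for k
  proof -
    have "\<epsilon> / real (Suc (Suc k)) < \<epsilon> / 1"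
      using variation_facts(1) by (intro divide_strict_left_mono) auto
    moreover have "0 < \<epsilon> / real (Suc (Suc k))" using variation_facts(1) by simp
    ultimately show "t k \<in> I" "t k \<noteq> 0" by (auto simp: t_def)
  qed
  have t0: "t \<longlonglongrightarrow> 0"
    unfolding t_def[abs_def]
    using LIMSEQ_Suc[OF LIMSEQ_Suc[OF lim_const_over_n[of \<epsilon>]]] by simp
  \<comment> \<open>Infinitely many of these points lie in one piece \<open>K\<close>; as
    \<open>K\<close> is closed, it also contains their limit \<phi> y.\<close>
  have "F (t k) y \<in> \<Union>\<K>" for k using variation_facts(3)[OF t_in y(1)] \<K>(2) by blast
  from finite_union_subsequence[OF \<K>(1), of "\<lambda>k. F (t k) y", OF this]
  obtain K and r :: "nat \<Rightarrow> nat" where K: "K \<in> \<K>" "strict_mono r" "\<And>k. F (t (r k)) y \<in> K"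
    by blast
  have tr: "(\<lambda>k. t (r k)) \<longlonglongrightarrow> 0" using LIMSEQ_subseq_LIMSEQ[OF t0 K(2)] by (simp add: o_def)
  have q: "(\<lambda>k. (F (t (r k)) y - \<phi> y) /\<^sub>R t (r k)) \<longlonglongrightarrow> velocity y"
    using has_vector_derivative_quotient[OF velocity_derivative[OF y(1)] tr t_nz] by (simp add: variation_facts(4)[OF y(1)])
  have "(\<lambda>k. \<phi> y + t (r k) *\<^sub>R ((F (t (r k)) y - \<phi> y) /\<^sub>R t (r k))) \<longlonglongrightarrow> \<phi> y + 0 *\<^sub>R velocity y"
    by (intro tendsto_intros tr q)
  then have "(\<lambda>k. F (t (r k)) y) \<longlonglongrightarrow> \<phi> y" using t_nz by simp
  from closed_sequentially[OF \<K>(3)[OF K(1)] K(3) this] have "\<phi> y \<in> K" .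
  then have sub: "\<phi> ` (M \<inter> S') \<subseteq> K" using dec[OF K(1)] y(1,3) by blast
  from bspec[OF \<K>(4)[OF K(1), unfolded tangent_cone_dim_le_def] \<open>\<phi> y \<in> K\<close>]
  obtain T where T: "subspace T \<and> dim T \<le> CARD('n) - eigen_mult 0 \<and>
     (\<forall>p t v. (\<forall>n::nat. p n \<in> K) \<longrightarrow> t \<longlonglongrightarrow> (0::real) \<longrightarrow> (\<forall>n. t n \<noteq> 0) \<longrightarrow>
        (\<lambda>n. (p n - \<phi> y) /\<^sub>R t n) \<longlonglongrightarrow> v \<longrightarrow> v \<in> T)"
    by (elim exE)
  have cone: "v \<in> T"
    if "\<forall>n::nat. p n \<in> K" "t \<longlonglongrightarrow> (0::real)" "\<forall>n. t n \<noteq> 0" "(\<lambda>n. (p n - \<phi> y) /\<^sub>R t n) \<longlonglongrightarrow> v"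
    for p t v
    using conjunct2[OF conjunct2[OF T], rule_format, of p t v] that by simp
  have VT: "velocity y \<in> T" by (rule cone[OF _ tr _ q]) (use K(3) t_nz in auto)
  obtain W and \<psi> :: "real^'n \<Rightarrow> 'a" and u where c: "local_parametrization M W \<psi>" "u \<in> W" "y = \<psi> u"
    using chart_at[OF y(1)] by metis
  note lp = c(1)
  note W = local_parametrizationD[OF lp]
  let ?f = "\<lambda>u. \<phi> (\<psi> u)"
  let ?R = "range (frechet_derivative ?f (at u))"
  have lin: "linear (frechet_derivative ?f (at u))"
    using ck_on_has_derivative[OF phi_smooth[OF lp] c(2)] by (rule has_derivative_linear)
  \<comment> \<open>Images of short straight segments in the chart are differentiable curves inside
    \<open>K\<close>, so their velocities at \<phi> y are limits of secants of
    \<open>K\<close>.\<close>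
  have "?R \<subseteq> T"
  proof
    fix z assume "z \<in> ?R"
    then obtain e where e: "z = frechet_derivative ?f (at u) e" by blast
    let ?V = "W \<inter> \<psi> -` S'"
    have "open ?V"
      by (rule continuous_open_preimage[OF ck_on_imp_continuous_on[OF W(2)[of 0]] W(1) y(2)])
    moreover have "u \<in> ?V" using c y(3) by simp
    ultimately obtain d where d: "d > 0" "ball u d \<subseteq> ?V" using openE by blast
    define s where "s k = d / ((norm e + 1) * real (Suc k))" for k
    have n1: "norm e + 1 > 0" by (simp add: add_nonneg_pos)
    have s_pos: "s k > 0" for k using d(1) n1 by (simp add: s_def)
    have s0: "s \<longlonglongrightarrow> 0"
    proof -
      have "(\<lambda>k. d / (norm e + 1) / real (Suc k)) \<longlonglongrightarrow> 0"
        using LIMSEQ_Suc[OF lim_const_over_n[of "d / (norm e + 1)"]] by simp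
      then show ?thesis by (simp add: s_def[abs_def])
    qed
    have "\<psi> (u + s k *\<^sub>R e) \<in> M \<inter> S'" for k
    proof -
      have "s k * norm e < s k * (norm e + 1)" using s_pos by simp
      also have "\<dots> = d / real (Suc k)" using n1 by (simp add: s_def)
      also have "\<dots> \<le> d / 1" using d(1) by (intro divide_left_mono) auto
      finally have "u + s k *\<^sub>R e \<in> ball u d" using s_pos[of k] by (simp add: dist_norm)
      then show ?thesis using d(2) W(4) by blast
    qed
    then have inK: "\<forall>k. ?f (u + s k *\<^sub>R e) \<in> K" using sub by blast
    have "((\<lambda>s. ?f (u + s *\<^sub>R e)) has_vector_derivative z) (at 0)"
      unfolding e by (rule has_vector_derivative_line) (use ck_on_has_derivative[OF phi_smooth[OF lp] c(2)] in simp)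
    from has_vector_derivative_quotient[OF this s0] s_pos
    have "(\<lambda>k. (?f (u + s k *\<^sub>R e) - \<phi> y) /\<^sub>R s k) \<longlonglongrightarrow> z" by (simp add: c(3) less_imp_neq[symmetric])
    moreover have "\<forall>k. s k \<noteq> 0" using s_pos by (simp add: less_imp_neq[symmetric])
    ultimately show "z \<in> T" using cone[OF inK s0] by blast
  qed
  moreover have "dim T \<le> dim ?R" using T dphi_rank[OF lp c(2)] by simp
  moreover have "subspace ?R" by (rule linear_subspace_image[OF lin subspace_UNIV])
  ultimately have "?R = T" using T by (intro subspace_dim_equal) auto
  then have "velocity y \<in> span (range (coord_frame \<psi> u))"
    using VT dphi_range[OF lp c(2)] by blast
  then have "velocity y \<bullet> y = 0 \<and> velocity y \<bullet> \<xi> y = 0" using tan_iff[OF lp c(2)] c(3) by simp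
  then show thesis using that[of y] y by blast
qed

text \<open>A continuous function vanishing on a dense subset of M vanishes identically; both
  equations are merged into the single function \<open>?h\<close>, since density was obtained for
  them jointly.\<close>

lemma velocity_orthogonal:
  assumes "x \<in> M"
  shows "velocity x \<bullet> x = 0" "velocity x \<bullet> \<xi> x = 0"
proof -
  let ?h = "\<lambda>x. \<bar>velocity x \<bullet> x\<bar> + \<bar>velocity x \<bullet> \<xi> x\<bar>"
  have cont: "continuous_on M ?h"
  proof (rule measurable_vol_if_charts(1))
    fix W and \<psi> :: "real^'n \<Rightarrow> 'a"
    assume lp: "local_parametrization M W \<psi>"
    show "continuous_on W (\<lambda>u. ?h (\<psi> u))"
      by (intro continuous_intros ck_on_imp_continuous_on[OF velocity_smooth[OF lp, of 0]]
          ck_on_imp_continuous_on[OF normal_smooth[OF lp, of 0]] ck_on_imp_continuous_on[OF psi_smooth[OF lp, of 0]])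
  qed
  have "?h x = 0"
  proof (rule ccontr)
    assume "?h x \<noteq> 0"
    have "openin (top_of_set M) (M \<inter> ?h -` (- {0}))"
      by (rule continuous_openin_preimage_gen[OF cont]) auto
    then obtain O' where O': "open O'" "M \<inter> ?h -` (- {0}) = M \<inter> O'" by (auto simp: openin_open)
    have "x \<in> M \<inter> ?h -` (- {0})" using assms \<open>?h x \<noteq> 0\<close> by simp
    then have "x \<in> O'" unfolding O'(2) by simp
    then obtain y where y: "y \<in> M" "y \<in> O'" "velocity y \<bullet> y = 0" "velocity y \<bullet> \<xi> y = 0"
      using velocity_orthogonal_dense[OF assms O'(1)] by blast
    then have "y \<in> M \<inter> O'" by simp
    then show False unfolding O'(2)[symmetric] using y by simp
  qed
  then show "velocity x \<bullet> x = 0" "velocity x \<bullet> \<xi> x = 0" by linarith+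
qed

lemma velocity_tangent:
  assumes "local_parametrization M W (\<psi> :: real^'n \<Rightarrow> 'a)" "u \<in> W"
  shows "velocity (\<psi> u) \<in> span (range (coord_frame \<psi> u))"
  using tan_iff[OF assms] velocity_orthogonal psi_in_M[OF assms] by simp

end

section \<open>Partition of unity\<close>

lemma integrable_ddiff_compact_support:
  fixes g :: "real^'n \<Rightarrow> real"
  assumes g: "ck_on (Suc 0) UNIV g" and C: "compact C" and supp: "\<And>u. u \<notin> C \<Longrightarrow> g u = 0"
  shows "integrable lborel (ddiff g v)"
proof -
  have "continuous_on C (ddiff g v)"
    using continuous_on_subset[of UNIV "ddiff g v" C] g by simp
  from borel_integrable_compact[OF C this]
  have "integrable lborel (\<lambda>u. indicator C u *\<^sub>R ddiff g v u)" .
  moreover have "ddiff g v u = 0" if "u \<notin> C" for u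
    by (rule ddiff_zero_of_constant[of "- C"]) (use that supp C in \<open>auto simp: compact_imp_closed open_Compl\<close>)
  then have "(\<lambda>u. indicator C u *\<^sub>R ddiff g v u) = ddiff g v" by (auto simp: indicator_def fun_eq_iff)
  ultimately show ?thesis by simp
qed

text \<open>The function s |s| is of class C^1. The integration by parts differentiates the cutoff
  functions only once, so this regularity suffices for them.\<close>

lemma DERIV_times_abs: "((\<lambda>s. s * \<bar>s\<bar>) has_real_derivative 2 * \<bar>s\<bar>) (at s)"
proof -
  consider "s > 0" | "s < 0" | "s = 0" by linarith
  then show ?thesis
  proof cases
    case 1
    have "((\<lambda>s. s * s) has_real_derivative 2 * \<bar>s\<bar>) (at s)"
      using 1 by (auto intro!: derivative_eq_intros)
    then show ?thesis
      by (rule has_field_derivative_transform_within_open[where S = "{0<..}"]) (use 1 in auto)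
  next
    case 2
    have "((\<lambda>s. - (s * s)) has_real_derivative 2 * \<bar>s\<bar>) (at s)"
      using 2 by (auto intro!: derivative_eq_intros)
    then show ?thesis
      by (rule has_field_derivative_transform_within_open[where S = "{..<0}"]) (use 2 in auto)
  next
    case 3
    have "((\<lambda>h::real. \<bar>h\<bar>) \<longlongrightarrow> \<bar>0\<bar>) (at 0)" by (intro tendsto_intros)
    then have "((\<lambda>h::real. h * \<bar>h\<bar> / h) \<longlongrightarrow> \<bar>0\<bar>) (at 0)"
      by (rule Lim_transform_eventually) (auto simp: eventually_at_filter)
    then show ?thesis using 3 by (simp add: DERIV_def)
  qed
qed

lemma ck_on_times_abs: "ck_on (Suc 0) UNIV (\<lambda>s::real. s * \<bar>s\<bar>)"
  by (rule ck_on_SucI[where f' = "\<lambda>s v. 2 * \<bar>s\<bar> * v"])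
    (use DERIV_times_abs in \<open>auto simp: has_field_derivative_def intro!: continuous_intros\<close>)

text \<open>With s = r^2 - |x - p|^2 the sum s^2 + s |s| equals 2 s^2 inside the ball and 0 outside,
  and it is of class C^1 across the sphere.\<close>

lemma bump_function_exists:
  fixes p :: "'a::euclidean_space"
  assumes "r > 0"
  obtains \<beta> :: "'a \<Rightarrow> real" where "ck_on (Suc 0) UNIV \<beta>" "\<And>x. \<beta> x \<ge> 0"
    "\<And>x. x \<in> ball p r \<Longrightarrow> \<beta> x > 0" "\<And>x. x \<notin> ball p r \<Longrightarrow> \<beta> x = 0"
proof -
  define s where "s x = r\<^sup>2 - (x - p) \<bullet> (x - p)" for x
  define \<beta> where "\<beta> x = s x * s x + s x * \<bar>s x\<bar>" for x
  have sck: "ck_on (Suc 0) UNIV s"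
    unfolding s_def[abs_def] by (intro ck_on_diff ck_on_const ck_on_inner ck_on_id open_UNIV)
  have "ck_on (Suc 0) UNIV (\<lambda>x. s x * \<bar>s x\<bar>)"
    by (rule ck_on_compose[OF open_UNIV open_UNIV sck ck_on_times_abs]) simp
  then have ck: "ck_on (Suc 0) UNIV \<beta>"
    unfolding \<beta>_def[abs_def] by (rule ck_on_add[OF open_UNIV ck_on_mult[OF open_UNIV sck sck]])
  have s: "s x > 0 \<longleftrightarrow> x \<in> ball p r" for x
  proof -
    have "s x > 0 \<longleftrightarrow> (norm (x - p))\<^sup>2 < r\<^sup>2" by (simp add: s_def power2_norm_eq_inner)
    also have "\<dots> \<longleftrightarrow> norm (x - p) < r"
      using power2_less_imp_less[of "norm (x - p)" r] power_strict_mono[of "norm (x - p)" r 2] assms by auto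
    finally show ?thesis by (simp add: dist_norm norm_minus_commute)
  qed
  have pos: "\<beta> x > 0" if "s x > 0" for x using that by (simp add: \<beta>_def add_pos_pos)
  have zero: "\<beta> x = 0" if "\<not> s x > 0" for x using that by (simp add: \<beta>_def)
  have "\<beta> x \<ge> 0" for x using pos[of x] zero[of x] by (cases "s x > 0") auto
  then show thesis using that[of \<beta>] ck pos zero s by blast
qed

context compact_submanifold
begin

lemma integrable_vol_if_charts:
  fixes f :: "'a \<Rightarrow> real"
  assumes "\<And>W (\<psi> :: real^'n \<Rightarrow> 'a). local_parametrization M W \<psi> \<Longrightarrow> continuous_on W (\<lambda>u. f (\<psi> u))"
  shows "integrable vol f"
proof -
  have "bounded (f ` M)"
    using compact_imp_bounded[OF compact_continuous_image[OF measurable_vol_if_charts(1)[OF assms] compact]] .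
  then obtain B where "\<And>x. x \<in> M \<Longrightarrow> \<bar>f x\<bar> \<le> B" by (auto simp: bounded_iff)
  then have "AE x in vol. norm (f x) \<le> B" by (intro AE_I2) (simp add: vol_simps(1))
  then show ?thesis
    by (rule finite_measure.integrable_const_bound[OF finite_measure_vol _ measurable_vol_if_charts(2)[OF assms]])
qed

text \<open>Supplies the constant that dominates the time derivative of the energy density on all of
  M.\<close>

lemma uniform_bound_if_local:
  fixes f :: "'t \<Rightarrow> 'a \<Rightarrow> real"
  assumes "\<And>W (\<psi> :: real^'n \<Rightarrow> 'a) C. local_parametrization M W \<psi> \<Longrightarrow> compact C \<Longrightarrow> C \<subseteq> W \<Longrightarrow>
    \<exists>K. \<forall>t\<in>J. \<forall>u\<in>C. \<bar>f t (\<psi> u)\<bar> \<le> K"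
  obtains K where "\<And>t x. t \<in> J \<Longrightarrow> x \<in> M \<Longrightarrow> \<bar>f t x\<bar> \<le> K"
proof -
  let ?P = "\<lambda>S K. \<forall>t\<in>J. \<forall>x\<in>M \<inter> S. \<bar>f t x\<bar> \<le> K"
  have "\<exists>S. open S \<and> p \<in> S \<and> (\<exists>K. ?P S K)" if p: "p \<in> M" for p
  proof -
    obtain W C S and \<psi> :: "real^'n \<Rightarrow> 'a"
      where c: "local_parametrization M W \<psi>" "compact C" "C \<subseteq> W" "open S" "p \<in> S" "M \<inter> S \<subseteq> \<psi> ` C"
      using compact_chart_at[OF p] by metis
    obtain K where "\<forall>t\<in>J. \<forall>u\<in>C. \<bar>f t (\<psi> u)\<bar> \<le> K" using assms[OF c(1-3)] by blast
    then have "?P S K" using c(6) by blast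
    then show ?thesis using c(4,5) by blast
  qed
  from finite_atlas[of "\<lambda>S. \<exists>K. ?P S K", OF this]
  obtain \<S> where S: "finite \<S>" "M \<subseteq> \<Union>\<S>" "\<And>S. S \<in> \<S> \<Longrightarrow> open S \<and> (\<exists>K. ?P S K)" by metis
  define k where "k S = (SOME K. ?P S K)" for S
  have k: "?P S (k S)" if "S \<in> \<S>" for S
    unfolding k_def by (rule someI_ex[OF conjunct2[OF S(3)[OF that]]])
  show thesis
  proof (rule that[of "\<Sum>S\<in>\<S>. \<bar>k S\<bar>"])
    fix t x assume tx: "t \<in> J" "x \<in> M"
    then obtain S where "S \<in> \<S>" "x \<in> S" using S(2) by blast
    have "\<bar>f t x\<bar> \<le> k S" using k[OF \<open>S \<in> \<S>\<close>] tx \<open>x \<in> S\<close> by auto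
    then have "\<bar>f t x\<bar> \<le> \<bar>k S\<bar>" by linarith
    also have "\<dots> \<le> (\<Sum>S\<in>\<S>. \<bar>k S\<bar>)" by (rule member_le_sum[OF \<open>S \<in> \<S>\<close> _ S(1)]) simp
    finally show "\<bar>f t x\<bar> \<le> (\<Sum>S\<in>\<S>. \<bar>k S\<bar>)" .
  qed
qed

text \<open>The functions add up to \<open>1\<close> on a neighbourhood of \<open>M\<close> and not only on \<open>M\<close>, so that their
  derivatives in the ambient space add up to \<open>0\<close>.\<close>

lemma partition_of_unity:
  obtains \<S> :: "'a set set" and \<Omega> \<rho> where "finite \<S>" "open \<Omega>" "M \<subseteq> \<Omega>"
    "\<And>S. S \<in> \<S> \<Longrightarrow> ck_on (Suc 0) \<Omega> (\<rho> S)" "\<And>x. x \<in> \<Omega> \<Longrightarrow> (\<Sum>S\<in>\<S>. \<rho> S x) = (1::real)"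
    "\<And>S. S \<in> \<S> \<Longrightarrow> \<exists>W (\<psi> :: real^'n \<Rightarrow> 'a) C K. local_parametrization M W \<psi> \<and> compact C \<and> C \<subseteq> W \<and>
       closed K \<and> M \<inter> K \<subseteq> \<psi> ` C \<and> (\<forall>x\<in>\<Omega>. x \<notin> K \<longrightarrow> \<rho> S x = 0)"
proof -
  let ?Q = "\<lambda>\<beta>. \<exists>W (\<psi> :: real^'n \<Rightarrow> 'a) C K. local_parametrization M W \<psi> \<and> compact C \<and> C \<subseteq> W \<and>
       closed K \<and> M \<inter> K \<subseteq> \<psi> ` C \<and> (\<forall>x. x \<notin> K \<longrightarrow> \<beta> x = 0)"
  let ?P = "\<lambda>S \<beta>. ck_on (Suc 0) UNIV \<beta> \<and> (\<forall>x. \<beta> x \<ge> (0::real)) \<and> (\<forall>x\<in>S. \<beta> x > 0) \<and> ?Q \<beta>"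
  have "\<exists>S. open S \<and> p \<in> S \<and> (\<exists>\<beta>. ?P S \<beta>)" if p: "p \<in> M" for p
  proof -
    obtain W C S and \<psi> :: "real^'n \<Rightarrow> 'a"
      where c: "local_parametrization M W \<psi>" "compact C" "C \<subseteq> W" "open S" "p \<in> S" "M \<inter> S \<subseteq> \<psi> ` C"
      using compact_chart_at[OF p] by metis
    obtain r where r: "r > 0" "cball p r \<subseteq> S" using c(4,5) by (meson open_contains_cball)
    from bump_function_exists[OF r(1), of p]
    obtain \<beta> :: "'a \<Rightarrow> real" where \<beta>: "ck_on (Suc 0) UNIV \<beta>" "\<And>x. \<beta> x \<ge> 0"
      "\<And>x. x \<in> ball p r \<Longrightarrow> \<beta> x > 0" "\<And>x. x \<notin> ball p r \<Longrightarrow> \<beta> x = 0"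
      by metis
    have "?Q \<beta>"
      by (rule exI[of _ W], rule exI[of _ \<psi>], rule exI[of _ C], rule exI[of _ "cball p r"])
        (use c r \<beta>(4) in auto)
    then have "?P (ball p r) \<beta>" using \<beta>(1-3) by blast
    moreover have "open (ball p r)" "p \<in> ball p r" using r(1) by auto
    ultimately show ?thesis by (intro exI[of _ "ball p r"]) blast
  qed
  from finite_atlas[of "\<lambda>S. \<exists>\<beta>. ?P S \<beta>", OF this]
  obtain \<S> where S: "finite \<S>" "M \<subseteq> \<Union>\<S>" "\<And>S. S \<in> \<S> \<Longrightarrow> open S \<and> (\<exists>\<beta>. ?P S \<beta>)" by metis
  define b where "b S = (SOME \<beta>. ?P S \<beta>)" for S
  have b: "?P S (b S)" if "S \<in> \<S>" for S
    unfolding b_def by (rule someI_ex[OF conjunct2[OF S(3)[OF that]]])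
  define B where "B x = (\<Sum>S\<in>\<S>. b S x)" for x
  have Bck: "ck_on (Suc 0) UNIV B"
    unfolding B_def[abs_def] by (rule ck_on_sum) (use b in auto)
  \<comment> \<open>Positivity of the sum \<open>B\<close> is an open condition and holds on M, so
    division by \<open>B\<close> is possible on a whole neighbourhood.\<close>
  define \<Omega> where "\<Omega> = {x. B x > 0}"
  have "continuous_on UNIV B" by (rule ck_on_imp_continuous_on[OF Bck])
  then have \<Omega>: "open \<Omega>" unfolding \<Omega>_def by (intro open_Collect_less continuous_on_const)
  have M\<Omega>: "M \<subseteq> \<Omega>"
  proof
    fix x assume "x \<in> M"
    then obtain S where "S \<in> \<S>" "x \<in> S" using S(2) by blast
    then show "x \<in> \<Omega>"
      unfolding \<Omega>_def B_def mem_Collect_eq using b S(1) by (intro sum_pos2[of _ S]) auto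
  qed
  define \<rho> where "\<rho> S x = b S x * inverse (B x)" for S x
  have "ck_on (Suc 0) \<Omega> (\<rho> S)" if "S \<in> \<S>" for S
    unfolding \<rho>_def
    using b[OF that] Bck \<Omega>
    by (intro ck_on_mult ck_on_inverse) (auto intro: ck_on_subset simp: \<Omega>_def simp del: ck_on.simps)
  moreover have "(\<Sum>S\<in>\<S>. \<rho> S x) = 1" if "x \<in> \<Omega>" for x
    using that by (simp add: \<rho>_def sum_distrib_right[symmetric] B_def[symmetric] \<Omega>_def del: inverse_eq_divide)
  moreover have "\<exists>W (\<psi> :: real^'n \<Rightarrow> 'a) C K. local_parametrization M W \<psi> \<and> compact C \<and> C \<subseteq> W \<and>
       closed K \<and> M \<inter> K \<subseteq> \<psi> ` C \<and> (\<forall>x\<in>\<Omega>. x \<notin> K \<longrightarrow> \<rho> S x = 0)" if "S \<in> \<S>" for S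
  proof -
    have "?Q (b S)" using b[OF that] by blast
    then obtain W and \<psi> :: "real^'n \<Rightarrow> 'a" and C K where "local_parametrization M W \<psi> \<and> compact C \<and> C \<subseteq> W \<and>
       closed K \<and> M \<inter> K \<subseteq> \<psi> ` C \<and> (\<forall>x. x \<notin> K \<longrightarrow> b S x = 0)" by (elim exE)
    then show ?thesis
      by (intro exI[of _ W] exI[of _ \<psi>] exI[of _ C] exI[of _ K]) (simp add: \<rho>_def)
  qed
  ultimately show thesis using that[of \<S> \<Omega> \<rho>] S(1) \<Omega> M\<Omega> by blast
qed

end

section \<open>The first variation of the energy\<close>

context focal_variation
begin

definition energy_density :: "real \<Rightarrow> 'a \<Rightarrow> real" where
  "energy_density t x = differential_norm_sq M (F t) x"

text \<open>The integrand of the first variation, \<open>\<langle>d\<phi>, dV\<rangle>\<close>.\<close>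

definition first_variation :: "'a \<Rightarrow> real" where
  "first_variation x = deriv (\<lambda>t. energy_density t x) 0 / 2"

text \<open>The coordinate form of the energy density of \<open>F t\<close>, as one function of time
  and coordinates: its joint regularity gives the time derivative together with local bounds for
  it.\<close>

definition chart_energy :: "(real^'n \<Rightarrow> 'a) \<Rightarrow> real \<times> (real^'n) \<Rightarrow> real" where
  "chart_energy \<psi> z = (\<Sum>i\<in>UNIV. \<Sum>j\<in>UNIV. matrix_inv (gram_matrix \<psi> (snd z)) $ i $ j *
     (ddiff (\<Phi> \<psi>) (0, axis i 1) z \<bullet> ddiff (\<Phi> \<psi>) (0, axis j 1) z))"

text \<open>The field S V, whose divergence is \<open>first_variation\<close>.\<close>

definition transported_field :: "'a \<Rightarrow> 'a" where
  "transported_field x = dphi x (velocity x)"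

context
  fixes W and \<psi> :: "real^'n \<Rightarrow> 'a"
  assumes lp: "local_parametrization M W \<psi>"
begin

interpretation symmetric_map M W \<psi> "\<lambda>u. \<phi> (\<psi> u)" "\<Sum>c | eigen_mult c \<noteq> 0. c * real (eigen_mult c)"
  by (rule symmetric_map_phi[OF lp])

lemma energy_density_chart: "t \<in> I \<Longrightarrow> u \<in> W \<Longrightarrow> energy_density t (\<psi> u) = chart_energy \<psi> (t, u)"
  unfolding energy_density_def chart_energy_def
  by (subst differential_norm_sq_chart[OF lp _ smooth_F]) (simp_all add: F_coord_frame[OF lp])

lemma chart_energy_ck_on: "ck_on (Suc 0) (I \<times> W) (chart_energy \<psi>)"
proof -
  note op = IW_open[OF lp]
  have "ck_on (Suc 0) (I \<times> W) snd"
    by (rule ck_on_bounded_linear[OF op bounded_linear_snd ck_on_id])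
  then have G: "ck_on (Suc 0) (I \<times> W) (\<lambda>z. matrix_inv (gram_matrix \<psi> (snd z)) $ i $ j)" for i j
    by (rule ck_on_compose[OF op W_open])
      (rule ck_on_matrix_inv[OF W_open gram_matrix_ck_on[OF lp]], use det_gram_matrix_pos[OF lp] in force, auto)
  have "ck_on (Suc (Suc 0)) (I \<times> W) (\<Phi> \<psi>)" by (rule Phi_smooth[OF lp])
  then have D: "ck_on (Suc 0) (I \<times> W) (ddiff (\<Phi> \<psi>) v)" for v by (rule ck_on_ddiff)
  show ?thesis
    unfolding chart_energy_def[abs_def] by (intro ck_on_sum ck_on_mult ck_on_inner op G D)
qed

lemma energy_density_derivative:
  assumes "t \<in> I" "u \<in> W"
  shows "((\<lambda>s. energy_density s (\<psi> u)) has_real_derivative ddiff (chart_energy \<psi>) (1, 0) (t, u)) (at t)"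
proof -
  have "((\<lambda>s. chart_energy \<psi> ((0, u) + s *\<^sub>R (1, 0))) has_real_derivative ddiff (chart_energy \<psi>) (1, 0) (t, u)) (at t)"
    by (rule has_real_derivative_line) (use ck_on_has_derivative[OF chart_energy_ck_on, of "(t, u)"] assms in simp)
  then have "((\<lambda>s. chart_energy \<psi> (s, u)) has_real_derivative ddiff (chart_energy \<psi>) (1, 0) (t, u)) (at t)" by simp
  then show ?thesis
    by (rule has_field_derivative_transform_within_open[where S = I])
      (use assms energy_density_chart in auto)
qed

lemma first_variation_chart: "u \<in> W \<Longrightarrow> first_variation (\<psi> u) = ddiff (chart_energy \<psi>) (1, 0) (0, u) / 2"
  unfolding first_variation_def using DERIV_imp_deriv[OF energy_density_derivative[OF zero_in_I]] by simp

lemma first_variation_continuous: "continuous_on W (\<lambda>u. first_variation (\<psi> u))"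
proof -
  have "ck_on 0 (I \<times> W) (ddiff (chart_energy \<psi>) (1, 0))" by (rule ck_on_ddiff[OF chart_energy_ck_on])
  then have "ck_on 0 W (\<lambda>u. ddiff (chart_energy \<psi>) (1, 0) (0, u))"
    by (rule ck_on_slice) (use W_open zero_in_I in auto)
  then have "continuous_on W (\<lambda>u. ddiff (chart_energy \<psi>) (1, 0) (0, u) / 2)"
    by (intro continuous_intros) simp_all
  then show ?thesis by (rule continuous_on_eq) (simp add: first_variation_chart)
qed

text \<open>The metric factor does not depend on time, and \<open>mixed_derivative\<close> turns the
  time derivative of dF into dV. The two sums from the product rule agree by the symmetry of the
  inverse metric, which cancels the factor 1/2.\<close>

lemma first_variation_formula:
  assumes u: "u \<in> W"
  shows "first_variation (\<psi> u)
    = (\<Sum>i\<in>UNIV. \<Sum>j\<in>UNIV. (dua i u \<bullet> dua j u) * (df i u \<bullet> coord_frame (\<lambda>u. velocity (\<psi> u)) u j))"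
proof -
  let ?w = "\<lambda>i. coord_frame (\<lambda>u. velocity (\<psi> u)) u i" and ?g = "\<lambda>i j. dua i u \<bullet> dua j u"
  have Phi0: "ddiff (\<Phi> \<psi>) (0, axis i 1) (0, u) = df i u" for i
  proof -
    have "ddiff (\<Phi> \<psi>) (0, axis i 1) (0, u) = coord_frame (\<lambda>u. F 0 (\<psi> u)) u i"
      by (rule F_coord_frame[OF lp zero_in_I u, symmetric])
    also have "\<dots> = df i u"
      unfolding coord_frame_def
      by (rule ddiff_cong_open[OF W_open _ u]) (simp add: variation_facts(4)[OF psi_in_M[OF lp]])
    finally show ?thesis .
  qed
  have D: "((\<lambda>s. ddiff (\<Phi> \<psi>) (0, axis i 1) (s, u)) has_vector_derivative ?w i) (at 0)" for i
  proof -
    have ck: "ck_on (Suc 0) (I \<times> W) (ddiff (\<Phi> \<psi>) (0, axis i 1))"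
      by (rule ck_on_ddiff[OF Phi_smooth[OF lp]])
    have "((\<lambda>s. ddiff (\<Phi> \<psi>) (0, axis i 1) ((0, u) + s *\<^sub>R (1, 0))) has_vector_derivative
        ddiff (ddiff (\<Phi> \<psi>) (0, axis i 1)) (1, 0) (0, u)) (at 0)"
      by (rule has_vector_derivative_line) (use ck_on_has_derivative[OF ck, of "(0, u)"] u zero_in_I in simp)
    then show ?thesis by (simp add: mixed_derivative[OF lp u])
  qed
  have ip: "((\<lambda>s. ddiff (\<Phi> \<psi>) (0, axis i 1) (s, u) \<bullet> ddiff (\<Phi> \<psi>) (0, axis j 1) (s, u)) has_real_derivative
      (df i u \<bullet> ?w j + ?w i \<bullet> df j u)) (at 0)" for i j
    using bounded_bilinear.has_vector_derivative[OF bounded_bilinear_inner D[of i] D[of j]]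
    by (simp add: has_real_derivative_iff_has_vector_derivative Phi0)
  have Gg: "matrix_inv (gram_matrix \<psi> u) $ i $ j = ?g i j" for i j
    by (simp add: gram_matrix_eq dual_frame_inner_dual[OF frame[OF u]])
  have "((\<lambda>s. chart_energy \<psi> (s, u)) has_real_derivative
      (\<Sum>i\<in>UNIV. \<Sum>j\<in>UNIV. ?g i j * (df i u \<bullet> ?w j + ?w i \<bullet> df j u))) (at 0)"
    unfolding chart_energy_def snd_conv Gg by (intro DERIV_sum DERIV_cmult ip)
  moreover have "((\<lambda>s. chart_energy \<psi> (s, u)) has_real_derivative ddiff (chart_energy \<psi>) (1, 0) (0, u)) (at 0)"
    by (rule has_field_derivative_transform_within_open[OF energy_density_derivative[OF zero_in_I u], of I])
      (use zero_in_I u energy_density_chart in auto)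
  ultimately have "ddiff (chart_energy \<psi>) (1, 0) (0, u)
      = (\<Sum>i\<in>UNIV. \<Sum>j\<in>UNIV. ?g i j * (df i u \<bullet> ?w j + ?w i \<bullet> df j u))"
    by (rule DERIV_unique[symmetric])
  also have "\<dots> = (\<Sum>i\<in>UNIV. \<Sum>j\<in>UNIV. ?g i j * (df i u \<bullet> ?w j))
      + (\<Sum>i\<in>UNIV. \<Sum>j\<in>UNIV. ?g i j * (?w i \<bullet> df j u))"
    by (simp only: distrib_left sum.distrib)
  also have "(\<Sum>i\<in>UNIV. \<Sum>j\<in>UNIV. ?g i j * (?w i \<bullet> df j u)) = (\<Sum>i\<in>UNIV. \<Sum>j\<in>UNIV. ?g i j * (df i u \<bullet> ?w j))"
    by (subst sum.swap) (simp only: inner_commute)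
  finally show ?thesis by (simp add: first_variation_chart[OF u])
qed

lemma transported_field_chart: "u \<in> W \<Longrightarrow> transported_field (\<psi> u) = image_field (\<lambda>u. velocity (\<psi> u)) u"
  unfolding transported_field_def image_field_def by (rule dphi_expand[OF lp _ velocity_tangent[OF lp]])

lemma transported_field_ck_on: "ck_on (Suc 0) W (\<lambda>u. transported_field (\<psi> u))"
  using image_field_ck_on[OF velocity_smooth[OF lp]] by (subst ck_on_cong[OF W_open transported_field_chart])

lemma transported_field_tan: "u \<in> W \<Longrightarrow> transported_field (\<psi> u) \<in> tansp u"
  using transported_field_chart image_field_tan by simp

text \<open>Tangency of V to M is what allows \<open>divergence_image_field\<close> to rewrite the
  contraction of d\<phi> with dV as div (S V).\<close>

lemma first_variation_divergence:
  assumes u: "u \<in> W"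
  shows "volume_density \<psi> u * first_variation (\<psi> u)
    = (\<Sum>k\<in>UNIV. ddiff (\<lambda>u. volume_density \<psi> u * (transported_field (\<psi> u) \<bullet> dua k u)) (axis k 1) u)"
proof -
  have "first_variation (\<psi> u) = (\<Sum>j\<in>UNIV. dua j u \<bullet> ddiff (image_field (\<lambda>u. velocity (\<psi> u))) (axis j 1) u)"
    unfolding first_variation_formula[OF u]
    by (rule divergence_image_field[OF velocity_smooth[OF lp] velocity_tangent[OF lp] u, symmetric])
  also have "\<dots> = (\<Sum>j\<in>UNIV. dua j u \<bullet> ddiff (\<lambda>u. transported_field (\<psi> u)) (axis j 1) u)"
    by (intro sum.cong refl arg_cong2[where f = inner] ddiff_cong_open[OF W_open _ u] transported_field_chart[symmetric])
  finally show ?thesis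
    by (simp only: divergence_chart[OF transported_field_ck_on transported_field_tan u])
qed

text \<open>The derivative of \<rho> is taken in a direction that varies with the point; expansion
  over \<open>Basis\<close> reduces it to fixed directions, for which \<open>ck_on\<close> provides
  continuity.\<close>

lemma localized_density_continuous:
  fixes \<rho> :: "'a \<Rightarrow> real"
  assumes \<rho>: "ck_on (Suc 0) \<Omega> \<rho>" and M\<Omega>: "M \<subseteq> \<Omega>"
  shows "continuous_on W (\<lambda>u. \<rho> (\<psi> u) * first_variation (\<psi> u)
    + frechet_derivative \<rho> (at (\<psi> u)) (transported_field (\<psi> u)))"
proof -
  have img: "\<psi> ` W \<subseteq> \<Omega>" using local_parametrizationD(4)[OF lp] M\<Omega> by blast
  have c\<psi>: "continuous_on W \<psi>" by (rule ck_on_imp_continuous_on[OF psi_smooth[OF lp, of 0]])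
  have c\<rho>: "continuous_on W (\<lambda>u. \<rho> (\<psi> u))"
    by (rule continuous_on_compose2[OF ck_on_imp_continuous_on[OF \<rho>] c\<psi> img])
  have "ck_on 0 \<Omega> (ddiff \<rho> b)" for b by (rule ck_on_ddiff[OF \<rho>])
  then have cd: "continuous_on W (\<lambda>u. ddiff \<rho> b (\<psi> u))" for b
    by (intro continuous_on_compose2[OF _ c\<psi> img]) simp
  have cX: "continuous_on W (\<lambda>u. transported_field (\<psi> u))"
    by (rule ck_on_imp_continuous_on[OF transported_field_ck_on])
  have cont: "continuous_on W (\<lambda>u. \<rho> (\<psi> u) * first_variation (\<psi> u)
      + (\<Sum>b\<in>Basis. (transported_field (\<psi> u) \<bullet> b) * ddiff \<rho> b (\<psi> u)))"
    by (intro continuous_intros c\<rho> cd cX first_variation_continuous)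
  have eq: "(\<Sum>b\<in>Basis. (transported_field (\<psi> u) \<bullet> b) * ddiff \<rho> b (\<psi> u))
      = frechet_derivative \<rho> (at (\<psi> u)) (transported_field (\<psi> u))" if "u \<in> W" for u
  proof -
    have lin: "linear (frechet_derivative \<rho> (at (\<psi> u)))"
      by (rule has_derivative_linear[OF ck_on_has_derivative[OF \<rho>]]) (use that img in auto)
    show ?thesis
      by (subst (3) euclidean_representation[symmetric]) (simp only: linear_sum[OF lin] linear_scale[OF lin] real_scaleR_def)
  qed
  show ?thesis by (rule continuous_on_eq[OF cont]) (simp add: eq)
qed

text \<open>The integrand is div (\<rho> S V). Multiplied by the volume density it becomes, in the
  chart, the Euclidean divergence of a compactly supported field, whose integral vanishes.\<close>

lemma localized_integral_zero:
  fixes \<rho> :: "'a \<Rightarrow> real"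
  assumes \<rho>: "ck_on (Suc 0) \<Omega> \<rho>" and M\<Omega>: "M \<subseteq> \<Omega>" "open \<Omega>"
    and C: "compact C" "C \<subseteq> W" and K: "closed K" "M \<inter> K \<subseteq> \<psi> ` C" "\<And>x. x \<in> \<Omega> \<Longrightarrow> x \<notin> K \<Longrightarrow> \<rho> x = 0"
    and meas: "(\<lambda>x. \<rho> x * first_variation x + frechet_derivative \<rho> (at x) (transported_field x)) \<in> borel_measurable vol"
  shows "(\<integral>x. \<rho> x * first_variation x + frechet_derivative \<rho> (at x) (transported_field x) \<partial>vol) = 0"
proof -
  let ?h = "\<lambda>x. \<rho> x * first_variation x + frechet_derivative \<rho> (at x) (transported_field x)"
  let ?b = "\<lambda>k u. transported_field (\<psi> u) \<bullet> dua k u"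
  let ?B = "\<lambda>k u. volume_density \<psi> u * ?b k u"
  have img: "\<psi> ` W \<subseteq> \<Omega>" using local_parametrizationD(4)[OF lp] M\<Omega> by blast
  \<comment> \<open>Injectivity of the chart turns the support condition in M into one in
    coordinates: the support lies over the compact set \<open>C\<close>.\<close>
  have C_of_K: "u \<in> C" if "u \<in> W" "\<psi> u \<in> K" for u
  proof -
    have "\<psi> u \<in> \<psi> ` C" using that K(2) psi_in_M[OF lp] by blast
    then show ?thesis using local_parametrizationD(6)[OF lp] that(1) C(2) by (auto dest: inj_onD)
  qed
  have \<rho>0: "frechet_derivative \<rho> (at x) v = 0" if "x \<in> \<Omega>" "x \<notin> K" for x v
    by (rule ddiff_zero_of_constant[of "\<Omega> - K"]) (use that K(1,3) M\<Omega>(2) in auto)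
  \<comment> \<open>The components of that field, extended by 0. They are of class C^1 on
    \<open>W\<close> and vanish off \<open>C\<close>, and these two open sets cover the coordinate
    space.\<close>
  define g where "g k u = (if u \<in> W then \<rho> (\<psi> u) * ?B k u else 0)" for k u
  have r: "ck_on (Suc 0) W (\<lambda>u. \<rho> (\<psi> u))"
    by (rule ck_on_compose[OF W_open M\<Omega>(2) psi_smooth[OF lp] \<rho> img])
  have B: "ck_on (Suc 0) W (?B k)" for k
    by (rule ck_on_mult[OF W_open volume_density_ck_on[OF lp] ck_on_inner[OF W_open transported_field_ck_on dua_ck_on]])
  have gW: "ck_on (Suc 0) W (g k)" for k
    by (subst ck_on_cong[OF W_open, where g = "\<lambda>u. \<rho> (\<psi> u) * ?B k u"])
      (simp add: g_def, rule ck_on_mult[OF W_open r B])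
  have opC: "open (- C)" using C(1) by (simp add: compact_imp_closed open_Compl)
  have gC: "g k u = 0" if "u \<notin> C" for k u
    using that C_of_K[of u] K(3) img by (auto simp: g_def)
  have g: "ck_on (Suc 0) UNIV (g k)" for k
  proof (rule ck_on_local)
    fix u :: "real^'n"
    show "\<exists>U. open U \<and> u \<in> U \<and> ck_on (Suc 0) U (g k)"
    proof (cases "u \<in> W")
      case True
      then show ?thesis using W_open gW by blast
    next
      case False
      then have "u \<in> - C" using C(2) by blast
      moreover have "ck_on (Suc 0) (- C) (g k)"
        by (subst ck_on_cong[OF opC, where g = "\<lambda>_. 0"]) (auto simp: gC ck_on_const simp del: ck_on.simps)
      ultimately show ?thesis using opC by blast
    qed
  qed
  have pt: "indicator W u * volume_density \<psi> u * ?h (\<psi> u) = (\<Sum>k\<in>UNIV. ddiff (g k) (axis k 1) u)" for u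
  proof (cases "u \<in> W")
    case True
    note u = True
    have \<psi>\<Omega>: "\<psi> u \<in> \<Omega>" using u img by blast
    have lin: "linear (frechet_derivative \<rho> (at (\<psi> u)))"
      by (rule has_derivative_linear[OF ck_on_has_derivative[OF \<rho> \<psi>\<Omega>]])
    have dr: "ddiff (\<lambda>u. \<rho> (\<psi> u)) (axis k 1) u = frechet_derivative \<rho> (at (\<psi> u)) (bas k u)" for k
      using frechet_derivative_at[OF has_derivative_compose[OF ck_on_has_derivative[OF psi_smooth[OF lp] u]
          ck_on_has_derivative[OF \<rho> \<psi>\<Omega>]]]
      by (metis coord_frame_def)
    have "ddiff (g k) (axis k 1) u = \<rho> (\<psi> u) * ddiff (?B k) (axis k 1) u
        + frechet_derivative \<rho> (at (\<psi> u)) (bas k u) * ?B k u" for k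
    proof -
      have "ddiff (g k) (axis k 1) u = ddiff (\<lambda>u. \<rho> (\<psi> u) * ?B k u) (axis k 1) u"
        by (rule ddiff_cong_open[OF W_open _ u]) (simp add: g_def)
      also have "\<dots> = \<rho> (\<psi> u) * ddiff (?B k) (axis k 1) u + ddiff (\<lambda>u. \<rho> (\<psi> u)) (axis k 1) u * ?B k u"
        by (rule ddiff_mult[OF r B u])
      finally show ?thesis by (simp only: dr)
    qed
    then have "(\<Sum>k\<in>UNIV. ddiff (g k) (axis k 1) u) = \<rho> (\<psi> u) * (\<Sum>k\<in>UNIV. ddiff (?B k) (axis k 1) u)
        + volume_density \<psi> u * (\<Sum>k\<in>UNIV. ?b k u * frechet_derivative \<rho> (at (\<psi> u)) (bas k u))"
      by (simp only: sum.distrib sum_distrib_left mult_ac)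
    also have "(\<Sum>k\<in>UNIV. ?b k u * frechet_derivative \<rho> (at (\<psi> u)) (bas k u))
        = frechet_derivative \<rho> (at (\<psi> u)) (\<Sum>k\<in>UNIV. ?b k u *\<^sub>R bas k u)"
      by (simp only: linear_sum[OF lin] linear_scale[OF lin] real_scaleR_def)
    also have "(\<Sum>k\<in>UNIV. ?b k u *\<^sub>R bas k u) = transported_field (\<psi> u)"
      by (rule tan_expand[OF u transported_field_tan[OF u]])
    also have "(\<Sum>k\<in>UNIV. ddiff (?B k) (axis k 1) u) = volume_density \<psi> u * first_variation (\<psi> u)"
      by (rule first_variation_divergence[OF u, symmetric])
    finally show ?thesis using u by (simp add: algebra_simps)
  next
    case False
    then have "u \<in> - C" using C(2) by blast
    then have "ddiff (g k) (axis k 1) u = 0" for k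
      by (intro ddiff_zero_of_constant[OF opC, of "g k" 0]) (simp_all add: gC)
    then show ?thesis using False by simp
  qed
  have "(\<integral>x. ?h x \<partial>vol) = (\<integral>u. indicator W u * volume_density \<psi> u * ?h (\<psi> u) \<partial>lborel)"
  proof (rule integral_chart[OF lp meas])
    fix x assume x: "x \<in> M" "x \<notin> \<psi> ` W"
    then have "x \<notin> K" using K(2) C(2) by blast
    then show "?h x = 0" using x(1) M\<Omega>(1) K(3) \<rho>0 by auto
  qed
  also have "\<dots> = (\<integral>u. (\<Sum>k\<in>UNIV. ddiff (g k) (axis k 1) u) \<partial>lborel)" by (simp only: pt)
  also have "\<dots> = (\<Sum>k\<in>UNIV. \<integral>u. ddiff (g k) (axis k 1) u \<partial>lborel)"
    by (rule Bochner_Integration.integral_sum) (rule integrable_ddiff_compact_support[OF g C(1) gC])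
  also have "\<dots> = 0"
    by (rule sum.neutral) (intro ballI integral_ddiff_compact_support[OF g C(1) gC])
  finally show ?thesis .
qed

end

text \<open>Summed over the partition of unity, the terms containing derivatives of the cutoff
  functions cancel, and \<open>first_variation\<close> alone remains.\<close>

lemma first_variation_integral: "(\<integral>x. first_variation x \<partial>vol) = 0"
proof -
  obtain \<S> :: "'a set set" and \<Omega> and \<rho> :: "'a set \<Rightarrow> 'a \<Rightarrow> real" where S: "finite \<S>"
    and \<Omega>: "open \<Omega>" "M \<subseteq> \<Omega>" and \<rho>: "\<And>S. S \<in> \<S> \<Longrightarrow> ck_on (Suc 0) \<Omega> (\<rho> S)"
    and one: "\<And>x. x \<in> \<Omega> \<Longrightarrow> (\<Sum>S\<in>\<S>. \<rho> S x) = 1"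
    and supp: "\<And>S. S \<in> \<S> \<Longrightarrow> \<exists>W (\<psi> :: real^'n \<Rightarrow> 'a) C K. local_parametrization M W \<psi> \<and> compact C \<and> C \<subseteq> W \<and>
       closed K \<and> M \<inter> K \<subseteq> \<psi> ` C \<and> (\<forall>x\<in>\<Omega>. x \<notin> K \<longrightarrow> \<rho> S x = 0)"
    using partition_of_unity by blast
  let ?h = "\<lambda>S x. \<rho> S x * first_variation x + frechet_derivative (\<rho> S) (at x) (transported_field x)"
  have int: "integrable vol (?h S)" if "S \<in> \<S>" for S
    by (rule integrable_vol_if_charts) (rule localized_density_continuous[OF _ \<rho>[OF that] \<Omega>(2)])
  have zero: "(\<integral>x. ?h S x \<partial>vol) = 0" if "S \<in> \<S>" for S
  proof -
    from supp[OF that] obtain W and \<psi> :: "real^'n \<Rightarrow> 'a" and C K where *: "local_parametrization M W \<psi> \<and> compact C \<and> C \<subseteq> W \<and>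
       closed K \<and> M \<inter> K \<subseteq> \<psi> ` C \<and> (\<forall>x\<in>\<Omega>. x \<notin> K \<longrightarrow> \<rho> S x = 0)" by (elim exE)
    show ?thesis
      by (rule localized_integral_zero[OF _ \<rho>[OF that] \<Omega>(2,1), of W \<psi> C K])
        (use * int[OF that] in auto)
  qed
  have "(\<integral>x. first_variation x \<partial>vol) = (\<integral>x. (\<Sum>S\<in>\<S>. ?h S x) \<partial>vol)"
  proof (rule Bochner_Integration.integral_cong[OF refl])
    fix x assume "x \<in> space vol"
    then have x: "x \<in> \<Omega>" using \<Omega>(2) by (auto simp: vol_simps(1))
    have "(\<Sum>S\<in>\<S>. frechet_derivative (\<rho> S) (at x) (transported_field x))
        = ddiff (\<lambda>x. \<Sum>S\<in>\<S>. \<rho> S x) (transported_field x) x"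
      by (rule ddiff_sum[OF \<rho> x, symmetric])
    also have "\<dots> = 0" by (rule ddiff_zero_of_constant[OF \<Omega>(1) one x])
    finally show "first_variation x = (\<Sum>S\<in>\<S>. ?h S x)"
      by (simp add: sum.distrib sum_distrib_right[symmetric] one[OF x])
  qed
  also have "\<dots> = (\<Sum>S\<in>\<S>. \<integral>x. ?h S x \<partial>vol)"
    by (rule Bochner_Integration.integral_sum) (rule int)
  also have "\<dots> = 0" by (rule sum.neutral) (simp add: zero)
  finally show ?thesis .
qed

lemma energy_derivative: "((\<lambda>t. energy TYPE('n) M (F t)) has_real_derivative 0) (at 0)"
proof -
  let ?e' = "\<lambda>t x. deriv (\<lambda>s. energy_density s x) t"
  \<comment> \<open>Half the range gives a compact time interval inside \<open>I\<close>, on which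
    the time derivative of the energy density is bounded.\<close>
  define \<delta> where "\<delta> = \<epsilon> / 2"
  have \<delta>: "\<delta> > 0" "{-\<delta>..\<delta>} \<subseteq> I" using variation_facts(1) by (auto simp: \<delta>_def)
  have der: "((\<lambda>s. energy_density s x) has_real_derivative ?e' t x) (at t)" if "t \<in> I" and x: "x \<in> M" for t x
  proof -
    obtain W and \<psi> :: "real^'n \<Rightarrow> 'a" and u where c: "local_parametrization M W \<psi>" "u \<in> W" "x = \<psi> u"
      using chart_at[OF x] by metis
    have D: "((\<lambda>s. energy_density s x) has_real_derivative ddiff (chart_energy \<psi>) (1, 0) (t, u)) (at t)"
      unfolding c(3) by (rule energy_density_derivative[OF c(1) \<open>t \<in> I\<close> c(2)])
    then show ?thesis by (simp only: DERIV_imp_deriv[OF D])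
  qed
  obtain K where K: "\<And>t x. t \<in> {-\<delta>..\<delta>} \<Longrightarrow> x \<in> M \<Longrightarrow> \<bar>?e' t x\<bar> \<le> K"
  proof (rule uniform_bound_if_local[of "{-\<delta>..\<delta>}" ?e'])
    fix W and \<psi> :: "real^'n \<Rightarrow> 'a" and C
    assume lp: "local_parametrization M W \<psi>" and C: "compact C" "C \<subseteq> W"
    have "ck_on 0 (I \<times> W) (ddiff (chart_energy \<psi>) (1, 0))" by (rule ck_on_ddiff[OF chart_energy_ck_on[OF lp]])
    then have "continuous_on ({-\<delta>..\<delta>} \<times> C) (ddiff (chart_energy \<psi>) (1, 0))"
      by (rule continuous_on_subset[OF ck_on_imp_continuous_on]) (use \<delta>(2) C(2) in blast)
    moreover have "compact ({-\<delta>..\<delta>} \<times> C)" by (intro compact_Times C(1) compact_Icc)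
    ultimately have "bounded (ddiff (chart_energy \<psi>) (1, 0) ` ({-\<delta>..\<delta>} \<times> C))"
      by (intro compact_imp_bounded compact_continuous_image)
    then obtain B where B: "\<And>z. z \<in> {-\<delta>..\<delta>} \<times> C \<Longrightarrow> \<bar>ddiff (chart_energy \<psi>) (1, 0) z\<bar> \<le> B" by (auto simp: bounded_iff)
    have "\<bar>?e' t (\<psi> u)\<bar> \<le> B" if "t \<in> {-\<delta>..\<delta>}" "u \<in> C" for t u
    proof -
      have "t \<in> I" "u \<in> W" using that \<delta>(2) C(2) by blast+
      from DERIV_imp_deriv[OF energy_density_derivative[OF lp this]] show ?thesis using B[of "(t, u)"] that by simp
    qed
    then show "\<exists>K. \<forall>t\<in>{-\<delta>..\<delta>}. \<forall>u\<in>C. \<bar>?e' t (\<psi> u)\<bar> \<le> K" by blast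
  qed blast
  have "((\<lambda>t. \<integral>x. energy_density t x \<partial>vol) has_real_derivative (\<integral>x. ?e' 0 x \<partial>vol)) (at 0)"
  proof (rule has_real_derivative_integral(1)[OF \<delta>(1), where w = "\<lambda>_. K"])
    fix t :: real assume "\<bar>t\<bar> < \<delta>"
    then have "t \<in> {-\<delta>..\<delta>}" by auto
    moreover from this have "t \<in> I" using \<delta>(2) by blast
    ultimately have t: "t \<in> {-\<delta>..\<delta>}" "t \<in> I" .
    show "integrable vol (energy_density t)"
    proof (rule integrable_vol_if_charts)
      fix W and \<psi> :: "real^'n \<Rightarrow> 'a"
      assume lp: "local_parametrization M W \<psi>"
      have "ck_on (Suc 0) W (\<lambda>u. chart_energy \<psi> (t, u))"
        by (rule ck_on_slice[OF chart_energy_ck_on[OF lp]]) (use t W_open[OF lp] in auto)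
      then have "continuous_on W (\<lambda>u. chart_energy \<psi> (t, u))" by (rule ck_on_imp_continuous_on)
      then show "continuous_on W (\<lambda>u. energy_density t (\<psi> u))"
        by (rule continuous_on_eq) (simp add: energy_density_chart[OF lp t(2)])
    qed
    fix x assume "x \<in> space vol"
    then have x: "x \<in> M" by (simp add: vol_simps(1))
    show "((\<lambda>t. energy_density t x) has_real_derivative ?e' t x) (at t)" by (rule der[OF t(2) x])
    show "\<bar>?e' t x\<bar> \<le> K" by (rule K[OF t(1) x])
  next
    show "integrable vol (\<lambda>_. K)" by (rule finite_measure.integrable_const[OF finite_measure_vol])
  qed
  moreover have "(\<integral>x. ?e' 0 x \<partial>vol) = 0"
  proof -
    have "(\<lambda>x. ?e' 0 x) = (\<lambda>x. 2 * first_variation x)" by (simp add: first_variation_def)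
    then show ?thesis using first_variation_integral by (simp only: integral_mult_right_zero)
  qed
  ultimately have "((\<lambda>t. 1/2 * (\<integral>x. energy_density t x \<partial>vol)) has_real_derivative 1/2 * 0) (at 0)"
    by (intro DERIV_cmult) simp
  then show ?thesis by (simp add: energy_def energy_density_def vol)
qed

end

theorem proposition1p1:
  fixes M :: "'a::euclidean_space set" and \<xi> :: "'a \<Rightarrow> 'a" and \<theta> :: real
  assumes "isoparametric_hypersurface TYPE('n::finite) M \<xi>"
    and "compact M"
    and "focal_angle M \<xi> \<theta>"
  shows "harmonic_map TYPE('n) M (focal_submanifold M \<xi> \<theta>) (parallel_map \<xi> \<theta>)"
proof -
  have iso: "isoparametric TYPE('n) M (riemannian_volume TYPE('n) M) \<xi> \<theta>"
  proof
    show "compact M" "isoparametric_hypersurface TYPE('n) M \<xi>" by (fact assms)+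
    show "embedded_submanifold TYPE('n) M"
      using assms(1) by (simp add: isoparametric_hypersurface_def sphere_hypersurface_def)
    show "sin \<theta> \<noteq> 0" using assms(3) by (simp add: focal_angle_def)
  qed simp
  show ?thesis
    unfolding harmonic_map_def focal_submanifold_def
  proof (intro conjI allI impI)
    show "smooth_map_on M (parallel_map \<xi> \<theta>)" by (rule isoparametric.smooth_phi[OF iso])
    fix \<epsilon> F
    assume "smooth_variation M (parallel_map \<xi> \<theta> ` M) (parallel_map \<xi> \<theta>) \<epsilon> F"
    then have "focal_variation TYPE('n) M (riemannian_volume TYPE('n) M) \<xi> \<theta> \<epsilon> F"
      using iso by (simp add: focal_variation_def focal_variation_axioms_def)
    then show "((\<lambda>t. energy TYPE('n) M (F t)) has_real_derivative 0) (at 0)"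
      by (rule focal_variation.energy_derivative)
  qed simp
qed

end
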